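(* Let $\overline{M}^{m+n}$ be a Riemannian manifold of dimension $m+n$, let $\Sigma$ be an $m$-dimensional submanifold isometrically immersed in $\overline{M}$ with $m\geq 3$, and let $q\in\Sigma$. Fix an integer $s$ with $2\leq s\leq m-1$. Assume that for each $(s+n)$-dimensional submanifold $M$ of $\overline{M}$ through $q$ which is totally geodesic at $q$ and satisfies $T_q^{\bot}\Sigma\subset T_qM$, the point $q$ is umbilic in $S_M:=M\cap\Sigma$ as a submanifold of $\overline{M}$ (equivalently, as a submanifold of $M$). Then the point $q\in\Sigma$ is umbilic.
   Context: $T_q^{\bot}\Sigma$ denotes the normal space of $\Sigma$ at $q$ in $T_q\overline{M}$. For a $k$-dimensional isometrically immersed submanifold $S$ of $\overline{M}$, the second fundamental form ${\rm II}_S$ is defined by the Gauss formula $\overline{\nabla}_XY=\nabla^S_XY+{\rm II}_S(X,Y)$, where $\overline{\nabla}$ is the Levi-Civita connection of $\overline{M}$ and $\nabla^S$ the induced connection, and the mean curvature vector of $S$ at $p$ is ${\rm H}(p)=\frac1k\,{\rm trace}\,{\rm II}_S(p)$. A point $p\in S$ is umbilic if ${\rm II}_S(u,v)=\overline{g}(u,v)\,{\rm H}(p)$ for all $u,v\in T_pS$. A submanifold $M$ is totally geodesic at $q\in M$ if every geodesic of $M$ with initial vector in $T_qM$ is a geodesic of $\overline{M}$ for all parameters in some neighborhood of $0$. Near $q$, the intersection $S_M=M\cap\Sigma$ is an $s$-dimensional submanifold (since $T_qM+T_q\Sigma=T_q\overline{M}$). *)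

theory Defs
  imports "HOL-Analysis.Analysis"
begin

section \<open>Smooth maps and smooth manifolds\<close>

text \<open>
  The predicates \<open>Ck_on\<close> and \<open>smooth_on\<close> are only meaningful on open sets, which is
  where they are used below: derivatives are taken in full neighbourhoods.
\<close>

primrec Ck_on :: "nat \<Rightarrow> 'a::real_normed_vector set \<Rightarrow> ('a \<Rightarrow> 'b::real_normed_vector) \<Rightarrow> bool" where
  "Ck_on 0 S f \<longleftrightarrow> continuous_on S f"
| "Ck_on (Suc k) S f \<longleftrightarrow>
     (\<forall>x\<in>S. f differentiable (at x)) \<and> (\<forall>v. Ck_on k S (\<lambda>x. frechet_derivative f (at x) v))"

definition smooth_on :: "'a::real_normed_vector set \<Rightarrow> ('a \<Rightarrow> 'b::real_normed_vector) \<Rightarrow> bool" where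
  "smooth_on S f \<longleftrightarrow> (\<forall>k. Ck_on k S f)"

text \<open>A chart is a pair of a domain and a coordinate map (irrelevant outside the domain).\<close>

type_synonym ('a, 'e) chart = "'a set \<times> ('a \<Rightarrow> 'e)"

abbreviation cdom :: "('a, 'e) chart \<Rightarrow> 'a set" where
  "cdom c \<equiv> fst c"

abbreviation coord :: "('a, 'e) chart \<Rightarrow> 'a \<Rightarrow> 'e" where
  "coord c \<equiv> snd c"

definition inv_coord :: "('a, 'e) chart \<Rightarrow> 'e \<Rightarrow> 'a" where
  "inv_coord c = inv_into (cdom c) (coord c)"

definition is_chart :: "('a::topological_space, 'e::euclidean_space) chart \<Rightarrow> bool" where
  "is_chart c \<longleftrightarrow> open (cdom c) \<and> open (coord c ` cdom c) \<and>
     homeomorphism (cdom c) (coord c ` cdom c) (coord c) (inv_coord c)"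

definition transition :: "('a, 'e) chart \<Rightarrow> ('a, 'e) chart \<Rightarrow> 'e \<Rightarrow> 'e" where
  "transition c d = coord d \<circ> inv_coord c"

definition compatible ::
    "('a::topological_space, 'e::euclidean_space) chart \<Rightarrow> ('a, 'e) chart \<Rightarrow> bool" where
  "compatible c d \<longleftrightarrow>
     smooth_on (coord c ` (cdom c \<inter> cdom d)) (transition c d) \<and>
     smooth_on (coord d ` (cdom c \<inter> cdom d)) (transition d c)"

text \<open>
  A smooth structure on a (Hausdorff, second countable) space is a maximal smooth atlas; the
  dimension of the manifold is the dimension of the model space \<open>'e\<close>.
\<close>

definition smooth_structure ::
    "('a::{t2_space, second_countable_topology}, 'e::euclidean_space) chart set \<Rightarrow> bool" where
  "smooth_structure A \<longleftrightarrow>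
     (\<forall>c\<in>A. is_chart c) \<and> (\<Union>c\<in>A. cdom c) = UNIV \<and>
     (\<forall>c\<in>A. \<forall>d\<in>A. compatible c d) \<and>
     (\<forall>c. is_chart c \<and> (\<forall>d\<in>A. compatible c d) \<longrightarrow> c \<in> A)"

section \<open>Riemannian metrics and the Levi-Civita connection\<close>

text \<open>
  Tangent vectors at a point of the domain of a chart are represented by their coordinate vectors
  in that chart. A Riemannian metric is given by its components: \<open>g c x u v\<close> is the inner
  product, at the point with coordinates \<open>x\<close> in the chart \<open>c\<close>, of the vectors with
  coordinates \<open>u\<close> and \<open>v\<close>; the components in different charts are related by the
  transformation law of covariant 2-tensors.
\<close>

definition inner_form :: "('e::real_vector \<Rightarrow> 'e \<Rightarrow> real) \<Rightarrow> bool" where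
  "inner_form Q \<longleftrightarrow> bilinear Q \<and> (\<forall>u v. Q u v = Q v u) \<and> (\<forall>u. u \<noteq> 0 \<longrightarrow> Q u u > 0)"

type_synonym ('a, 'e) metric_components = "('a, 'e) chart \<Rightarrow> 'e \<Rightarrow> 'e \<Rightarrow> 'e \<Rightarrow> real"

definition riemannian_metric ::
    "('a, 'e::euclidean_space) chart set \<Rightarrow> ('a, 'e) metric_components \<Rightarrow> bool" where
  "riemannian_metric A g \<longleftrightarrow>
     (\<forall>c\<in>A. (\<forall>x\<in>coord c ` cdom c. inner_form (g c x)) \<and>
            (\<forall>u v. smooth_on (coord c ` cdom c) (\<lambda>x. g c x u v))) \<and>
     (\<forall>c\<in>A. \<forall>d\<in>A. \<forall>x\<in>coord c ` (cdom c \<inter> cdom d). \<forall>u v.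
        g c x u v = g d (transition c d x)
          (frechet_derivative (transition c d) (at x) u)
          (frechet_derivative (transition c d) (at x) v))"

definition riemannian_manifold ::
    "('a::{t2_space, second_countable_topology}, 'e::euclidean_space) chart set \<Rightarrow>
     ('a, 'e) metric_components \<Rightarrow> bool" where
  "riemannian_manifold A g \<longleftrightarrow> smooth_structure A \<and> riemannian_metric A g"

text \<open>
  For metric components \<open>G\<close> on an open set, \<open>levi_civita G x u v\<close> is the covariant
  derivative at \<open>x\<close> of the constant coordinate field \<open>v\<close> in direction \<open>u\<close>, i.e.
  the Christoffel symbols, characterised as those of the unique torsion-free metric connection.
\<close>

definition levi_civita ::
    "('e::euclidean_space \<Rightarrow> 'e \<Rightarrow> 'e \<Rightarrow> real) \<Rightarrow> 'e \<Rightarrow> 'e \<Rightarrow> 'e \<Rightarrow> 'e" where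
  "levi_civita G x = (THE \<Gamma>. bilinear \<Gamma> \<and> (\<forall>u v. \<Gamma> u v = \<Gamma> v u) \<and>
     (\<forall>u v w. frechet_derivative (\<lambda>y. G y v w) (at x) u = G x (\<Gamma> u v) w + G x v (\<Gamma> u w)))"

text \<open>
  Covariant derivative at \<open>y\<close>, in direction \<open>u\<close>, of a vector field \<open>Z\<close> along a
  map \<open>f\<close> (all in coordinates): \<open>dZ(u) + \<Gamma>(df(u), Z)\<close>.
\<close>

definition cov_deriv ::
    "('e::euclidean_space \<Rightarrow> 'e \<Rightarrow> 'e \<Rightarrow> real) \<Rightarrow> ('d::real_normed_vector \<Rightarrow> 'e) \<Rightarrow> ('d \<Rightarrow> 'e) \<Rightarrow>
     'd \<Rightarrow> 'd \<Rightarrow> 'e" where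
  "cov_deriv G f Z y u =
     frechet_derivative Z (at y) u + levi_civita G (f y) (frechet_derivative f (at y) u) (Z y)"

text \<open>The component of \<open>w\<close> in the subspace \<open>T\<close>, orthogonally with respect to \<open>Q\<close>.\<close>

definition tangential :: "('e::real_vector \<Rightarrow> 'e \<Rightarrow> real) \<Rightarrow> 'e set \<Rightarrow> 'e \<Rightarrow> 'e" where
  "tangential Q T w = (THE t. t \<in> T \<and> (\<forall>u\<in>T. Q (w - t) u = 0))"

section \<open>Submanifolds, tangent spaces and geodesics\<close>

text \<open>Embedded submanifolds of dimension \<open>k\<close>, via slice charts.\<close>

definition submanifold ::
    "('a, 'e::euclidean_space) chart set \<Rightarrow> nat \<Rightarrow> 'a set \<Rightarrow> bool" where
  "submanifold A k M \<longleftrightarrow>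
     (\<forall>p\<in>M. \<exists>c\<in>A. p \<in> cdom c \<and>
        (\<exists>L. subspace L \<and> dim L = k \<and> coord c ` (cdom c \<inter> M) = coord c ` cdom c \<inter> L))"

text \<open>Velocities at \<open>p\<close> of smooth curves in \<open>S\<close>, in coordinates of the chart \<open>c\<close>.\<close>

definition tangent_space ::
    "('a, 'e::euclidean_space) chart \<Rightarrow> 'a set \<Rightarrow> 'a \<Rightarrow> 'e set" where
  "tangent_space c S p =
     {v. \<exists>(\<gamma>::real \<Rightarrow> 'a) e. e > 0 \<and> \<gamma> 0 = p \<and> (\<forall>t\<in>{-e<..<e}. \<gamma> t \<in> S \<inter> cdom c) \<and>
           smooth_on {-e<..<e} (coord c \<circ> \<gamma>) \<and> v = vector_derivative (coord c \<circ> \<gamma>) (at 0)}"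

text \<open>
  Geodesics, defined on an open interval \<open>I\<close>, of the submanifold \<open>M\<close> with its induced
  connection, which is the tangential part of the ambient one. With \<open>M = UNIV\<close> these are the
  geodesics of the ambient manifold.
\<close>

definition geodesic ::
    "('a::topological_space, 'e::euclidean_space) chart set \<Rightarrow> ('a, 'e) metric_components \<Rightarrow>
     'a set \<Rightarrow> real set \<Rightarrow> (real \<Rightarrow> 'a) \<Rightarrow> bool" where
  "geodesic A g M I \<gamma> \<longleftrightarrow>
     open I \<and> is_interval I \<and> continuous_on I \<gamma> \<and> \<gamma> ` I \<subseteq> M \<and>
     (\<forall>c\<in>A. smooth_on {t\<in>I. \<gamma> t \<in> cdom c} (coord c \<circ> \<gamma>) \<and>
        (\<forall>t\<in>I. \<gamma> t \<in> cdom c \<longrightarrow>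
           tangential (g c (coord c (\<gamma> t))) (tangent_space c M (\<gamma> t))
             (cov_deriv (g c) (coord c \<circ> \<gamma>) (\<lambda>\<tau>. vector_derivative (coord c \<circ> \<gamma>) (at \<tau>)) t 1)
           = 0))"

definition totally_geodesic_at ::
    "('a::topological_space, 'e::euclidean_space) chart set \<Rightarrow> ('a, 'e) metric_components \<Rightarrow>
     'a set \<Rightarrow> 'a \<Rightarrow> bool" where
  "totally_geodesic_at A g M q \<longleftrightarrow>
     (\<forall>I \<gamma>. 0 \<in> I \<and> geodesic A g M I \<gamma> \<and> \<gamma> 0 = q \<longrightarrow>
        (\<exists>e>0. {-e<..<e} \<subseteq> I \<and> geodesic A g UNIV {-e<..<e} \<gamma>))"

section \<open>Isometric immersions and the second fundamental form\<close>

definition coord_rep :: "('p, 'd) chart \<Rightarrow> ('a, 'e) chart \<Rightarrow> ('p \<Rightarrow> 'a) \<Rightarrow> 'd \<Rightarrow> 'e" where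
  "coord_rep b c \<iota> = coord c \<circ> \<iota> \<circ> inv_coord b"

definition differential ::
    "('p, 'd::euclidean_space) chart \<Rightarrow> ('a, 'e::euclidean_space) chart \<Rightarrow> ('p \<Rightarrow> 'a) \<Rightarrow> 'p \<Rightarrow> 'd \<Rightarrow> 'e"
  where
  "differential b c \<iota> p = frechet_derivative (coord_rep b c \<iota>) (at (coord b p))"

definition immersion ::
    "('p::topological_space, 'd::euclidean_space) chart set \<Rightarrow>
     ('a::topological_space, 'e::euclidean_space) chart set \<Rightarrow> ('p \<Rightarrow> 'a) \<Rightarrow> bool" where
  "immersion B A \<iota> \<longleftrightarrow> continuous_on UNIV \<iota> \<and>
     (\<forall>b\<in>B. \<forall>c\<in>A. smooth_on (coord b ` (cdom b \<inter> \<iota> -` cdom c)) (coord_rep b c \<iota>) \<and>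
        (\<forall>p\<in>cdom b \<inter> \<iota> -` cdom c. inj (differential b c \<iota> p)))"

definition isometric_immersion ::
    "('p::topological_space, 'd::euclidean_space) chart set \<Rightarrow> ('p, 'd) metric_components \<Rightarrow>
     ('a::topological_space, 'e::euclidean_space) chart set \<Rightarrow> ('a, 'e) metric_components \<Rightarrow>
     ('p \<Rightarrow> 'a) \<Rightarrow> bool" where
  "isometric_immersion B h A g \<iota> \<longleftrightarrow> immersion B A \<iota> \<and>
     (\<forall>b\<in>B. \<forall>c\<in>A. \<forall>p\<in>cdom b \<inter> \<iota> -` cdom c. \<forall>u v.
        h b (coord b p) u v =
          g c (coord c (\<iota> p)) (differential b c \<iota> p u) (differential b c \<iota> p v))"

text \<open>The normal space at \<open>p\<close> of the immersed manifold, in coordinates of \<open>c\<close> at \<open>\<iota> p\<close>.\<close>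

definition normal_space_at ::
    "('p, 'd::euclidean_space) chart \<Rightarrow> ('a, 'e::euclidean_space) chart \<Rightarrow>
     ('a, 'e) metric_components \<Rightarrow> ('p \<Rightarrow> 'a) \<Rightarrow> 'p \<Rightarrow> 'e set" where
  "normal_space_at b c g \<iota> p = {w. \<forall>u. g c (coord c (\<iota> p)) w (differential b c \<iota> p u) = 0}"

text \<open>
  Local vector fields (in coordinates of \<open>b\<close>) of the immersed manifold, defined near \<open>p\<close>
  and tangent to \<open>S\<close> at the points of \<open>S\<close>.
\<close>

definition tangent_field_near ::
    "('p::topological_space, 'd::euclidean_space) chart \<Rightarrow> 'p set \<Rightarrow> 'p \<Rightarrow> ('d \<Rightarrow> 'd) \<Rightarrow> bool" where
  "tangent_field_near b S p X \<longleftrightarrow>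
     (\<exists>V. open V \<and> p \<in> V \<and> V \<subseteq> cdom b \<and> smooth_on (coord b ` V) X \<and>
        (\<forall>x\<in>S \<inter> V. X (coord b x) \<in> tangent_space b S x))"

text \<open>
  In the following, \<open>S\<close> is a subset of the immersed manifold which is a submanifold near
  \<open>p\<close>; it is regarded as a submanifold of the ambient manifold through the immersion
  \<open>\<iota>\<close> (\<open>S = UNIV\<close> being the immersed manifold itself), and its tangent vectors are
  identified with their images under the differential of \<open>\<iota>\<close>.
\<close>

definition ambient_derivative ::
    "('p, 'd::euclidean_space) chart \<Rightarrow> ('a, 'e::euclidean_space) chart \<Rightarrow>
     ('a, 'e) metric_components \<Rightarrow> ('p \<Rightarrow> 'a) \<Rightarrow> 'p \<Rightarrow> ('d \<Rightarrow> 'd) \<Rightarrow> ('d \<Rightarrow> 'd) \<Rightarrow> 'e" where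
  "ambient_derivative b c g \<iota> p X Y =
     cov_deriv (g c) (coord_rep b c \<iota>)
       (\<lambda>y. frechet_derivative (coord_rep b c \<iota>) (at y) (Y y)) (coord b p) (X (coord b p))"

definition induced_derivative ::
    "('p, 'd::euclidean_space) chart \<Rightarrow> ('a, 'e::euclidean_space) chart \<Rightarrow>
     ('a, 'e) metric_components \<Rightarrow> ('p \<Rightarrow> 'a) \<Rightarrow> 'p set \<Rightarrow> 'p \<Rightarrow> ('d \<Rightarrow> 'd) \<Rightarrow> ('d \<Rightarrow> 'd) \<Rightarrow> 'e" where
  "induced_derivative b c g \<iota> S p X Y =
     tangential (g c (coord c (\<iota> p))) (differential b c \<iota> p ` tangent_space b S p)
       (ambient_derivative b c g \<iota> p X Y)"

text \<open>The second fundamental form, by the Gauss formula.\<close>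

definition second_fundamental_form ::
    "('p::topological_space, 'd::euclidean_space) chart \<Rightarrow> ('a, 'e::euclidean_space) chart \<Rightarrow>
     ('a, 'e) metric_components \<Rightarrow> ('p \<Rightarrow> 'a) \<Rightarrow> 'p set \<Rightarrow> 'p \<Rightarrow> 'd \<Rightarrow> 'd \<Rightarrow> 'e" where
  "second_fundamental_form b c g \<iota> S p u v =
     (THE w. \<exists>X Y. tangent_field_near b S p X \<and> tangent_field_near b S p Y \<and>
        X (coord b p) = u \<and> Y (coord b p) = v \<and>
        ambient_derivative b c g \<iota> p X Y = induced_derivative b c g \<iota> S p X Y + w)"

definition pullback_form ::
    "('p, 'd::euclidean_space) chart \<Rightarrow> ('a, 'e::euclidean_space) chart \<Rightarrow>
     ('a, 'e) metric_components \<Rightarrow> ('p \<Rightarrow> 'a) \<Rightarrow> 'p \<Rightarrow> 'd \<Rightarrow> 'd \<Rightarrow> real" where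
  "pullback_form b c g \<iota> p u v =
     g c (coord c (\<iota> p)) (differential b c \<iota> p u) (differential b c \<iota> p v)"

definition orthonormal_basis :: "('d::real_vector \<Rightarrow> 'd \<Rightarrow> real) \<Rightarrow> 'd set \<Rightarrow> 'd set \<Rightarrow> bool" where
  "orthonormal_basis Q T E \<longleftrightarrow>
     E \<subseteq> T \<and> span E = T \<and> (\<forall>e\<in>E. \<forall>e'\<in>E. Q e e' = (if e = e' then 1 else 0))"

definition mean_curvature ::
    "('p::topological_space, 'd::euclidean_space) chart \<Rightarrow> ('a, 'e::euclidean_space) chart \<Rightarrow>
     ('a, 'e) metric_components \<Rightarrow> ('p \<Rightarrow> 'a) \<Rightarrow> 'p set \<Rightarrow> 'p \<Rightarrow> 'e" where
  "mean_curvature b c g \<iota> S p =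
     (1 / real (dim (tangent_space b S p))) *\<^sub>R
     (\<Sum>e\<in>(SOME E. orthonormal_basis (pullback_form b c g \<iota> p) (tangent_space b S p) E).
        second_fundamental_form b c g \<iota> S p e e)"

definition umbilic_at ::
    "('p::topological_space, 'd::euclidean_space) chart set \<Rightarrow>
     ('a, 'e::euclidean_space) chart set \<Rightarrow> ('a, 'e) metric_components \<Rightarrow>
     ('p \<Rightarrow> 'a) \<Rightarrow> 'p set \<Rightarrow> 'p \<Rightarrow> bool" where
  "umbilic_at B A g \<iota> S p \<longleftrightarrow> p \<in> S \<and>
     (\<forall>b\<in>B. \<forall>c\<in>A. p \<in> cdom b \<and> \<iota> p \<in> cdom c \<longrightarrow>
        (\<forall>u\<in>tangent_space b S p. \<forall>v\<in>tangent_space b S p.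
           second_fundamental_form b c g \<iota> S p u v =
             pullback_form b c g \<iota> p u v *\<^sub>R mean_curvature b c g \<iota> S p))"

end

theory Submission
  imports Defs
begin

text \<open>
  Fix charts at \<open>q\<close> and let \<open>f\<close> be the coordinate expression of the immersion. Modulo the tangent space
  of \<open>\<Sigma>\<close>, the second fundamental forms of \<open>\<Sigma>\<close> and of any submanifold of \<open>\<Sigma>\<close> through \<open>q\<close> are given by
  the same expression \<open>D\<^sup>2f(u, v) + \<Gamma>(Df u, Df v)\<close>. Hence if \<open>q\<close> is umbilic in \<open>S\<^sub>M\<close>, the second fundamental
  form of \<open>\<Sigma>\<close>, restricted to \<open>T\<^sub>qS\<^sub>M\<close>, is a multiple of the metric by a fixed normal vector. For every
  \<open>s\<close>-dimensional \<open>P \<subseteq> T\<^sub>q\<Sigma>\<close> there is an admissible \<open>M\<close> with \<open>T\<^sub>qS\<^sub>M = P\<close>, namely the image under the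
  exponential map at \<open>q\<close> of a neighbourhood of \<open>0\<close> in \<open>P \<oplus> T\<^sub>q\<^sup>\<bottom>\<Sigma>\<close>. As \<open>s \<ge> 2\<close>, every pair of vectors
  lies in such a \<open>P\<close>, so the vectors obtained from the various \<open>P\<close> agree.
\<close>

section \<open>Calculus of \<open>C\<^sup>k\<close> maps\<close>

text \<open>The hypothesis on \<open>M\<close> concerns all of its geodesics issuing from
  \<open>q\<close>, so it is not enough to exhibit some that are ambient: uniqueness is needed for
  the geodesic equation of \<open>M\<close>, whose right-hand side contains the projection onto the
  tangent spaces. A chart in which the candidates are straight lines makes this manageable, and such
  a chart needs a smooth exponential map, hence smooth flows.

  The choice of \<open>M\<close> is governed by a left inverse \<open>\<tau>\<close> of the
  differential of \<open>f\<close> at \<open>q\<close>, taken in a normal chart, whose kernel is the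
  normal space. The preimage \<open>W = {w. \<tau> w \<in> P}\<close> contains the normal space and
  has dimension \<open>s + n\<close>, and the slice of \<open>W\<close> meets \<Sigma> where
  \<open>\<tau> (f y) \<in> P\<close>. Since \<open>\<tau> \<circ> f\<close> has the identity as
  derivative at \<open>q\<close>, it is a local diffeomorphism that flattens the intersections for
  all \<open>P\<close> at once.

  Second fundamental forms are compared in an arbitrary chart, after projection to the normal space
  of \<Sigma>. The projection also removes any component tangent to \<Sigma> of the mean curvature
  vector of the intersection.\<close>

lemma Ck_on_congI:
  assumes "Ck_on k S f" "open S" "\<And>x. x \<in> S \<Longrightarrow> f x = g x"
  shows "Ck_on k S g"
  using assms
proof (induction k arbitrary: f g)
  case 0
  then show ?case using continuous_on_cong[of S S f g] by simp
next
  case (Suc k)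
  have eq: "frechet_derivative f (at x) = frechet_derivative g (at x)" if "x \<in> S" for x
    using Suc.prems that by (intro frechet_derivative_transform_within_open[of f x S g]) auto
  have "g differentiable (at x)" if "x \<in> S" for x
  proof -
    have "(f has_derivative frechet_derivative f (at x)) (at x)"
      using Suc.prems that by (auto simp: frechet_derivative_works)
    then have "(g has_derivative frechet_derivative f (at x)) (at x)"
      by (rule has_derivative_transform_within_open[OF _ Suc.prems(2) that Suc.prems(3)])
    then show ?thesis by (auto simp: differentiable_def)
  qed
  moreover have "Ck_on k S (\<lambda>x. frechet_derivative g (at x) v)" for v
    by (rule Suc.IH[OF _ Suc.prems(2), of "\<lambda>x. frechet_derivative f (at x) v"])
      (use Suc.prems(1) eq in simp_all)
  ultimately show ?case by simp
qed

text \<open>Inductive step of most regularity proofs below: the derivative may be exhibited in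
  whatever closed form is at hand, and only its values in each fixed direction \<open>v\<close> have
  to be regular. That form usually has the same shape as the original map, so an induction
  generalised over the map closes.\<close>

lemma Ck_on_SucI:
  assumes "open S" "\<And>x. x \<in> S \<Longrightarrow> (f has_derivative f' x) (at x)"
    and "\<And>v. Ck_on k S (\<lambda>x. f' x v)"
  shows "Ck_on (Suc k) S f"
proof -
  have eq: "f' x = frechet_derivative f (at x)" if "x \<in> S" for x
    using assms(2)[OF that] by (rule frechet_derivative_at)
  have "Ck_on k S (\<lambda>x. frechet_derivative f (at x) v)" for v
    by (rule Ck_on_congI[OF assms(3)[of v] assms(1)]) (simp add: eq)
  then show ?thesis using assms(2) by (auto simp: differentiable_def)
qed

lemma Ck_on_has_derivative:
  assumes "Ck_on (Suc k) S f" "x \<in> S"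
  shows "(f has_derivative frechet_derivative f (at x)) (at x)"
  using assms by (auto simp: frechet_derivative_works)

lemma Ck_on_Suc_imp: "Ck_on (Suc k) S f \<Longrightarrow> Ck_on k S f"
proof (induction k arbitrary: f)
  case 0
  then show ?case
    by (auto intro!: continuous_at_imp_continuous_on differentiable_imp_continuous_within)
next
  case (Suc k)
  then show ?case using Ck_on.simps(2) by metis
qed

lemma Ck_on_le: "Ck_on l S f \<Longrightarrow> k \<le> l \<Longrightarrow> Ck_on k S f"
  by (induction l) (auto simp del: Ck_on.simps simp: le_Suc_eq dest: Ck_on_Suc_imp)

lemma Ck_on_continuous: "Ck_on k S f \<Longrightarrow> continuous_on S f"
  using Ck_on_le[of k S f 0] by simp

lemma Ck_on_subset: "Ck_on k S f \<Longrightarrow> T \<subseteq> S \<Longrightarrow> Ck_on k T f"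
  by (induction k arbitrary: f) (auto intro: continuous_on_subset)

lemma Ck_on_const: "Ck_on k S (\<lambda>x. c)"
  by (induction k arbitrary: c) auto

lemma Ck_on_linear:
  assumes "bounded_linear L" "open S"
  shows "Ck_on k S L"
proof (cases k)
  case 0
  then show ?thesis using assms by (auto intro: linear_continuous_on)
next
  case (Suc l)
  show ?thesis unfolding Suc
    by (rule Ck_on_SucI[OF assms(2) bounded_linear_imp_has_derivative[OF assms(1)] Ck_on_const])
qed

lemma Ck_on_linear_compose:
  assumes "bounded_linear L" "Ck_on k S f" "open S"
  shows "Ck_on k S (\<lambda>x. L (f x))"
  using assms(2)
proof (induction k arbitrary: f)
  case 0
  then show ?case by (simp add: bounded_linear.continuous_on[OF assms(1)])
next
  case (Suc k)
  show ?case
  proof (rule Ck_on_SucI[OF assms(3)])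
    fix x assume "x \<in> S"
    then show "((\<lambda>x. L (f x)) has_derivative (\<lambda>v. L (frechet_derivative f (at x) v))) (at x)"
      using Ck_on_has_derivative[OF Suc.prems] by (intro bounded_linear.has_derivative[OF assms(1)])
  next
    fix v show "Ck_on k S (\<lambda>x. L (frechet_derivative f (at x) v))"
      using Suc.prems by (intro Suc.IH) simp
  qed
qed

lemma Ck_on_add:
  assumes "Ck_on k S f" "Ck_on k S g" "open S"
  shows "Ck_on k S (\<lambda>x. f x + g x)"
  using assms(1,2)
proof (induction k arbitrary: f g)
  case 0
  then show ?case by (auto intro: continuous_on_add)
next
  case (Suc k)
  show ?case
  proof (rule Ck_on_SucI[OF assms(3)])
    fix x assume "x \<in> S"
    then show "((\<lambda>x. f x + g x) has_derivative (\<lambda>v. frechet_derivative f (at x) v + frechet_derivative g (at x) v)) (at x)"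
      using Ck_on_has_derivative[OF Suc.prems(1)] Ck_on_has_derivative[OF Suc.prems(2)]
      by (intro has_derivative_add)
  next
    fix v show "Ck_on k S (\<lambda>x. frechet_derivative f (at x) v + frechet_derivative g (at x) v)"
      using Suc.prems by (intro Suc.IH) simp_all
  qed
qed

lemma Ck_on_bilinear:
  assumes B: "bounded_bilinear B" and "Ck_on k S f" "Ck_on k S g" "open S"
  shows "Ck_on k S (\<lambda>x. B (f x) (g x))"
  using assms(2,3)
proof (induction k arbitrary: f g)
  case 0
  then show ?case by (simp add: bounded_bilinear.continuous_on[OF B])
next
  case (Suc k)
  show ?case
  proof (rule Ck_on_SucI[OF assms(4)])
    fix x assume "x \<in> S"
    then show "((\<lambda>x. B (f x) (g x)) has_derivative
      (\<lambda>v. B (f x) (frechet_derivative g (at x) v) + B (frechet_derivative f (at x) v) (g x))) (at x)"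
      using Ck_on_has_derivative[OF Suc.prems(1)] Ck_on_has_derivative[OF Suc.prems(2)]
      by (intro bounded_bilinear.FDERIV[OF B])
  next
    fix v show "Ck_on k S (\<lambda>x. B (f x) (frechet_derivative g (at x) v) + B (frechet_derivative f (at x) v) (g x))"
      using Suc.prems by (intro Ck_on_add Suc.IH assms) (auto dest: Ck_on_Suc_imp simp del: Ck_on.simps, simp_all)
  qed
qed

lemmas Ck_on_scaleR = Ck_on_bilinear[OF bounded_bilinear_scaleR]

lemma Ck_on_diff:
  assumes "Ck_on k S f" "Ck_on k S g" "open S"
  shows "Ck_on k S (\<lambda>x. f x - g x)"
  using Ck_on_add[OF assms(1) Ck_on_linear_compose[OF bounded_linear_minus[OF bounded_linear_ident] assms(2,3)] assms(3)]
  by simp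

lemma Ck_on_sum:
  assumes "\<And>i. i \<in> J \<Longrightarrow> Ck_on k S (f i)" "open S"
  shows "Ck_on k S (\<lambda>x. \<Sum>i\<in>J. f i x)"
  using assms by (induction J rule: infinite_finite_induct) (auto intro: Ck_on_const Ck_on_add)

text \<open>\<open>Ck_on\<close> controls derivatives in fixed directions, whereas the chain rule
  evaluates the derivative of \<open>f\<close> in a direction that moves with \<open>x\<close>.
  Expanding this direction in \<open>Basis\<close> leaves regular coefficients times derivatives in
  fixed directions, to which the induction hypothesis applies.\<close>

lemma Ck_on_compose:
  fixes f :: "'b::euclidean_space \<Rightarrow> 'c::real_normed_vector" and g :: "'a::real_normed_vector \<Rightarrow> 'b"
  assumes "Ck_on k S g" "Ck_on k T f" "open S" "open T" "g ` S \<subseteq> T"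
  shows "Ck_on k S (\<lambda>x. f (g x))"
  using assms(1,2)
proof (induction k arbitrary: f)
  case 0
  then show ?case using assms(5) continuous_on_compose2[of T f S g] by simp
next
  case (Suc k)
  show ?case
  proof (rule Ck_on_SucI[OF assms(3)])
    fix x assume x: "x \<in> S"
    have fg: "(f has_derivative frechet_derivative f (at (g x))) (at (g x))"
      using x assms(5) by (intro Ck_on_has_derivative[OF Suc.prems(2)]) auto
    have comp: "((\<lambda>x. f (g x)) has_derivative (\<lambda>v. frechet_derivative f (at (g x)) (frechet_derivative g (at x) v))) (at x)"
      using Ck_on_has_derivative[OF Suc.prems(1) x] fg
      by (rule has_derivative_compose)
    have "frechet_derivative f (at (g x)) w = (\<Sum>i\<in>Basis. (w \<bullet> i) *\<^sub>R frechet_derivative f (at (g x)) i)" for w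
    proof -
      interpret L: linear "frechet_derivative f (at (g x))"
        using has_derivative_linear[OF fg] .
      show ?thesis
        by (subst euclidean_representation[of w, symmetric]) (simp only: L.sum L.scaleR)
    qed
    then have "(\<lambda>v. frechet_derivative f (at (g x)) (frechet_derivative g (at x) v)) =
        (\<lambda>v. \<Sum>i\<in>Basis. (frechet_derivative g (at x) v \<bullet> i) *\<^sub>R frechet_derivative f (at (g x)) i)"
      by (rule ext)
    from comp[unfolded this] show "((\<lambda>x. f (g x)) has_derivative
      (\<lambda>v. \<Sum>i\<in>Basis. (frechet_derivative g (at x) v \<bullet> i) *\<^sub>R frechet_derivative f (at (g x)) i)) (at x)" .
  next
    fix v
    show "Ck_on k S (\<lambda>x. \<Sum>i\<in>Basis. (frechet_derivative g (at x) v \<bullet> i) *\<^sub>R frechet_derivative f (at (g x)) i)"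
      using Suc.prems assms(3) Ck_on_Suc_imp[OF Suc.prems(1)]
      by (intro Ck_on_sum Ck_on_scaleR Suc.IH Ck_on_linear_compose[OF bounded_linear_inner_left]) simp_all
  qed
qed

lemma Ck_on_Pair:
  assumes "Ck_on k S f" "Ck_on k S g" "open S"
  shows "Ck_on k S (\<lambda>x. (f x, g x))"
proof -
  have "bounded_linear (\<lambda>a. (a, 0))" "bounded_linear (\<lambda>a. (0, a))"
    by (auto intro!: bounded_linear_Pair bounded_linear_ident bounded_linear_zero)
  then have "Ck_on k S (\<lambda>x. (f x, 0) + (0, g x))"
    using assms by (intro Ck_on_add Ck_on_linear_compose[where L = "\<lambda>a. (a, 0)"]
      Ck_on_linear_compose[where L = "\<lambda>a. (0, a)"])
  then show ?thesis by simp
qed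

section \<open>Operator-valued maps and their inverses\<close>

lemma Ck_on_blinfunI:
  fixes F :: "'a::real_normed_vector \<Rightarrow> ('b::euclidean_space \<Rightarrow>\<^sub>L 'c::real_normed_vector)"
  assumes "\<And>i. i \<in> Basis \<Longrightarrow> Ck_on k S (\<lambda>x. F x i)" "open S"
  shows "Ck_on k S F"
proof -
  let ?L = "\<lambda>i c. blinfun_scaleR_left c o\<^sub>L blinfun_inner_left i :: 'b \<Rightarrow>\<^sub>L 'c"
  have L: "bounded_linear (?L i)" for i
    using bounded_linear_compose[OF bounded_bilinear.bounded_linear_left[OF bounded_bilinear_blinfun_compose]
      bounded_linear_blinfun_scaleR_left] .
  \<comment> \<open>An operator on a finite-dimensional space is recovered linearly from its values
    on a basis, so regularity of these values gives regularity in operator norm.\<close>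
  have "F x = (\<Sum>i\<in>Basis. ?L i (F x i))" for x
    by (rule blinfun_euclidean_eqI)
      (simp add: blinfun.sum_left blinfun_inner_left.rep_eq inner_Basis if_distrib if_distribR sum.delta cong: if_cong)
  moreover have "Ck_on k S (\<lambda>x. \<Sum>i\<in>Basis. ?L i (F x i))"
    using assms by (intro Ck_on_sum Ck_on_linear_compose[OF L]) auto
  ultimately show ?thesis by presburger
qed

lemma Ck_on_blinfun_apply:
  assumes "Ck_on k S F" "Ck_on k S g" "open S"
  shows "Ck_on k S (\<lambda>x. blinfun_apply (F x) (g x))"
  using Ck_on_bilinear[OF bounded_bilinear_blinfun_apply assms] .

lemma Ck_on_blinfun_apply_const:
  assumes "Ck_on k S F" "open S"
  shows "Ck_on k S (\<lambda>x. blinfun_apply (F x) v)"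
  using Ck_on_blinfun_apply[OF assms(1) Ck_on_const assms(2)] .

lemma Blinfun_derivative:
  "(f has_derivative f') F \<Longrightarrow> blinfun_apply (Blinfun f') = f'"
  by (rule bounded_linear_Blinfun_apply) (rule has_derivative_bounded_linear)

text \<open>Upgrades regularity direction by direction to regularity of the derivative as an
  operator, the form needed for inversion and for estimates uniform in the direction.\<close>

lemma Ck_on_Blinfun_derivative:
  fixes f :: "'a::euclidean_space \<Rightarrow> 'b::real_normed_vector"
  assumes "Ck_on (Suc k) S f" "open S"
  shows "Ck_on k S (\<lambda>x. Blinfun (frechet_derivative f (at x)))"
proof (rule Ck_on_blinfunI)
  fix i :: 'a
  have "Ck_on k S (\<lambda>x. frechet_derivative f (at x) i)" using assms by simp
  then show "Ck_on k S (\<lambda>x. blinfun_apply (Blinfun (frechet_derivative f (at x))) i)"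
    by (rule Ck_on_congI[OF _ assms(2)]) (simp add: Blinfun_derivative[OF Ck_on_has_derivative[OF assms(1)]])
qed (rule assms)

text \<open>A product rule in which \<open>G\<close> is merely continuous: since \<open>f\<close>
  vanishes at \<open>x\<close>, the term \<open>B (G y - G x) (f y)\<close> is a quantity tending to
  0 times one of order \<open>norm (y - x)\<close>. This permits differentiating an inverse that is
  so far known only to be continuous.\<close>

lemma has_derivative_bilinear_vanishing:
  assumes B: "bounded_bilinear B" and G: "isCont G x" and f: "(f has_derivative f') (at x)" and 0: "f x = 0"
  shows "((\<lambda>y. B (G y) (f y)) has_derivative (\<lambda>h. B (G x) (f' h))) (at x)"
proof -
  interpret bounded_bilinear B by fact
  obtain K where K: "0 < K" "\<And>a b. norm (B a b) \<le> norm a * norm b * K"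
    using pos_bounded by blast
  have f': "bounded_linear f'" using f by (rule has_derivative_bounded_linear)
  have lim: "((\<lambda>y. norm (f y - f x - f' (y - x)) / norm (y - x)) \<longlongrightarrow> 0) (at x)"
    using f by (simp add: has_derivative_iff_norm)
  have "((\<lambda>y. B (G y - G x) (f y)) has_derivative (\<lambda>h. 0)) (at x)"
    unfolding has_derivative_iff_norm
  proof (intro conjI bounded_linear_zero)
    let ?b = "\<lambda>y. norm (G y - G x) * (norm (f y - f x - f' (y - x)) / norm (y - x) + onorm f') * K"
    have "(?b \<longlongrightarrow> norm (G x - G x) * (0 + onorm f') * K) (at x)"
      using G unfolding isCont_def by (intro tendsto_intros lim)
    then have b0: "(?b \<longlongrightarrow> 0) (at x)" by simp
    show "((\<lambda>y. norm (B (G y - G x) (f y) - B (G x - G x) (f x) - 0) / norm (y - x)) \<longlongrightarrow> 0) (at x)"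
    proof (rule Lim_null_comparison[OF _ b0], rule always_eventually, rule allI)
      fix y
      show "norm (norm (B (G y - G x) (f y) - B (G x - G x) (f x) - 0) / norm (y - x)) \<le> ?b y"
      proof (cases "y = x")
        case False
        have "norm (f y) \<le> norm (f y - f x - f' (y - x)) + norm (f' (y - x))"
          using norm_triangle_sub[of "f y" "f' (y - x)"] 0 by simp
        also have "norm (f' (y - x)) \<le> onorm f' * norm (y - x)" by (rule onorm[OF f'])
        finally have h1: "norm (f y) / norm (y - x) \<le> norm (f y - f x - f' (y - x)) / norm (y - x) + onorm f'" (is "_ \<le> ?r")
          using False by (simp add: field_simps)
        have "norm (B (G y - G x) (f y)) / norm (y - x) \<le> norm (G y - G x) * (norm (f y) / norm (y - x)) * K"
          using divide_right_mono[OF K(2)[of "G y - G x" "f y"], of "norm (y - x)"] by (simp add: field_simps)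
        also have "\<dots> \<le> norm (G y - G x) * ?r * K"
          using K(1) by (intro mult_right_mono mult_left_mono h1) simp_all
        finally show ?thesis using 0 by (simp add: zero_right)
      qed (use 0 K in \<open>simp add: zero_right\<close>)
    qed
  qed
  moreover have "((\<lambda>y. B (G x) (f y)) has_derivative (\<lambda>h. B (G x) (f' h))) (at x)"
    by (rule bounded_linear.has_derivative[OF bounded_linear_right f])
  ultimately have "((\<lambda>y. B (G y - G x) (f y) + B (G x) (f y)) has_derivative (\<lambda>h. 0 + B (G x) (f' h))) (at x)"
    by (rule has_derivative_add)
  then show ?thesis by (simp add: diff_left)
qed

text \<open>Everything follows from the identity \<open>diff\<close>, which expresses
  \<open>G y - G x\<close> through \<open>F y - F x\<close>. It gives first continuity of the
  inverse, then its derivative: minus \<open>G\<close>, the derivative of \<open>F\<close>, and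
  \<open>G\<close> composed. This expression is as regular as \<open>G\<close> and the derivative of
  \<open>F\<close>, so regularity climbs by induction.\<close>

lemma Ck_on_blinfun_inverse:
  fixes F :: "'a::real_normed_vector \<Rightarrow> ('b::real_normed_vector \<Rightarrow>\<^sub>L 'c::real_normed_vector)"
  assumes F: "Ck_on k S F" and S: "open S"
    and inv: "\<And>x. x \<in> S \<Longrightarrow> G x o\<^sub>L F x = id_blinfun" "\<And>x. x \<in> S \<Longrightarrow> F x o\<^sub>L G x = id_blinfun"
  shows "Ck_on k S G"
proof -
  have diff: "G y - G x = - (G y o\<^sub>L (F y - F x) o\<^sub>L G x)" if "x \<in> S" "y \<in> S" for x y
  proof (rule blinfun_eqI)
    fix v
    have "G y (F y w) = w" for w
      using inv(1)[OF that(2)] by (metis blinfun_apply_blinfun_compose blinfun_apply_id_blinfun)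
    moreover have "F x (G x w) = w" for w
      using inv(2)[OF that(1)] by (metis blinfun_apply_blinfun_compose blinfun_apply_id_blinfun)
    ultimately show "(G y - G x) v = (- (G y o\<^sub>L (F y - F x) o\<^sub>L G x)) v"
      by (simp add: blinfun.diff_left blinfun.diff_right blinfun.minus_left)
  qed
  have cont: "isCont G x" if F: "isCont F x" and x: "x \<in> S" for x
  proof -
    let ?n = "norm (G x)"
    have *: "((\<lambda>y. norm (F y - F x)) \<longlongrightarrow> 0) (at x)"
      using F unfolding isCont_def by (simp add: LIM_zero tendsto_norm_zero)
    then have "((\<lambda>y. norm (F y - F x) * ?n) \<longlongrightarrow> 0) (at x)"
      by (rule tendsto_mult_left_zero)
    then have ev: "\<forall>\<^sub>F y in at x. norm (F y - F x) * ?n < 1/2"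
      by (rule order_tendstoD) simp
    have evS: "\<forall>\<^sub>F y in at x. y \<in> S" using S x by (intro eventually_at_in_open') auto
    have "\<forall>\<^sub>F y in at x. norm (G y - G x) \<le> (2 * ?n * norm (F y - F x)) * ?n"
      using ev evS
    proof eventually_elim
      case (elim y)
      \<comment> \<open>The identity contains \<open>G y\<close> itself, so a local bound on it must
        come first: where the variation of \<open>F\<close> times \<open>norm (G x)\<close> is below
        1/2, half of \<open>norm (G y)\<close> is absorbed and
        \<open>norm (G y) \<le> 2 * norm (G x)\<close> remains.\<close>
      have le: "norm (G y - G x) \<le> norm (G y) * norm (F y - F x) * ?n"
        unfolding diff[OF x elim(2)] norm_minus_cancel
        by (rule order_trans[OF norm_blinfun_compose mult_right_mono[OF norm_blinfun_compose norm_ge_zero]])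
      also have "\<dots> \<le> norm (G y) * (1/2)"
        using elim(1) by (subst mult.assoc) (rule mult_left_mono, simp_all)
      finally have "norm (G y) \<le> 2 * ?n"
        using norm_triangle_sub[of "G y" "G x"] by simp
      then have "norm (G y) * norm (F y - F x) * ?n \<le> (2 * ?n) * norm (F y - F x) * ?n"
        by (intro mult_right_mono) simp_all
      with le show ?case by simp
    qed
    moreover have "((\<lambda>y. (2 * ?n * norm (F y - F x)) * ?n) \<longlongrightarrow> 0) (at x)"
      by (intro tendsto_mult_left_zero tendsto_mult_right_zero *)
    ultimately have "((\<lambda>y. G y - G x) \<longlongrightarrow> 0) (at x)"
      by (rule Lim_null_comparison)
    then show ?thesis unfolding isCont_def by (simp add: LIM_zero_iff)
  qed
  show ?thesis using F
  proof (induction k)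
    case 0
    then show ?case using cont S by (auto simp: continuous_on_eq_continuous_at)
  next
    case (Suc k)
    have G: "Ck_on k S G" by (rule Suc.IH[OF Ck_on_Suc_imp[OF Suc.prems]])
    have contF: "isCont F x" if "x \<in> S" for x
      using Ck_on_continuous[OF Suc.prems] S that by (simp add: continuous_on_eq_continuous_at)
    show ?case
    proof (rule Ck_on_SucI[OF S])
      fix x assume x: "x \<in> S"
      let ?F' = "frechet_derivative F (at x)"
      have F': "((\<lambda>y. F y - F x) has_derivative ?F') (at x)"
        using has_derivative_diff[OF Ck_on_has_derivative[OF Suc.prems x] has_derivative_const[of "F x"]] by simp
      have "((\<lambda>y. G y o\<^sub>L (F y - F x)) has_derivative (\<lambda>v. G x o\<^sub>L ?F' v)) (at x)"
        by (rule has_derivative_bilinear_vanishing[OF bounded_bilinear_blinfun_compose cont[OF contF[OF x] x] F']) simp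
      then have "((\<lambda>y. G y o\<^sub>L (F y - F x) o\<^sub>L G x) has_derivative (\<lambda>v. G x o\<^sub>L ?F' v o\<^sub>L G x)) (at x)"
        by (rule bounded_linear.has_derivative[OF
            bounded_bilinear.bounded_linear_left[OF bounded_bilinear_blinfun_compose]])
      from has_derivative_add[OF has_derivative_const[of "G x"] has_derivative_minus[OF this]]
      have "((\<lambda>y. G x + - (G y o\<^sub>L (F y - F x) o\<^sub>L G x)) has_derivative (\<lambda>v. - (G x o\<^sub>L ?F' v o\<^sub>L G x))) (at x)"
        by simp
      then show "(G has_derivative (\<lambda>v. - (G x o\<^sub>L ?F' v o\<^sub>L G x))) (at x)"
        by (rule has_derivative_transform_within_open[OF _ S x]) (use diff[OF x] in \<open>simp add: algebra_simps\<close>)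
    next
      fix v
      have "Ck_on k S (\<lambda>x. frechet_derivative F (at x) v)" using Suc.prems by simp
      then show "Ck_on k S (\<lambda>x. - (G x o\<^sub>L frechet_derivative F (at x) v o\<^sub>L G x))"
        by (intro Ck_on_linear_compose[OF bounded_linear_minus[OF bounded_linear_ident]]
            Ck_on_bilinear[OF bounded_bilinear_blinfun_compose] G S)
    qed
  qed
qed

lemma Ck_on_Lipschitz:
  fixes f :: "'a::euclidean_space \<Rightarrow> 'b::real_normed_vector"
  assumes f: "Ck_on 1 S f" and S: "open S" and K: "compact K" "convex K" "K \<subseteq> S"
  obtains C where "C \<ge> 0" "\<And>x y. x \<in> K \<Longrightarrow> y \<in> K \<Longrightarrow> norm (f x - f y) \<le> C * norm (x - y)"
proof -
  have f1: "Ck_on (Suc 0) S f" using f by simp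
  let ?F = "\<lambda>x. Blinfun (frechet_derivative f (at x))"
  have "continuous_on K ?F"
    using Ck_on_Blinfun_derivative[OF f1 S] K by (auto intro: continuous_on_subset)
  then have "bounded (?F ` K)" using K compact_continuous_image compact_imp_bounded by blast
  then obtain C where C: "C > 0" "\<And>x. x \<in> K \<Longrightarrow> norm (?F x) \<le> C"
    unfolding bounded_pos by auto
  have "norm (f x - f y) \<le> C * norm (x - y)" if "x \<in> K" "y \<in> K" for x y
  proof (rule differentiable_bound[OF K(2) _ _ that])
    fix x assume x: "x \<in> K"
    then have d: "(f has_derivative frechet_derivative f (at x)) (at x)"
      using Ck_on_has_derivative[OF f1] K by auto
    then show "(f has_derivative frechet_derivative f (at x)) (at x within K)"
      by (rule has_derivative_at_withinI)
    show "onorm (frechet_derivative f (at x)) \<le> C"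
      using C(2)[OF x] Blinfun_derivative[OF d] by (simp add: norm_blinfun.rep_eq)
  qed
  with C(1) show ?thesis by (intro that[of C]) auto
qed

section \<open>Smooth maps and the inverse function theorem\<close>

lemma smooth_onD: "smooth_on S f \<Longrightarrow> Ck_on k S f"
  by (simp add: smooth_on_def)

lemma smooth_on_has_derivative:
  "smooth_on S f \<Longrightarrow> x \<in> S \<Longrightarrow> (f has_derivative frechet_derivative f (at x)) (at x)"
  by (rule Ck_on_has_derivative[OF smooth_onD[of S f "Suc 0"]])

lemma smooth_on_frechet_derivative: "smooth_on S f \<Longrightarrow> smooth_on S (\<lambda>x. frechet_derivative f (at x) v)"
  unfolding smooth_on_def using Ck_on.simps(2) by blast

lemma smooth_on_congI:
  "smooth_on S f \<Longrightarrow> open S \<Longrightarrow> (\<And>x. x \<in> S \<Longrightarrow> f x = g x) \<Longrightarrow> smooth_on S g"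
  unfolding smooth_on_def by (blast intro: Ck_on_congI)

lemma smooth_on_subset: "smooth_on S f \<Longrightarrow> T \<subseteq> S \<Longrightarrow> smooth_on T f"
  unfolding smooth_on_def by (blast intro: Ck_on_subset)

lemma smooth_on_compose:
  fixes f :: "'b::euclidean_space \<Rightarrow> 'c::real_normed_vector" and g :: "'a::real_normed_vector \<Rightarrow> 'b"
  assumes "smooth_on S g" "smooth_on T f" "open S" "open T" "g ` S \<subseteq> T"
  shows "smooth_on S (\<lambda>x. f (g x))"
  using assms unfolding smooth_on_def by (blast intro: Ck_on_compose)

lemma smooth_on_linear: "bounded_linear L \<Longrightarrow> open S \<Longrightarrow> smooth_on S L"
  unfolding smooth_on_def by (blast intro: Ck_on_linear)

lemma smooth_on_const: "smooth_on S (\<lambda>x. c)"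
  unfolding smooth_on_def by (blast intro: Ck_on_const)

lemma smooth_on_add: "smooth_on S f \<Longrightarrow> smooth_on S g \<Longrightarrow> open S \<Longrightarrow> smooth_on S (\<lambda>x. f x + g x)"
  unfolding smooth_on_def by (blast intro: Ck_on_add)

lemma smooth_on_scaleR: "smooth_on S f \<Longrightarrow> smooth_on S g \<Longrightarrow> open S \<Longrightarrow> smooth_on S (\<lambda>x. f x *\<^sub>R g x)"
  unfolding smooth_on_def by (blast intro: Ck_on_scaleR)

lemma smooth_on_sum: "(\<And>i. i \<in> J \<Longrightarrow> smooth_on S (f i)) \<Longrightarrow> open S \<Longrightarrow> smooth_on S (\<lambda>x. \<Sum>i\<in>J. f i x)"
  unfolding smooth_on_def by (blast intro: Ck_on_sum)

lemma smooth_on_linear_compose: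
  "bounded_linear L \<Longrightarrow> smooth_on S f \<Longrightarrow> open S \<Longrightarrow> smooth_on S (\<lambda>x. L (f x))"
  unfolding smooth_on_def by (blast intro: Ck_on_linear_compose)

text \<open>The derivative of the local inverse \<open>g\<close> at \<open>y\<close> is the inverse
  of the derivative of \<open>f\<close> at \<open>g y\<close>. If \<open>g\<close> is of class
  \<open>C^k\<close>, so is this operator by \<open>Ck_on_blinfun_inverse\<close>, and then
  \<open>g\<close> is of class \<open>C^(k+1)\<close>.\<close>

lemma smooth_inverse_function:
  fixes f :: "'a::euclidean_space \<Rightarrow> 'a"
  assumes U: "open U" and f: "smooth_on U f" and x0: "x0 \<in> U" and inj: "inj (frechet_derivative f (at x0))"
  obtains U' V g where "open U'" "U' \<subseteq> U" "x0 \<in> U'" "open V" "homeomorphism U' V f g" "smooth_on V g"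
proof -
  let ?F = "\<lambda>x. Blinfun (frechet_derivative f (at x))"
  have app: "blinfun_apply (?F x) = frechet_derivative f (at x)" if "x \<in> U" for x
    by (rule Blinfun_derivative[OF smooth_on_has_derivative[OF f that]])
  have ck: "Ck_on k U ?F" for k by (rule Ck_on_Blinfun_derivative[OF smooth_onD[OF f] U])
  have "linear (frechet_derivative f (at x0))"
    using has_derivative_linear[OF smooth_on_has_derivative[OF f x0]] .
  then obtain g0 where g0: "linear g0" "g0 \<circ> frechet_derivative f (at x0) = id"
    using linear_injective_left_inverse inj by blast
  have g0': "Blinfun g0 o\<^sub>L ?F x0 = id_blinfun"
    using g0 app[OF x0] by (intro blinfun_eqI)
      (simp add: bounded_linear_Blinfun_apply linear_conv_bounded_linear o_def fun_eq_iff id_def)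
  have der: "(f has_derivative blinfun_apply (?F x)) (at x)" if "x \<in> U" for x
    using smooth_on_has_derivative[OF f that] app[OF that] by simp
  have "Ck_on 0 U ?F" by (rule ck)
  then have cont: "continuous_on U ?F" by simp
  obtain U' V g g' where *: "open U'" "U' \<subseteq> U" "x0 \<in> U'" "open V" "f x0 \<in> V" "homeomorphism U' V f g"
    "\<And>y. y \<in> V \<Longrightarrow> (g has_derivative (g' y)) (at y)"
    "\<And>y. y \<in> V \<Longrightarrow> g' y = inv (blinfun_apply (?F (g y)))"
    "\<And>y. y \<in> V \<Longrightarrow> bij (blinfun_apply (?F (g y)))"
    using inverse_function_theorem[OF U der cont x0 g0'] by metis
  have gV: "g ` V \<subseteq> U" using *(2,6) by (auto simp: homeomorphism_def)
  have "Ck_on k V g" for k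
  proof (induction k)
    case 0
    then show ?case using *(6) by (auto simp: homeomorphism_def)
  next
    case (Suc k)
    have "Ck_on k V (\<lambda>y. Blinfun (g' y))"
    proof (rule Ck_on_blinfun_inverse[OF Ck_on_compose[OF Suc.IH ck \<open>open V\<close> U gV] \<open>open V\<close>])
      fix y assume y: "y \<in> V"
      have app': "blinfun_apply (Blinfun (g' y)) = g' y" by (rule Blinfun_derivative[OF *(7)[OF y]])
      show "Blinfun (g' y) o\<^sub>L ?F (g y) = id_blinfun"
        by (rule blinfun_eqI, simp only: blinfun_apply_blinfun_compose blinfun_apply_id_blinfun app')
          (simp only: *(8)[OF y] inv_f_f[OF bij_is_inj[OF *(9)[OF y]]])
      show "?F (g y) o\<^sub>L Blinfun (g' y) = id_blinfun"
        by (rule blinfun_eqI, simp only: blinfun_apply_blinfun_compose blinfun_apply_id_blinfun app')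
          (simp only: *(8)[OF y] surj_f_inv_f[OF bij_is_surj[OF *(9)[OF y]]])
    qed
    then have "Ck_on k V (\<lambda>y. blinfun_apply (Blinfun (g' y)) v)" for v
      by (rule Ck_on_blinfun_apply_const[OF _ \<open>open V\<close>])
    then have "Ck_on k V (\<lambda>y. g' y v)" for v
      by (rule Ck_on_congI[OF _ \<open>open V\<close>]) (simp add: Blinfun_derivative[OF *(7)])
    from Ck_on_SucI[OF \<open>open V\<close> *(7) this] show ?case .
  qed
  then have "smooth_on V g" by (simp add: smooth_on_def)
  then show ?thesis using * by (intro that[of U' V g]) auto
qed

section \<open>Symmetry of second derivatives\<close>

lemma has_vector_derivative_along_line:
  assumes "(f has_derivative f') (at (a + s *\<^sub>R u))"
  shows "((\<lambda>s. f (a + s *\<^sub>R u)) has_vector_derivative f' u) (at s)"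
proof -
  have "((\<lambda>s. a + s *\<^sub>R u) has_derivative (\<lambda>d. d *\<^sub>R u)) (at s)"
    by (auto intro!: derivative_eq_intros)
  from has_derivative_compose[OF this assms]
  show ?thesis
    unfolding has_vector_derivative_def using linear_scale[OF has_derivative_linear[OF assms]] by simp
qed

text \<open>Mean value theorem in direction \<open>u\<close>, applied to the difference of
  \<open>f\<close> and its translate by \<open>h v\<close>, and then in direction \<open>v\<close>.
  The left side is symmetric in \<open>u\<close> and \<open>v\<close> and the right side is not,
  which is the source of symmetry of second derivatives.\<close>

lemma second_difference_mean_value:
  fixes f :: "'a::real_normed_vector \<Rightarrow> real"
  assumes f: "Ck_on 2 S f" and h: "h > 0"
    and S: "\<And>s t. 0 \<le> s \<Longrightarrow> s \<le> h \<Longrightarrow> 0 \<le> t \<Longrightarrow> t \<le> h \<Longrightarrow> x + s *\<^sub>R u + t *\<^sub>R v \<in> S"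
  shows "\<exists>s t. 0 \<le> s \<and> s \<le> h \<and> 0 \<le> t \<and> t \<le> h \<and>
    f (x + h *\<^sub>R u + h *\<^sub>R v) - f (x + h *\<^sub>R u) - f (x + h *\<^sub>R v) + f x =
    h * (h * frechet_derivative (\<lambda>z. frechet_derivative f (at z) u) (at (x + s *\<^sub>R u + t *\<^sub>R v)) v)"
proof -
  let ?D = "\<lambda>y u. frechet_derivative f (at y) u"
  have f1: "Ck_on (Suc (Suc 0)) S f" using f by (simp add: numeral_2_eq_2 del: Ck_on.simps)
  have f2: "Ck_on (Suc 0) S (\<lambda>y. ?D y u)" using f1 by (metis Ck_on.simps(2))
  have d1: "((\<lambda>s. f (a + s *\<^sub>R u)) has_real_derivative ?D (a + s *\<^sub>R u) u) (at s)" if "a + s *\<^sub>R u \<in> S" for a s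
    using has_vector_derivative_along_line[OF Ck_on_has_derivative[OF f1 that]]
    by (simp add: has_real_derivative_iff_has_vector_derivative)
  have d2: "((\<lambda>s. ?D (a + s *\<^sub>R v) u) has_real_derivative
      frechet_derivative (\<lambda>z. ?D z u) (at (a + s *\<^sub>R v)) v) (at s)" if "a + s *\<^sub>R v \<in> S" for a s
    using has_vector_derivative_along_line[OF Ck_on_has_derivative[OF f2 that]]
    by (simp add: has_real_derivative_iff_has_vector_derivative)
  have "((\<lambda>s. f ((x + h *\<^sub>R v) + s *\<^sub>R u) - f (x + s *\<^sub>R u)) has_real_derivative
      ?D ((x + h *\<^sub>R v) + s *\<^sub>R u) u - ?D (x + s *\<^sub>R u) u) (at s)" if "0 \<le> s" "s \<le> h" for s
    using that h S[of s h] S[of s 0] by (intro DERIV_diff d1) (simp_all add: algebra_simps)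
  from MVT2[OF h this] obtain s where s: "0 < s" "s < h" and
    "f (x + h *\<^sub>R v + h *\<^sub>R u) - f (x + h *\<^sub>R u) - (f (x + h *\<^sub>R v + 0 *\<^sub>R u) - f (x + 0 *\<^sub>R u)) =
      (h - 0) * (?D ((x + h *\<^sub>R v) + s *\<^sub>R u) u - ?D (x + s *\<^sub>R u) u)" by auto
  then have e1: "f (x + h *\<^sub>R u + h *\<^sub>R v) - f (x + h *\<^sub>R u) - f (x + h *\<^sub>R v) + f x =
      h * (?D ((x + s *\<^sub>R u) + h *\<^sub>R v) u - ?D ((x + s *\<^sub>R u) + 0 *\<^sub>R v) u)"
    by (simp add: ac_simps)
  have "((\<lambda>t. ?D ((x + s *\<^sub>R u) + t *\<^sub>R v) u) has_real_derivative
      frechet_derivative (\<lambda>z. ?D z u) (at ((x + s *\<^sub>R u) + t *\<^sub>R v)) v) (at t)" if "0 \<le> t" "t \<le> h" for t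
    using that s by (intro d2 S) auto
  from MVT2[OF h this] obtain t where t: "0 < t" "t < h" and
    "?D ((x + s *\<^sub>R u) + h *\<^sub>R v) u - ?D ((x + s *\<^sub>R u) + 0 *\<^sub>R v) u =
      (h - 0) * frechet_derivative (\<lambda>z. ?D z u) (at ((x + s *\<^sub>R u) + t *\<^sub>R v)) v" by auto
  with e1 s t show ?thesis by (intro exI[of _ s] exI[of _ t]) simp
qed

text \<open>Evaluating the second difference over a small parallelogram in both orders shows that
  the two mixed derivatives agree at two points close to \<open>x\<close>; continuity brings both
  points to \<open>x\<close>.\<close>

lemma second_derivative_symmetric_real:
  fixes f :: "'a::real_normed_vector \<Rightarrow> real"
  assumes f: "Ck_on 2 S f" and S: "open S" "x \<in> S"
  shows "frechet_derivative (\<lambda>z. frechet_derivative f (at z) v) (at x) u =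
    frechet_derivative (\<lambda>z. frechet_derivative f (at z) u) (at x) v"
proof -
  let ?D = "\<lambda>a b y. frechet_derivative (\<lambda>z. frechet_derivative f (at z) a) (at y) b"
  have f1: "Ck_on (Suc (Suc 0)) S f" using f by (simp add: numeral_2_eq_2 del: Ck_on.simps)
  have "continuous_on S (?D a b)" for a b
    using f1 by (simp only: Ck_on.simps)
  then have "isCont (?D a b) x" for a b
    using S by (simp add: continuous_on_eq_continuous_at)
  then have cont: "isCont (\<lambda>y. ?D a b y) x" for a b by simp
  have "dist (?D v u x) (?D u v x) \<le> e" if "e > 0" for e
  proof -
    obtain d1 where d1: "d1 > 0" "\<And>y. dist y x < d1 \<Longrightarrow> dist (?D v u y) (?D v u x) < e/2"
      using cont[of v u] \<open>e > 0\<close> unfolding continuous_at_eps_delta by (metis half_gt_zero)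
    obtain d2 where d2: "d2 > 0" "\<And>y. dist y x < d2 \<Longrightarrow> dist (?D u v y) (?D u v x) < e/2"
      using cont[of u v] \<open>e > 0\<close> unfolding continuous_at_eps_delta by (metis half_gt_zero)
    obtain d3 where d3: "d3 > 0" "ball x d3 \<subseteq> S" using S open_contains_ball by blast
    define d where "d = min d1 (min d2 d3)"
    have d: "d > 0" using d1 d2 d3 by (simp add: d_def)
    \<comment> \<open>All points of the parallelogram lie within
      \<open>h * (norm u + norm v) < d\<close> of \<open>x\<close>. The summand 1 keeps the
      denominator positive when both vectors vanish.\<close>
    define h where "h = d / (2 * (norm u + norm v + 1))"
    have pos: "norm u + norm v + 1 > 0" using norm_ge_zero[of u] norm_ge_zero[of v] by linarith
    then have "h * (norm u + norm v + 1) = d / 2" unfolding h_def by (simp add: divide_simps)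
    moreover have h0: "h > 0" unfolding h_def using pos d by simp
    ultimately have "h * (norm u + norm v) < d" using d by (simp add: algebra_simps)
    with h0 have h: "h > 0" "h * (norm u + norm v) < d" .
    have near: "dist (x + s *\<^sub>R u + t *\<^sub>R v) x < d" if "0 \<le> s" "s \<le> h" "0 \<le> t" "t \<le> h" for s t
    proof -
      have "norm (s *\<^sub>R u + t *\<^sub>R v) \<le> s * norm u + t * norm v"
        using norm_triangle_ineq[of "s *\<^sub>R u" "t *\<^sub>R v"] that by simp
      also have "\<dots> \<le> h * norm u + h * norm v"
        using that by (intro add_mono mult_right_mono) auto
      finally show ?thesis using h(2) by (simp add: dist_norm algebra_simps)
    qed
    have inS: "x + s *\<^sub>R u + t *\<^sub>R v \<in> S" if "0 \<le> s" "s \<le> h" "0 \<le> t" "t \<le> h" for s t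
      using near[OF that] d3 by (auto simp: d_def mem_ball dist_commute)
    obtain s t where st: "0 \<le> s" "s \<le> h" "0 \<le> t" "t \<le> h" and
      1: "f (x + h *\<^sub>R u + h *\<^sub>R v) - f (x + h *\<^sub>R u) - f (x + h *\<^sub>R v) + f x =
        h * (h * ?D u v (x + s *\<^sub>R u + t *\<^sub>R v))"
      using second_difference_mean_value[OF f h(1) inS] by blast
    have inS': "x + s *\<^sub>R v + t *\<^sub>R u \<in> S" if "0 \<le> s" "s \<le> h" "0 \<le> t" "t \<le> h" for s t
      using inS[of t s] that by (simp add: ac_simps)
    obtain t' s' where st': "0 \<le> t'" "t' \<le> h" "0 \<le> s'" "s' \<le> h" and
      2: "f (x + h *\<^sub>R v + h *\<^sub>R u) - f (x + h *\<^sub>R v) - f (x + h *\<^sub>R u) + f x =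
        h * (h * ?D v u (x + t' *\<^sub>R v + s' *\<^sub>R u))"
      using second_difference_mean_value[OF f h(1) inS'] by blast
    have comm: "x + h *\<^sub>R v + h *\<^sub>R u = x + h *\<^sub>R u + h *\<^sub>R v" by (simp add: ac_simps)
    have "h * (h * ?D u v (x + s *\<^sub>R u + t *\<^sub>R v)) = h * (h * ?D v u (x + t' *\<^sub>R v + s' *\<^sub>R u))"
      using 1 2 unfolding comm by linarith
    then have eq: "?D u v (x + s *\<^sub>R u + t *\<^sub>R v) = ?D v u (x + t' *\<^sub>R v + s' *\<^sub>R u)"
      using h(1) by simp
    have "x + t' *\<^sub>R v + s' *\<^sub>R u = x + s' *\<^sub>R u + t' *\<^sub>R v" by (simp add: ac_simps)
    then have "dist (x + t' *\<^sub>R v + s' *\<^sub>R u) x < d" using near[OF st'(3,4,1,2)] by (simp only:)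
    then have "dist (?D v u (x + t' *\<^sub>R v + s' *\<^sub>R u)) (?D v u x) < e/2"
      by (intro d1) (simp add: d_def)
    moreover have "dist (?D u v (x + s *\<^sub>R u + t *\<^sub>R v)) (?D u v x) < e/2"
      using near[OF st] by (intro d2) (simp add: d_def)
    ultimately show ?thesis
      unfolding eq[symmetric] dist_real_def by linarith
  qed
  then have "dist (?D v u x) (?D u v x) \<le> 0" by (rule field_le_epsilon[of _ 0, simplified])
  then show ?thesis by simp
qed

lemma second_derivative_symmetric:
  fixes f :: "'a::real_normed_vector \<Rightarrow> 'b::euclidean_space"
  assumes f: "Ck_on 2 S f" and S: "open S" "x \<in> S"
  shows "frechet_derivative (\<lambda>z. frechet_derivative f (at z) v) (at x) u =
    frechet_derivative (\<lambda>z. frechet_derivative f (at z) u) (at x) v"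
proof (rule euclidean_eqI)
  fix i :: 'b
  let ?g = "\<lambda>y. f y \<bullet> i"
  have f1: "Ck_on (Suc (Suc 0)) S f" using f by (simp add: numeral_2_eq_2 del: Ck_on.simps)
  have fa: "Ck_on (Suc 0) S (\<lambda>y. frechet_derivative f (at y) a)" for a using f1 by (metis Ck_on.simps(2))
  have g: "Ck_on 2 S ?g" by (rule Ck_on_linear_compose[OF bounded_linear_inner_left f S(1)])
  have d: "frechet_derivative ?g (at y) = (\<lambda>a. frechet_derivative f (at y) a \<bullet> i)" if "y \<in> S" for y
    by (rule frechet_derivative_at[symmetric])
      (rule bounded_linear.has_derivative[OF bounded_linear_inner_left Ck_on_has_derivative[OF f1 that]])
  have "frechet_derivative (\<lambda>z. frechet_derivative ?g (at z) a) (at x) b =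
      frechet_derivative (\<lambda>z. frechet_derivative f (at z) a) (at x) b \<bullet> i" for a b
  proof -
    have "((\<lambda>z. frechet_derivative f (at z) a \<bullet> i) has_derivative
       (\<lambda>b. frechet_derivative (\<lambda>z. frechet_derivative f (at z) a) (at x) b \<bullet> i)) (at x)"
      by (rule bounded_linear.has_derivative[OF bounded_linear_inner_left Ck_on_has_derivative[OF fa S(2)]])
    then have "((\<lambda>z. frechet_derivative ?g (at z) a) has_derivative
       (\<lambda>b. frechet_derivative (\<lambda>z. frechet_derivative f (at z) a) (at x) b \<bullet> i)) (at x)"
      by (rule has_derivative_transform_within_open[OF _ S]) (simp add: d)
    from frechet_derivative_at[OF this] show ?thesis by metis
  qed
  with second_derivative_symmetric_real[OF g S, of v u]
  show "frechet_derivative (\<lambda>z. frechet_derivative f (at z) v) (at x) u \<bullet> i =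
    frechet_derivative (\<lambda>z. frechet_derivative f (at z) u) (at x) v \<bullet> i" by simp
qed

section \<open>Parameter dependence of linear differential equations\<close>

lemma vector_mean_value_bound:
  fixes u :: "real \<Rightarrow> 'b::real_normed_vector"
  assumes S: "convex S" and d: "\<And>t. t \<in> S \<Longrightarrow> (u has_vector_derivative u' t) (at t within S)"
    and B: "\<And>t. t \<in> S \<Longrightarrow> norm (u' t) \<le> B" and ab: "a \<in> S" "b \<in> S"
  shows "norm (u a - u b) \<le> B * \<bar>a - b\<bar>"
proof -
  have "norm (u a - u b) \<le> B * norm (a - b)"
  proof (rule differentiable_bound[OF S _ _ ab])
    fix t assume t: "t \<in> S"
    show "(u has_derivative (\<lambda>d. d *\<^sub>R u' t)) (at t within S)"
      using d[OF t] by (simp add: has_vector_derivative_def)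
    show "onorm (\<lambda>d. d *\<^sub>R u' t) \<le> B"
    proof (rule onorm_bound)
      show "0 \<le> B" by (rule order_trans[OF norm_ge_zero B[OF t]])
      fix x show "norm (x *\<^sub>R u' t) \<le> B * norm x"
        using mult_right_mono[OF B[OF t], of "\<bar>x\<bar>"] by (simp add: mult.commute)
    qed
  qed
  then show ?thesis by simp
qed

text \<open>A Gronwall estimate without exponentials: the mean value bound is applied at a point
  where \<open>norm (u t)\<close> is maximal, and since \<open>L * \<tau> \<le> 1 / 2\<close> half
  of the maximum is absorbed into the left side. All differential equations below are run on
  intervals short enough for this.\<close>

lemma gronwall_small:
  fixes u :: "real \<Rightarrow> 'b::real_normed_vector"
  assumes d: "\<And>t. t \<in> {-\<tau>..\<tau>} \<Longrightarrow> (u has_vector_derivative u' t) (at t within {-\<tau>..\<tau>})"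
    and B: "\<And>t. t \<in> {-\<tau>..\<tau>} \<Longrightarrow> norm (u' t) \<le> L * norm (u t) + e"
    and L: "0 \<le> L" "L * \<tau> \<le> 1 / 2" and e: "0 \<le> e" and t: "t \<in> {-\<tau>..\<tau>}"
  shows "norm (u t) \<le> 2 * norm (u 0) + 2 * \<tau> * e"
proof -
  have \<tau>: "0 \<le> \<tau>" using t by simp
  have "continuous_on {-\<tau>..\<tau>} u"
    unfolding continuous_on_eq_continuous_within using d has_vector_derivative_continuous by blast
  then have "continuous_on {-\<tau>..\<tau>} (\<lambda>t. norm (u t))" by (rule continuous_on_norm)
  then obtain s where s: "s \<in> {-\<tau>..\<tau>}" "\<And>t. t \<in> {-\<tau>..\<tau>} \<Longrightarrow> norm (u t) \<le> norm (u s)"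
    using continuous_attains_sup[of "{-\<tau>..\<tau>}" "\<lambda>t. norm (u t)"] t by auto
  have "norm (u s - u 0) \<le> (L * norm (u s) + e) * \<bar>s - 0\<bar>"
  proof (rule vector_mean_value_bound[OF _ d])
    fix t assume t: "t \<in> {-\<tau>..\<tau>}"
    have "L * norm (u t) \<le> L * norm (u s)" by (rule mult_left_mono[OF s(2)[OF t] L(1)])
    with B[OF t] show "norm (u' t) \<le> L * norm (u s) + e" by simp
  qed (use s \<tau> in auto)
  also have "\<dots> \<le> (L * norm (u s) + e) * \<tau>"
    using s L e by (intro mult_left_mono) auto
  also have "\<dots> = (L * \<tau>) * norm (u s) + \<tau> * e" by (simp add: algebra_simps)
  also have "\<dots> \<le> 1/2 * norm (u s) + \<tau> * e"
    using L by (intro add_right_mono mult_right_mono) auto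
  finally have "norm (u s) \<le> 2 * norm (u 0) + 2 * \<tau> * e"
    using norm_triangle_sub[of "u s" "u 0"] by simp
  with s(2)[OF t] show ?thesis by simp
qed

text \<open>As \<open>F\<close> is Lipschitz on the whole space, the integral operator contracts all
  bounded continuous functions and no invariant ball has to be found. Fields defined only locally
  are cut off before this is applied.\<close>

lemma picard_global:
  fixes F :: "real \<Rightarrow> 'b::banach \<Rightarrow> 'b"
  assumes \<tau>: "0 < \<tau>" and L: "0 \<le> L" "L * \<tau> \<le> 1 / 2"
    and cont: "\<And>\<phi>. continuous_on {-\<tau>..\<tau>} \<phi> \<Longrightarrow> continuous_on {-\<tau>..\<tau>} (\<lambda>t. F t (\<phi> t))"
    and lip: "\<And>t y z. t \<in> {-\<tau>..\<tau>} \<Longrightarrow> norm (F t y - F t z) \<le> L * norm (y - z)"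
  obtains y where "y 0 = y0"
    "\<And>t. t \<in> {-\<tau>..\<tau>} \<Longrightarrow> (y has_vector_derivative F t (y t)) (at t within {-\<tau>..\<tau>})"
proof -
  let ?I = "{-\<tau>..\<tau>}"
  \<comment> \<open>The difference of two integrals with the same lower limit plays the role of the
    oriented integral from 0 to \<open>t\<close>, for either sign of \<open>t\<close>.\<close>
  define P where "P \<phi> t = y0 + (integral {-\<tau>..t} (\<lambda>s. F s (\<phi> s)) - integral {-\<tau>..0} (\<lambda>s. F s (\<phi> s)))" for \<phi> t
  \<comment> \<open>Clamping time to the interval turns functions on it into bounded continuous
    functions on the line, a complete space on which the contraction principle is available.\<close>
  define c where "c t = max (-\<tau>) (min \<tau> t)" for t
  have c: "c t \<in> ?I" for t using \<tau> by (auto simp: c_def)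
  have cI: "c t = t" if "t \<in> ?I" for t using that by (auto simp: c_def)
  have contc: "continuous_on UNIV c" unfolding c_def by (intro continuous_intros)
  have P0: "P \<phi> 0 = y0" for \<phi> by (simp add: P_def)
  have dP: "(P \<phi> has_vector_derivative F t (\<phi> t)) (at t within ?I)"
    if "continuous_on ?I \<phi>" "t \<in> ?I" for \<phi> t
    unfolding P_def[abs_def]
    using has_vector_derivative_add[OF has_vector_derivative_const[of y0]
      has_vector_derivative_diff[OF integral_has_vector_derivative[OF cont[OF that(1)] that(2)] has_vector_derivative_const]]
    by simp
  have contP: "continuous_on ?I (P \<phi>)" if "continuous_on ?I \<phi>" for \<phi>
    unfolding continuous_on_eq_continuous_within using dP[OF that] has_vector_derivative_continuous by blast
  define T :: "(real \<Rightarrow>\<^sub>C 'b) \<Rightarrow> (real \<Rightarrow>\<^sub>C 'b)" where "T \<phi> = Bcontfun (\<lambda>t. P \<phi> (c t))" for \<phi>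
  have T: "apply_bcontfun (T \<phi>) t = P \<phi> (c t)" for \<phi> t
  proof -
    have "continuous_on UNIV (\<lambda>t. P \<phi> (c t))"
      by (rule continuous_on_compose2[OF contP contc]) (use c in auto)
    moreover have "bounded (range (\<lambda>t. P \<phi> (c t)))"
    proof (rule bounded_subset)
      show "bounded (P \<phi> ` ?I)"
        by (intro compact_imp_bounded compact_continuous_image contP) auto
      show "range (\<lambda>t. P \<phi> (c t)) \<subseteq> P \<phi> ` ?I" using c by blast
    qed
    ultimately have "(\<lambda>t. P \<phi> (c t)) \<in> bcontfun" by (simp add: bcontfun_def)
    then show ?thesis unfolding T_def by (simp add: Bcontfun_inverse)
  qed
  have "dist (T \<phi>) (T \<psi>) \<le> 1/2 * dist \<phi> \<psi>" for \<phi> \<psi>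
  proof (rule dist_bound)
    fix t
    have 0: "0 \<in> ?I" using \<tau> by simp
    let ?d = "\<lambda>t. P \<phi> t - P \<psi> t"
    have "norm (?d (c t) - ?d 0) \<le> (L * dist \<phi> \<psi>) * \<bar>c t - 0\<bar>"
    proof (rule vector_mean_value_bound[OF _ _ _ c 0])
      fix s assume s: "s \<in> ?I"
      show "(?d has_vector_derivative F s (\<phi> s) - F s (\<psi> s)) (at s within ?I)"
        by (intro has_vector_derivative_diff dP s) auto
      have "norm (F s (\<phi> s) - F s (\<psi> s)) \<le> L * norm (\<phi> s - \<psi> s)" by (rule lip[OF s])
      also have "\<dots> \<le> L * dist \<phi> \<psi>"
        using L dist_bounded[of \<phi> s \<psi>] by (intro mult_left_mono) (simp_all add: dist_norm)
      finally show "norm (F s (\<phi> s) - F s (\<psi> s)) \<le> L * dist \<phi> \<psi>" .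
    qed simp
    also have "\<dots> \<le> (L * dist \<phi> \<psi>) * \<tau>"
      using c[of t] L by (intro mult_left_mono) auto
    also have "\<dots> = (L * \<tau>) * dist \<phi> \<psi>" by simp
    also have "\<dots> \<le> 1/2 * dist \<phi> \<psi>" using L by (intro mult_right_mono) auto
    finally show "dist (T \<phi> t) (T \<psi> t) \<le> 1/2 * dist \<phi> \<psi>"
      by (simp add: T P0 dist_norm)
  qed
  then obtain \<phi> where \<phi>: "T \<phi> = \<phi>"
    using banach_fix_type[of "1/2" T] by auto
  have eq: "\<phi> t = P \<phi> t" if "t \<in> ?I" for t
    using T[of \<phi> t] cI[OF that] by (simp add: \<phi>)
  show ?thesis
  proof (rule that[of \<phi>])
    show "\<phi> 0 = y0" using eq[of 0] \<tau> P0 by simp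
    fix t assume t: "t \<in> ?I"
    show "(\<phi> has_vector_derivative F t (\<phi> t)) (at t within ?I)"
      using dP[of \<phi> t] t eq
      by (auto intro: has_vector_derivative_transform[of t ?I "\<lambda>t. \<phi> t"])
  qed
qed

lemma linear_ode_unique:
  fixes A :: "real \<Rightarrow> ('b::real_normed_vector \<Rightarrow>\<^sub>L 'b)"
  assumes L: "\<And>t. t \<in> {-\<tau>..\<tau>} \<Longrightarrow> norm (A t) \<le> L" "0 \<le> L" "L * \<tau> \<le> 1 / 2"
    and y: "\<And>t. t \<in> {-\<tau>..\<tau>} \<Longrightarrow> (y has_vector_derivative A t (y t) + c t) (at t within {-\<tau>..\<tau>})"
    and z: "\<And>t. t \<in> {-\<tau>..\<tau>} \<Longrightarrow> (z has_vector_derivative A t (z t) + c t) (at t within {-\<tau>..\<tau>})"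
    and 0: "y 0 = z 0" and t: "t \<in> {-\<tau>..\<tau>}"
  shows "y t = z t"
proof -
  have "norm (y t - z t) \<le> 2 * norm (y 0 - z 0) + 2 * \<tau> * 0"
  proof (rule gronwall_small[OF _ _ L(2,3) _ t])
    fix t assume t: "t \<in> {-\<tau>..\<tau>}"
    show "((\<lambda>t. y t - z t) has_vector_derivative A t (y t - z t)) (at t within {-\<tau>..\<tau>})"
      using has_vector_derivative_diff[OF y[OF t] z[OF t]] by (simp add: blinfun.diff_right)
    have "norm (A t (y t - z t)) \<le> norm (A t) * norm (y t - z t)" by (rule norm_blinfun)
    also have "\<dots> \<le> L * norm (y t - z t)" using L(1)[OF t] by (rule mult_right_mono) simp
    finally show "norm (A t (y t - z t)) \<le> L * norm (y t - z t) + 0" by simp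
  qed simp
  then show ?thesis using 0 by simp
qed

text \<open>The coefficients are continuous on the open interval only, and need not extend to its
  end points. The equation is therefore solved on each closed symmetric subinterval, and the
  solutions are glued by uniqueness.\<close>

lemma linear_ode_solution:
  fixes A :: "real \<Rightarrow> ('b::banach \<Rightarrow>\<^sub>L 'b)"
  assumes T: "0 < T" and L: "\<And>t. t \<in> {-T<..<T} \<Longrightarrow> norm (A t) \<le> L" "0 \<le> L" "L * T \<le> 1 / 2"
    and A: "continuous_on {-T<..<T} A" and c: "continuous_on {-T<..<T} c"
  obtains y where "y 0 = y0" "\<And>t. t \<in> {-T<..<T} \<Longrightarrow> (y has_vector_derivative A t (y t) + c t) (at t)"
proof -
  have L\<tau>: "L * \<tau> \<le> 1 / 2" if "\<tau> < T" for \<tau>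
    using mult_left_mono[of \<tau> T L] that L by simp
  have "\<exists>y. y 0 = y0 \<and> (\<forall>t\<in>{-\<tau>..\<tau>}. (y has_vector_derivative A t (y t) + c t) (at t within {-\<tau>..\<tau>}))"
    if \<tau>: "0 < \<tau>" "\<tau> < T" for \<tau>
  proof -
    have sub: "{-\<tau>..\<tau>} \<subseteq> {-T<..<T}" using \<tau> by auto
    obtain y where "y 0 = y0" "\<And>t. t \<in> {-\<tau>..\<tau>} \<Longrightarrow> (y has_vector_derivative A t (y t) + c t) (at t within {-\<tau>..\<tau>})"
    proof (rule picard_global[OF \<tau>(1) L(2) L\<tau>[OF \<tau>(2)], where F = "\<lambda>t y. A t y + c t" and ?y0.0 = y0])
      fix \<phi> :: "real \<Rightarrow> 'b" assume "continuous_on {-\<tau>..\<tau>} \<phi>"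
      then show "continuous_on {-\<tau>..\<tau>} (\<lambda>t. A t (\<phi> t) + c t)"
        using continuous_on_subset[OF A sub] continuous_on_subset[OF c sub] by (intro continuous_intros)
    next
      fix t y z assume t: "t \<in> {-\<tau>..\<tau>}"
      have "norm (A t (y - z)) \<le> norm (A t) * norm (y - z)" by (rule norm_blinfun)
      also have "\<dots> \<le> L * norm (y - z)" using L(1) t sub by (intro mult_right_mono) auto
      finally show "norm (A t y + c t - (A t z + c t)) \<le> L * norm (y - z)"
        by (simp add: blinfun.diff_right)
    qed blast
    then show ?thesis by blast
  qed
  then obtain Y where Y: "\<And>\<tau>. 0 < \<tau> \<Longrightarrow> \<tau> < T \<Longrightarrow> Y \<tau> 0 = y0"
    "\<And>\<tau> t. 0 < \<tau> \<Longrightarrow> \<tau> < T \<Longrightarrow> t \<in> {-\<tau>..\<tau>} \<Longrightarrow> (Y \<tau> has_vector_derivative A t (Y \<tau> t) + c t) (at t within {-\<tau>..\<tau>})"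
    by metis
  have agree: "Y \<tau> t = Y \<sigma> t" if "0 < \<tau>" "\<tau> \<le> \<sigma>" "\<sigma> < T" "t \<in> {-\<tau>..\<tau>}" for \<tau> \<sigma> t
  proof (rule linear_ode_unique[OF L(1) L(2) L\<tau> Y(2) _ _ that(4)])
    fix s assume s: "s \<in> {-\<tau>..\<tau>}"
    show "(Y \<sigma> has_vector_derivative A s (Y \<sigma> s) + c s) (at s within {-\<tau>..\<tau>})"
      by (rule has_vector_derivative_within_subset[OF Y(2)]) (use that s in auto)
  qed (use that Y(1) in auto)
  \<comment> \<open>The midpoint of \<open>\<bar>t\<bar>\<close> and \<open>T\<close>: the
    subinterval up to \<open>r t\<close> is admissible and has \<open>t\<close> in its interior, so
    one-sided derivatives at its end points do not interfere.\<close>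
  define r where "r t = (\<bar>t\<bar> + T) / 2" for t
  have r: "0 < r t" "r t < T" "\<bar>t\<bar> < r t" if "t \<in> {-T<..<T}" for t
    using that by (auto simp: r_def abs_if)
  define y where "y t = Y (r t) t" for t
  have eq: "y s = Y (r t) s" if t: "t \<in> {-T<..<T}" and s: "\<bar>s\<bar> < r t" for s t
  proof -
    have s': "s \<in> {-T<..<T}" using r(2)[OF t] s by auto
    have mem: "s \<in> {-r s..r s}" "s \<in> {-r t..r t}" using r(3)[OF s'] s by auto
    show ?thesis
    proof (cases "r s \<le> r t")
      case True
      then show ?thesis unfolding y_def using agree[of "r s" "r t" s] r[OF s'] r[OF t] mem by blast
    next
      case False
      then show ?thesis unfolding y_def using agree[of "r t" "r s" s] r[OF s'] r[OF t] mem by simp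
    qed
  qed
  show ?thesis
  proof (rule that[of y])
    show "y 0 = y0" unfolding y_def using r[of 0] T by (intro Y(1)) auto
    fix t assume t: "t \<in> {-T<..<T}"
    have "(Y (r t) has_vector_derivative A t (Y (r t) t) + c t) (at t within {-r t..r t})"
      using r[OF t] by (intro Y(2)) auto
    moreover have "at t within {-r t..r t} = at t"
      using r[OF t] by (intro at_within_interior) (auto simp: interior_atLeastAtMost_real)
    ultimately have "(Y (r t) has_vector_derivative A t (Y (r t) t) + c t) (at t)" by simp
    then have "(y has_vector_derivative A t (Y (r t) t) + c t) (at t)"
      by (rule has_vector_derivative_transform_within_open[of _ _ _ "{-r t<..<r t}"])
        (use r[OF t] eq[OF t] in auto)
    then show "(y has_vector_derivative A t (y t) + c t) (at t)" by (simp add: y_def)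
  qed
qed

text \<open>Total differentiability needs joint continuity of only one of the two partial
  derivatives. Here it is the one in time, which in the applications is given by the right-hand side
  of the differential equation; the parameter derivative is produced pointwise.\<close>

lemma Ck_on_Suc_partials:
  fixes f :: "'p::real_normed_vector \<times> real \<Rightarrow> 'b::real_normed_vector"
  assumes U: "open U" and I: "open I" "convex I"
    and ft: "\<And>p t. p \<in> U \<Longrightarrow> t \<in> I \<Longrightarrow> ((\<lambda>t. f (p, t)) has_vector_derivative ft (p, t)) (at t)"
    and fp: "\<And>p t. p \<in> U \<Longrightarrow> t \<in> I \<Longrightarrow> ((\<lambda>p. f (p, t)) has_derivative fp (p, t)) (at p)"
    and ck: "Ck_on k (U \<times> I) ft" "\<And>w. Ck_on k (U \<times> I) (\<lambda>x. fp x w)"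
  shows "Ck_on (Suc k) (U \<times> I) f"
proof (rule Ck_on_SucI)
  show UI: "open (U \<times> I)" using U I by (intro open_Times)
  fix x assume "x \<in> U \<times> I"
  then obtain p t where x: "x = (p, t)" and pt: "p \<in> U" "t \<in> I" by auto
  have "((\<lambda>(p, t). f (p, t)) has_derivative (\<lambda>(w, s). fp (p, t) w + blinfun_scaleR_left (ft (p, t)) s))
      (at (p, t) within U \<times> I)"
  proof (rule has_derivative_partialsI[where fy = "\<lambda>p t. blinfun_scaleR_left (ft (p, t))"])
    show "((\<lambda>p. f (p, t)) has_derivative fp (p, t)) (at p within U)"
      by (rule has_derivative_at_withinI[OF fp[OF pt]])
    fix p' t' assume "p' \<in> U" "t' \<in> I"
    from ft[OF this]
    show "((\<lambda>t. f (p', t)) has_derivative blinfun_scaleR_left (ft (p', t'))) (at t' within I)"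
      unfolding has_vector_derivative_def blinfun_scaleR_left.rep_eq by (rule has_derivative_at_withinI)
  next
    have "continuous (at (p, t) within U \<times> I) ft"
      using Ck_on_continuous[OF ck(1)] pt by (auto simp: continuous_on_eq_continuous_within)
    then have "continuous (at (p, t) within U \<times> I) (\<lambda>x. blinfun_scaleR_left (ft x))"
      by (rule bounded_linear.continuous[OF bounded_linear_blinfun_scaleR_left])
    then show "continuous (at (p, t) within U \<times> I) (\<lambda>(p, t). blinfun_scaleR_left (ft (p, t)))"
      by (simp add: case_prod_unfold)
  qed (use pt I in auto)
  moreover have "at (p, t) within U \<times> I = at (p, t)" using UI pt by (intro at_within_open) auto
  ultimately show "(f has_derivative (\<lambda>h. fp x (fst h) + snd h *\<^sub>R ft x)) (at x)"
    by (simp add: x case_prod_unfold)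
next
  fix v :: "'p \<times> real"
  show "Ck_on k (U \<times> I) (\<lambda>x. fp x (fst v) + snd v *\<^sub>R ft x)"
    using U I by (intro Ck_on_add Ck_on_scaleR Ck_on_const ck open_Times)
qed

section \<open>Estimates uniform over a compact time interval\<close>

lemma tube_estimate:
  fixes f :: "'p::metric_space \<times> real \<Rightarrow> 'b::real_normed_vector"
  assumes f: "continuous_on (U \<times> I) f" and U: "open U" and K: "compact K" "K \<subseteq> I" and p: "p \<in> U" and e: "e > 0"
  obtains d where "d > 0" "ball p d \<subseteq> U" "\<And>p' t. p' \<in> ball p d \<Longrightarrow> t \<in> K \<Longrightarrow> norm (f (p', t) - f (p, t)) \<le> e"
proof -
  have "continuous_on (U \<times> K) f" using f K by (auto intro: continuous_on_subset)
  from continuous_on_prod_compactE[OF this K(1) p e] obtain X0 where X0: "p \<in> X0" "open X0"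
    "\<forall>x\<in>X0 \<inter> U. \<forall>t\<in>K. dist (f (x, t)) (f (p, t)) \<le> e" by metis
  obtain d where "d > 0" "ball p d \<subseteq> X0 \<inter> U"
    using X0(1,2) U p by (meson openE open_Int IntI)
  then show ?thesis
  proof (intro that[of d])
    fix p' t assume "p' \<in> ball p d" "t \<in> K"
    then have "p' \<in> X0 \<inter> U" "t \<in> K" using \<open>ball p d \<subseteq> X0 \<inter> U\<close> by blast+
    then show "norm (f (p', t) - f (p, t)) \<le> e" using X0(3) by (simp only: dist_norm)
  qed auto
qed

lemma continuous_on_tube:
  fixes y :: "'p::metric_space \<times> real \<Rightarrow> 'b::real_normed_vector"
  assumes c: "\<And>p. p \<in> U \<Longrightarrow> continuous_on {-T<..<T} (\<lambda>t. y (p, t))"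
    and tube: "\<And>p \<tau> e. p \<in> U \<Longrightarrow> 0 < \<tau> \<Longrightarrow> \<tau> < T \<Longrightarrow> 0 < e \<Longrightarrow>
      \<exists>d>0. \<forall>p'\<in>U. dist p' p < d \<longrightarrow> (\<forall>t\<in>{-\<tau>..\<tau>}. norm (y (p', t) - y (p, t)) \<le> e)"
  shows "continuous_on (U \<times> {-T<..<T}) y"
  unfolding continuous_on_iff
proof (intro ballI allI impI)
  fix x and e :: real assume "x \<in> U \<times> {-T<..<T}" and e: "0 < e"
  then obtain p t where x: "x = (p, t)" and p: "p \<in> U" and t: "t \<in> {-T<..<T}" by auto
  define \<tau> where "\<tau> = (\<bar>t\<bar> + T) / 2"
  have \<tau>: "0 < \<tau>" "\<tau> < T" "\<bar>t\<bar> < \<tau>" using t by (auto simp: \<tau>_def abs_if)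
  obtain d1 where d1: "d1 > 0" "\<And>p' t. p' \<in> U \<Longrightarrow> dist p' p < d1 \<Longrightarrow> t \<in> {-\<tau>..\<tau>} \<Longrightarrow> norm (y (p', t) - y (p, t)) \<le> e / 2"
    using tube[OF p \<tau>(1,2), of "e/2"] e by auto
  obtain d2 where d2: "d2 > 0" "\<And>t'. t' \<in> {-T<..<T} \<Longrightarrow> dist t' t < d2 \<Longrightarrow> dist (y (p, t')) (y (p, t)) < e / 2"
    using c[OF p] t e unfolding continuous_on_iff by (metis half_gt_zero)
  show "\<exists>d>0. \<forall>x'\<in>U \<times> {-T<..<T}. dist x' x < d \<longrightarrow> dist (y x') (y x) < e"
  proof (intro exI[of _ "min d1 (min d2 (\<tau> - \<bar>t\<bar>))"] conjI ballI impI)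
    show "0 < min d1 (min d2 (\<tau> - \<bar>t\<bar>))" using d1 d2 \<tau> by auto
    fix x' assume "x' \<in> U \<times> {-T<..<T}" and near: "dist x' x < min d1 (min d2 (\<tau> - \<bar>t\<bar>))"
    then obtain p' t' where x': "x' = (p', t')" and p': "p' \<in> U" and t': "t' \<in> {-T<..<T}" by auto
    have dd: "dist p' p < d1" "dist t' t < d2" "dist t' t < \<tau> - \<bar>t\<bar>"
      using near dist_fst_le[of x' x] dist_snd_le[of x' x] unfolding x x' by auto
    then have "t' \<in> {-\<tau>..\<tau>}" by (auto simp: dist_real_def)
    from d1(2)[OF p' dd(1) this] d2(2)[OF t' dd(2)]
    show "dist (y x') (y x) < e"
      using dist_triangle[of "y (p', t')" "y (p, t)" "y (p, t')"] unfolding x x' by (simp add: dist_norm)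
  qed
qed

text \<open>First-order expansion in the parameter with one remainder bound for all times in
  \<open>K\<close>: by compactness the derivative is within \<open>e\<close> of its value at
  \<open>p\<close> over a whole ball of parameters, and the mean value inequality in that ball gives
  the rest.\<close>

lemma tube_linearization:
  fixes f :: "'p::euclidean_space \<times> real \<Rightarrow> 'b::real_normed_vector"
  assumes f: "Ck_on (Suc 0) (U \<times> I) f" and U: "open U" and I: "open I" and K: "compact K" "K \<subseteq> I"
    and p: "p \<in> U" and e: "e > 0"
  obtains d where "d > 0" "ball p d \<subseteq> U"
    "\<And>p' t. p' \<in> ball p d \<Longrightarrow> t \<in> K \<Longrightarrow>
      norm (f (p', t) - f (p, t) - frechet_derivative f (at (p, t)) (p' - p, 0)) \<le> e * norm (p' - p)"
proof -
  let ?F = "\<lambda>x. Blinfun (frechet_derivative f (at x))"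
  have UI: "open (U \<times> I)" using U I by (rule open_Times)
  have "continuous_on (U \<times> I) ?F" by (rule Ck_on_continuous[OF Ck_on_Blinfun_derivative[OF f UI]])
  from tube_estimate[OF this U K p e] obtain d where d: "d > 0" "ball p d \<subseteq> U"
    "\<And>p' t. p' \<in> ball p d \<Longrightarrow> t \<in> K \<Longrightarrow> norm (?F (p', t) - ?F (p, t)) \<le> e" by metis
  have F: "blinfun_apply (?F x) = frechet_derivative f (at x)" if "x \<in> U \<times> I" for x
    by (rule Blinfun_derivative[OF Ck_on_has_derivative[OF f that]])
  have "norm (f (p', t) - f (p, t) - frechet_derivative f (at (p, t)) (p' - p, 0)) \<le> e * norm (p' - p)"
    if p': "p' \<in> ball p d" and t: "t \<in> K" for p' t
  proof -
    let ?g = "\<lambda>q w. frechet_derivative f (at (q, t)) (w, 0)"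
    have in_UI: "(q, t) \<in> U \<times> I" if "q \<in> ball p d" for q using that t K d(2) by auto
    have "norm (f (p', t) - f (p, t) - ?g p (p' - p)) \<le> norm (p' - p) * e"
    proof (rule differentiable_bound_linearization[where S = "ball p d" and f = "\<lambda>q. f (q, t)" and f' = ?g])
      fix s :: real assume "s \<in> {0..1}"
      then show "p + s *\<^sub>R (p' - p) \<in> ball p d"
        using p' d(1) convex_ball[of p d] convexD_alt[of "ball p d" p p' s]
        by (simp add: algebra_simps)
    next
      fix q assume q: "q \<in> ball p d"
      have "((\<lambda>q. (q, t)) has_derivative (\<lambda>w. (w, 0))) (at q)" by (auto intro!: derivative_eq_intros)
      from has_derivative_compose[OF this Ck_on_has_derivative[OF f in_UI[OF q]]]
      show "((\<lambda>q. f (q, t)) has_derivative ?g q) (at q within ball p d)"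
        by (rule has_derivative_at_withinI)
      show "onorm (?g q - ?g p) \<le> e"
      proof (rule onorm_bound)
        fix w :: 'p
        have "(?g q - ?g p) w = (?F (q, t) - ?F (p, t)) (w, 0)"
          using F[OF in_UI[OF q]] F[OF in_UI[of p]] d(1) by (simp add: blinfun.diff_left)
        also have "norm \<dots> \<le> norm (?F (q, t) - ?F (p, t)) * norm (w, 0::real)" by (rule norm_blinfun)
        also have "\<dots> \<le> e * norm w" using d(3)[OF q t] by (simp add: norm_Pair mult_right_mono)
        finally show "norm ((?g q - ?g p) w) \<le> e * norm w" .
      qed (use e in simp)
    qed (use d(1) in simp)
    then show ?thesis by (simp add: mult.commute)
  qed
  then show ?thesis using d by (intro that[of d]) auto
qed

text \<open>The difference of the solutions for \<open>p'\<close> and \<open>p\<close> solves a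
  linear equation with coefficient \<open>A (p', t)\<close>, forced by the changes of
  \<open>A\<close> and \<open>c\<close>. These are uniformly small on the compact time interval, and
  the initial value of the difference is 0, so \<open>gronwall_small\<close> applies.\<close>

lemma linear_ode_tube:
  fixes A :: "'p::euclidean_space \<times> real \<Rightarrow> ('b::banach \<Rightarrow>\<^sub>L 'b)"
  assumes U: "open U" and T: "0 < T" and L: "0 \<le> L" "L * T \<le> 1 / 2"
    and A: "continuous_on (U \<times> {-T<..<T}) A" "\<And>x. x \<in> U \<times> {-T<..<T} \<Longrightarrow> norm (A x) \<le> L"
    and c: "continuous_on (U \<times> {-T<..<T}) c"
    and y: "\<And>p t. p \<in> U \<Longrightarrow> t \<in> {-T<..<T} \<Longrightarrow>
      ((\<lambda>t. y (p, t)) has_vector_derivative A (p, t) (y (p, t)) + c (p, t)) (at t)"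
    and y0: "\<And>p. p \<in> U \<Longrightarrow> y (p, 0) = y0"
    and p: "p \<in> U" and \<tau>: "0 < \<tau>" "\<tau> < T" and e: "0 < e"
  shows "\<exists>d>0. \<forall>p'\<in>U. dist p' p < d \<longrightarrow> (\<forall>t\<in>{-\<tau>..\<tau>}. norm (y (p', t) - y (p, t)) \<le> e)"
proof -
  let ?K = "{-\<tau>..\<tau>}"
  have K: "?K \<subseteq> {-T<..<T}" "compact ?K" using \<tau> by auto
  have "continuous_on ?K (\<lambda>t. y (p, t))"
  proof (intro continuous_at_imp_continuous_on ballI)
    fix t assume "t \<in> ?K"
    then have "t \<in> {-T<..<T}" using K by auto
    from has_vector_derivative_continuous[OF y[OF p this]] show "isCont (\<lambda>t. y (p, t)) t" .
  qed
  then have "bounded ((\<lambda>t. y (p, t)) ` ?K)"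
    by (intro compact_imp_bounded compact_continuous_image) auto
  then obtain Y where Y: "Y > 0" "\<And>t. t \<in> ?K \<Longrightarrow> norm (y (p, t)) \<le> Y" unfolding bounded_pos by auto
  \<comment> \<open>\<open>e1\<close> bounds the changes of both \<open>A\<close> and
    \<open>c\<close>, so the forcing is at most \<open>e1 * (Y + 1)\<close>; the estimate multiplies
    it by \<open>2 * \<tau>\<close>, which yields exactly \<open>e\<close>.\<close>
  define e1 where "e1 = e / (2 * \<tau> * (Y + 1))"
  have e1: "0 < e1" "2 * \<tau> * (e1 * (Y + 1)) = e" using e \<tau> Y by (auto simp: e1_def)
  obtain d1 where d1: "d1 > 0" "\<And>p' t. p' \<in> ball p d1 \<Longrightarrow> t \<in> ?K \<Longrightarrow> norm (A (p', t) - A (p, t)) \<le> e1"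
    using tube_estimate[OF A(1) U K(2,1) p e1(1)] by metis
  obtain d2 where d2: "d2 > 0" "\<And>p' t. p' \<in> ball p d2 \<Longrightarrow> t \<in> ?K \<Longrightarrow> norm (c (p', t) - c (p, t)) \<le> e1"
    using tube_estimate[OF c U K(2,1) p e1(1)] by metis
  show ?thesis
  proof (intro exI[of _ "min d1 d2"] conjI ballI impI)
    show "0 < min d1 d2" using d1 d2 by simp
    fix p' t assume p': "p' \<in> U" "dist p' p < min d1 d2" and t: "t \<in> ?K"
    have b: "p' \<in> ball p d1" "p' \<in> ball p d2" using p'(2) by (auto simp: dist_commute)
    let ?u' = "\<lambda>t. A (p', t) (y (p', t) - y (p, t)) + ((A (p', t) - A (p, t)) (y (p, t)) + (c (p', t) - c (p, t)))"
    have "norm (y (p', t) - y (p, t)) \<le> 2 * norm (y (p', 0) - y (p, 0)) + 2 * \<tau> * (e1 * (Y + 1))"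
    proof (rule gronwall_small[OF _ _ L(1) _ _ t])
      fix t assume t: "t \<in> ?K"
      then have tT: "t \<in> {-T<..<T}" using K by auto
      show "((\<lambda>t. y (p', t) - y (p, t)) has_vector_derivative ?u' t) (at t within ?K)"
      proof -
        have "?u' t = (A (p', t) (y (p', t)) + c (p', t)) - (A (p, t) (y (p, t)) + c (p, t))"
          by (simp add: blinfun.diff_left blinfun.diff_right)
        then show ?thesis
          using has_vector_derivative_at_within[OF has_vector_derivative_diff[OF y[OF p'(1) tT] y[OF p tT]]]
          by (simp only:)
      qed
      have "norm (A (p', t) (y (p', t) - y (p, t))) \<le> norm (A (p', t)) * norm (y (p', t) - y (p, t))"
        by (rule norm_blinfun)
      also have "\<dots> \<le> L * norm (y (p', t) - y (p, t))"
        using A(2)[of "(p', t)"] p'(1) tT by (intro mult_right_mono) auto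
      finally have 1: "norm (A (p', t) (y (p', t) - y (p, t))) \<le> L * norm (y (p', t) - y (p, t))" .
      have "norm ((A (p', t) - A (p, t)) (y (p, t))) \<le> norm (A (p', t) - A (p, t)) * norm (y (p, t))"
        by (rule norm_blinfun)
      also have "\<dots> \<le> e1 * Y" using d1(2)[OF b(1) t] Y(2)[OF t] e1 by (intro mult_mono) auto
      finally have 2: "norm ((A (p', t) - A (p, t)) (y (p, t))) \<le> e1 * Y" .
      have "norm (?u' t) \<le> L * norm (y (p', t) - y (p, t)) + (e1 * Y + e1)"
        by (intro norm_triangle_le add_mono 1 2 d2(2)[OF b(2) t])
      then show "norm (?u' t) \<le> L * norm (y (p', t) - y (p, t)) + e1 * (Y + 1)" by (simp add: algebra_simps)
    next
      show "L * \<tau> \<le> 1 / 2" using mult_left_mono[of \<tau> T L] \<tau> L by simp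
    qed (use e1 Y in simp)
    then show "norm (y (p', t) - y (p, t)) \<le> e" using y0 p p' e1(2) by simp
  qed
qed

text \<open>Supplies the candidates for derivatives with respect to a parameter: \<open>w\<close> is
  the direction of differentiation. Linearity in \<open>w\<close> comes from uniqueness, since sums
  and multiples of solutions solve the problem with the summed or multiplied data.\<close>

lemma linear_ode_family:
  fixes A :: "'p \<times> real \<Rightarrow> ('b::banach \<Rightarrow>\<^sub>L 'b)" and c :: "'w::real_vector \<Rightarrow> 'p \<times> real \<Rightarrow> 'b"
  assumes T: "0 < T" and L: "0 \<le> L" "L * T \<le> 1 / 2"
    and A: "\<And>p. p \<in> U \<Longrightarrow> continuous_on {-T<..<T} (\<lambda>t. A (p, t))"
      "\<And>x. x \<in> U \<times> {-T<..<T} \<Longrightarrow> norm (A x) \<le> L"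
    and c: "\<And>p w. p \<in> U \<Longrightarrow> continuous_on {-T<..<T} (\<lambda>t. c w (p, t))"
      "\<And>x. x \<in> U \<times> {-T<..<T} \<Longrightarrow> linear (\<lambda>w. c w x)"
    and y0: "linear y0"
  obtains \<eta> where "\<And>p w. p \<in> U \<Longrightarrow> \<eta> w (p, 0) = y0 w"
    "\<And>p w t. p \<in> U \<Longrightarrow> t \<in> {-T<..<T} \<Longrightarrow>
      ((\<lambda>t. \<eta> w (p, t)) has_vector_derivative A (p, t) (\<eta> w (p, t)) + c w (p, t)) (at t)"
    "\<And>p t. p \<in> U \<Longrightarrow> t \<in> {-T<..<T} \<Longrightarrow> linear (\<lambda>w. \<eta> w (p, t))"
proof -
  let ?I = "{-T<..<T}"
  have "\<exists>\<eta>. \<eta> 0 = y0 w \<and> (\<forall>t\<in>?I. (\<eta> has_vector_derivative A (p, t) (\<eta> t) + c w (p, t)) (at t))" if p: "p \<in> U" for p w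
  proof -
    obtain \<eta> where "\<eta> 0 = y0 w" "\<And>t. t \<in> ?I \<Longrightarrow> (\<eta> has_vector_derivative A (p, t) (\<eta> t) + c w (p, t)) (at t)"
      using linear_ode_solution[OF T _ L A(1)[OF p] c(1)[OF p], of "y0 w" w] A(2) p by blast
    then show ?thesis by blast
  qed
  then obtain \<eta>' where \<eta>': "\<And>p w. p \<in> U \<Longrightarrow> \<eta>' p w 0 = y0 w"
    "\<And>p w t. p \<in> U \<Longrightarrow> t \<in> ?I \<Longrightarrow> (\<eta>' p w has_vector_derivative A (p, t) (\<eta>' p w t) + c w (p, t)) (at t)"
    by metis
  define \<eta> where "\<eta> w x = \<eta>' (fst x) w (snd x)" for w x
  have \<eta>0: "\<eta> w (p, 0) = y0 w" if "p \<in> U" for p w using \<eta>'(1)[OF that] by (simp add: \<eta>_def)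
  have \<eta>: "((\<lambda>t. \<eta> w (p, t)) has_vector_derivative A (p, t) (\<eta> w (p, t)) + c w (p, t)) (at t)"
    if "p \<in> U" "t \<in> ?I" for p t w using \<eta>'(2)[OF that] by (simp add: \<eta>_def)
  have uniq: "u t = \<eta> w (p, t)"
    if p: "p \<in> U" and t: "t \<in> ?I" and u0: "u 0 = y0 w"
      and u: "\<And>t. t \<in> ?I \<Longrightarrow> (u has_vector_derivative A (p, t) (u t) + c w (p, t)) (at t)" for u w p t
  proof -
    have sub: "s \<in> ?I" if "s \<in> {-\<bar>t\<bar>..\<bar>t\<bar>}" for s using that t by auto
    show ?thesis
    proof (rule linear_ode_unique[of "\<bar>t\<bar>" "\<lambda>t. A (p, t)" L u "\<lambda>t. c w (p, t)" "\<lambda>t. \<eta> w (p, t)"])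
      have "\<bar>t\<bar> \<le> T" using t by auto
      from mult_left_mono[OF this L(1)] show "L * \<bar>t\<bar> \<le> 1 / 2" using L(2) by linarith
      fix s assume s: "s \<in> {-\<bar>t\<bar>..\<bar>t\<bar>}"
      show "norm (A (p, s)) \<le> L" using A(2) p sub[OF s] by simp
      show "(u has_vector_derivative A (p, s) (u s) + c w (p, s)) (at s within {-\<bar>t\<bar>..\<bar>t\<bar>})"
        by (rule has_vector_derivative_at_within[OF u[OF sub[OF s]]])
      show "((\<lambda>t. \<eta> w (p, t)) has_vector_derivative A (p, s) (\<eta> w (p, s)) + c w (p, s)) (at s within {-\<bar>t\<bar>..\<bar>t\<bar>})"
        by (rule has_vector_derivative_at_within[OF \<eta>[OF p sub[OF s]]])
    qed (use L u0 \<eta>0[OF p] in auto)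
  qed
  have "linear (\<lambda>w. \<eta> w (p, t))" if p: "p \<in> U" and t: "t \<in> ?I" for p t
  proof (rule linearI)
    fix v w
    have "\<eta> v (p, t) + \<eta> w (p, t) = \<eta> (v + w) (p, t)"
    proof (rule uniq[OF p t, where u = "\<lambda>t. \<eta> v (p, t) + \<eta> w (p, t)"])
      fix s assume s: "s \<in> ?I"
      show "((\<lambda>t. \<eta> v (p, t) + \<eta> w (p, t)) has_vector_derivative
          A (p, s) (\<eta> v (p, s) + \<eta> w (p, s)) + c (v + w) (p, s)) (at s)"
        using has_vector_derivative_add[OF \<eta>[OF p s, of v] \<eta>[OF p s, of w]] linear_add[OF c(2), of "(p, s)"] p s
        by (simp add: blinfun.add_right algebra_simps)
    qed (simp add: \<eta>0[OF p] linear_add[OF y0])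
    then show "\<eta> (v + w) (p, t) = \<eta> v (p, t) + \<eta> w (p, t)" by simp
  next
    fix r :: real and w
    have "r *\<^sub>R \<eta> w (p, t) = \<eta> (r *\<^sub>R w) (p, t)"
    proof (rule uniq[OF p t, where u = "\<lambda>t. r *\<^sub>R \<eta> w (p, t)"])
      fix s assume s: "s \<in> ?I"
      have "((\<lambda>t. r *\<^sub>R \<eta> w (p, t)) has_vector_derivative r *\<^sub>R (A (p, s) (\<eta> w (p, s)) + c w (p, s))) (at s)"
        by (rule bounded_linear.has_vector_derivative[OF bounded_linear_scaleR_right \<eta>[OF p s]])
      then show "((\<lambda>t. r *\<^sub>R \<eta> w (p, t)) has_vector_derivative
          A (p, s) (r *\<^sub>R \<eta> w (p, s)) + c (r *\<^sub>R w) (p, s)) (at s)"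
        using linear_scale[OF c(2), of "(p, s)"] p s by (simp add: blinfun.scaleR_right algebra_simps)
    qed (simp add: \<eta>0[OF p] linear_scale[OF y0])
    then show "\<eta> (r *\<^sub>R w) (p, t) = r *\<^sub>R \<eta> w (p, t)" by simp
  qed
  with \<eta>0 \<eta> show ?thesis by (intro that[of \<eta>]) auto
qed

lemma continuous_on_time_slice:
  assumes "Ck_on k (U \<times> I) f" "p \<in> U"
  shows "continuous_on I (\<lambda>t. f (p, t))"
  by (rule continuous_on_compose2[OF Ck_on_continuous[OF assms(1)]])
    (use assms in \<open>auto intro!: continuous_intros\<close>)

text \<open>The derivative of the solution with respect to the parameter solves an equation with the same
  linear part, so that the regularity of the solution follows by induction.\<close>

lemma linear_ode_Ck:
  fixes A :: "'p::euclidean_space \<times> real \<Rightarrow> ('b::banach \<Rightarrow>\<^sub>L 'b)"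
  assumes U: "open U" and T: "0 < T" and L: "0 \<le> L" "L * T \<le> 1 / 2"
    and A: "Ck_on k (U \<times> {-T<..<T}) A" "\<And>x. x \<in> U \<times> {-T<..<T} \<Longrightarrow> norm (A x) \<le> L"
    and "Ck_on k (U \<times> {-T<..<T}) c"
    and "\<And>p t. p \<in> U \<Longrightarrow> t \<in> {-T<..<T} \<Longrightarrow>
      ((\<lambda>t. y (p, t)) has_vector_derivative A (p, t) (y (p, t)) + c (p, t)) (at t)"
    and "\<And>p. p \<in> U \<Longrightarrow> y (p, 0) = y0"
  shows "Ck_on k (U \<times> {-T<..<T}) y"
  using assms(5,7-)
proof (induction k arbitrary: c y y0)
  case 0
  have "continuous_on (U \<times> {-T<..<T}) y"
  proof (rule continuous_on_tube)
    fix p assume "p \<in> U"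
    then show "continuous_on {-T<..<T} (\<lambda>t. y (p, t))"
      by (intro continuous_at_imp_continuous_on ballI has_vector_derivative_continuous[OF 0(3)])
  next
    fix p \<tau> and e :: real assume "p \<in> U" "0 < \<tau>" "\<tau> < T" "0 < e"
    then show "\<exists>d>0. \<forall>p'\<in>U. dist p' p < d \<longrightarrow> (\<forall>t\<in>{-\<tau>..\<tau>}. norm (y (p', t) - y (p, t)) \<le> e)"
      using 0 by (intro linear_ode_tube[OF U T L _ A(2), where c = c and y = y and ?y0.0 = y0]) auto
  qed
  then show ?case by simp
next
  case (Suc k)
  let ?I = "{-T<..<T}"
  have UI: "open (U \<times> ?I)" using U by (intro open_Times) auto
  have Ak: "Ck_on k (U \<times> ?I) A" and ck: "Ck_on k (U \<times> ?I) c"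
    using Suc.prems(1,2) by (auto intro: Ck_on_Suc_imp simp del: Ck_on.simps)
  have A1: "Ck_on (Suc 0) (U \<times> ?I) A" and c1: "Ck_on (Suc 0) (U \<times> ?I) c"
    using Suc.prems(1,2) by (auto elim: Ck_on_le simp del: Ck_on.simps)
  have yk: "Ck_on k (U \<times> ?I) y" by (rule Suc.IH[OF Ak ck Suc.prems(3,4)])
  define DA where "DA x w = frechet_derivative A (at x) (w, 0)" for x w
  define Dc where "Dc x w = frechet_derivative c (at x) (w, 0)" for x w
  \<comment> \<open>Formal differentiation of the equation in the parameter direction
    \<open>w\<close> gives the same linear part \<open>A\<close> with this new forcing term. The
    initial value becomes 0, because \<open>y0\<close> does not depend on the parameter. The forcing
    is of class \<open>C^k\<close> since \<open>y\<close> already is, by the induction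
    hypothesis.\<close>
  define cw where "cw w x = DA x w (y x) + Dc x w" for w x
  have DAk: "Ck_on k (U \<times> ?I) (\<lambda>x. DA x w)" and Dck: "Ck_on k (U \<times> ?I) (\<lambda>x. Dc x w)" for w
    using Suc.prems(1,2) by (simp_all add: DA_def Dc_def)
  have cwk: "Ck_on k (U \<times> ?I) (cw w)" for w
    unfolding cw_def[abs_def] by (intro Ck_on_add Ck_on_blinfun_apply DAk Dck yk UI)
  have DA_lin: "linear (DA x)" and Dc_lin: "linear (Dc x)" if "x \<in> U \<times> ?I" for x
  proof -
    have lin0: "linear (\<lambda>w::'p. (w, 0::real))" by (auto intro!: linearI)
    from linear_compose[OF lin0 has_derivative_linear[OF Ck_on_has_derivative[OF A1 that]]]
    show "linear (DA x)" by (simp add: DA_def[abs_def] o_def)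
    from linear_compose[OF lin0 has_derivative_linear[OF Ck_on_has_derivative[OF c1 that]]]
    show "linear (Dc x)" by (simp add: Dc_def[abs_def] o_def)
  qed
  have cw_lin: "linear (\<lambda>w. cw w x)" if "x \<in> U \<times> ?I" for x
    unfolding cw_def using linear_add[OF DA_lin[OF that]] linear_add[OF Dc_lin[OF that]]
      linear_scale[OF DA_lin[OF that]] linear_scale[OF Dc_lin[OF that]]
    by (intro linearI) (simp_all add: blinfun.add_left blinfun.scaleR_left scaleR_right_distrib)
  obtain \<eta> where \<eta>0: "\<And>p w. p \<in> U \<Longrightarrow> \<eta> w (p, 0) = 0"
    and \<eta>: "\<And>p w t. p \<in> U \<Longrightarrow> t \<in> ?I \<Longrightarrow>
      ((\<lambda>t. \<eta> w (p, t)) has_vector_derivative A (p, t) (\<eta> w (p, t)) + cw w (p, t)) (at t)"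
    and \<eta>_lin: "\<And>p t. p \<in> U \<Longrightarrow> t \<in> ?I \<Longrightarrow> linear (\<lambda>w. \<eta> w (p, t))"
    using linear_ode_family[OF T L continuous_on_time_slice[OF Ak] A(2) continuous_on_time_slice[OF cwk] cw_lin linear_zero]
    by blast
  have \<eta>k: "Ck_on k (U \<times> ?I) (\<eta> w)" for w by (rule Suc.IH[OF Ak cwk \<eta> \<eta>0])
  have dp: "((\<lambda>p. y (p, t)) has_derivative (\<lambda>w. \<eta> w (p, t))) (at p)" if p: "p \<in> U" and t: "t \<in> ?I" for p t
    unfolding has_derivative_at_alt
  proof (intro conjI allI impI)
    show "bounded_linear (\<lambda>w. \<eta> w (p, t))" using \<eta>_lin[OF p t] by (simp add: linear_conv_bounded_linear)
    fix e :: real assume e: "0 < e"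
    define \<tau> where "\<tau> = (\<bar>t\<bar> + T) / 2"
    have \<tau>: "0 < \<tau>" "\<tau> < T" "\<bar>t\<bar> < \<tau>" using t by (auto simp: \<tau>_def abs_if)
    let ?K = "{-\<tau>..\<tau>}"
    have K: "?K \<subseteq> ?I" "compact ?K" using \<tau> by auto
    have "bounded ((\<lambda>t. y (p, t)) ` ?K)"
      by (intro compact_imp_bounded compact_continuous_image continuous_on_subset[OF continuous_on_time_slice[OF yk p] K(1)]) auto
    then obtain Y where Y: "Y > 0" "\<And>t. t \<in> ?K \<Longrightarrow> norm (y (p, t)) \<le> Y" unfolding bounded_pos by auto
    have "continuous_on ?I (\<lambda>t. Blinfun (frechet_derivative A (at (p, t))))"
      by (rule continuous_on_compose2[OF Ck_on_continuous[OF Ck_on_Blinfun_derivative[OF A1 UI]]])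
        (use p in \<open>auto intro!: continuous_intros\<close>)
    then have "bounded ((\<lambda>t. Blinfun (frechet_derivative A (at (p, t)))) ` ?K)"
      by (intro compact_imp_bounded compact_continuous_image continuous_on_subset[OF _ K(1)]) auto
    then obtain M where M: "M > 0" "\<And>t. t \<in> ?K \<Longrightarrow> norm (Blinfun (frechet_derivative A (at (p, t)))) \<le> M"
      unfolding bounded_pos by auto
    have DAb: "norm (DA (p, t) w) \<le> M * norm w" if "t \<in> ?K" for t w
    proof -
      have "(p, t) \<in> U \<times> ?I" using that K p by auto
      then have "DA (p, t) w = Blinfun (frechet_derivative A (at (p, t))) (w, 0)"
        unfolding DA_def by (simp add: Blinfun_derivative[OF Ck_on_has_derivative[OF A1]])
      also have "norm \<dots> \<le> norm (Blinfun (frechet_derivative A (at (p, t)))) * norm (w, 0::real)" by (rule norm_blinfun)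
      also have "\<dots> \<le> M * norm w" using M(2)[OF that] by (simp add: norm_Pair mult_right_mono)
      finally show ?thesis .
    qed
    \<comment> \<open>\<open>e1\<close> governs the expansions of \<open>A\<close> and
      \<open>c\<close>, \<open>e2\<close> the continuity of \<open>y\<close>; they are chosen to
      make \<open>small\<close> hold. The bound by 1 on \<open>e1\<close> lets \<open>M + 1\<close>
      serve as a Lipschitz constant of \<open>A\<close> at \<open>p\<close>.\<close>
    define e1 where "e1 = min 1 (e / (4 * \<tau> * (Y + 1)))"
    define e2 where "e2 = e / (4 * \<tau> * (M + 1))"
    have e12: "0 < e1" "e1 \<le> 1" "0 < e2" using e \<tau> Y M by (auto simp: e1_def e2_def)
    have "e1 \<le> e / (4 * \<tau> * (Y + 1))" by (simp add: e1_def)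
    then have "e1 * (4 * \<tau> * (Y + 1)) \<le> e" using \<tau> Y by (simp add: pos_le_divide_eq)
    moreover have "e2 * (4 * \<tau> * (M + 1)) = e" using \<tau> M by (simp add: e2_def)
    ultimately have small: "2 * \<tau> * (e1 * (Y + 1) + (M + 1) * e2) \<le> e" by (simp add: algebra_simps)
    obtain d1 where d1: "d1 > 0" "ball p d1 \<subseteq> U" "\<And>p' t. p' \<in> ball p d1 \<Longrightarrow> t \<in> ?K \<Longrightarrow>
        norm (A (p', t) - A (p, t) - DA (p, t) (p' - p)) \<le> e1 * norm (p' - p)"
      using tube_linearization[OF A1 U _ K(2,1) p e12(1)] unfolding DA_def by (metis open_greaterThanLessThan)
    obtain d2 where d2: "d2 > 0" "\<And>p' t. p' \<in> ball p d2 \<Longrightarrow> t \<in> ?K \<Longrightarrow>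
        norm (c (p', t) - c (p, t) - Dc (p, t) (p' - p)) \<le> e1 * norm (p' - p)"
      using tube_linearization[OF c1 U _ K(2,1) p e12(1)] unfolding Dc_def by (metis open_greaterThanLessThan)
    obtain d3 where d3: "d3 > 0" "\<And>p' t. p' \<in> ball p d3 \<Longrightarrow> t \<in> ?K \<Longrightarrow> norm (y (p', t) - y (p, t)) \<le> e2"
      using tube_estimate[OF Ck_on_continuous[OF yk] U K(2,1) p e12(3)] by metis
    show "\<exists>d>0. \<forall>p'. norm (p' - p) < d \<longrightarrow> norm (y (p', t) - y (p, t) - \<eta> (p' - p) (p, t)) \<le> e * norm (p' - p)"
    proof (intro exI[of _ "min d1 (min d2 d3)"] conjI allI impI)
      show "0 < min d1 (min d2 d3)" using d1 d2 d3 by simp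
      fix p' assume "norm (p' - p) < min d1 (min d2 d3)"
      then have b: "p' \<in> ball p d1" "p' \<in> ball p d2" "p' \<in> ball p d3" by (auto simp: dist_norm norm_minus_commute)
      then have p': "p' \<in> U" using d1 by auto
      define w where "w = p' - p"
      \<comment> \<open>\<open>u\<close> is the error of the proposed linearisation. It solves the
        equation with linear part \<open>A (p, t)\<close> and forcing \<open>?r\<close>: the
        expansion errors of \<open>A\<close> and \<open>c\<close>, and a product of two small
        differences. Each is small compared with \<open>norm w\<close>.\<close>
      define u where "u t = y (p', t) - y (p, t) - \<eta> w (p, t)" for t
      let ?r = "\<lambda>t. (A (p', t) - A (p, t) - DA (p, t) w) (y (p, t)) + ((A (p', t) - A (p, t)) (y (p', t) - y (p, t))
         + (c (p', t) - c (p, t) - Dc (p, t) w))"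
      have "norm (u t) \<le> 2 * norm (u 0) + 2 * \<tau> * ((e1 * (Y + 1) + (M + 1) * e2) * norm w)"
      proof (rule gronwall_small[where u' = "\<lambda>t. A (p, t) (u t) + ?r t" and L = L])
        fix t assume t: "t \<in> ?K"
        then have tI: "t \<in> ?I" using K by auto
        have "(u has_vector_derivative (A (p', t) (y (p', t)) + c (p', t)) - (A (p, t) (y (p, t)) + c (p, t))
            - (A (p, t) (\<eta> w (p, t)) + cw w (p, t))) (at t within ?K)"
          unfolding u_def[abs_def] by (rule has_vector_derivative_at_within) (intro has_vector_derivative_diff Suc.prems(3) \<eta> p p' tI)
        moreover have "A (p, t) (u t) + ?r t = (A (p', t) (y (p', t)) + c (p', t)) - (A (p, t) (y (p, t)) + c (p, t))
            - (A (p, t) (\<eta> w (p, t)) + cw w (p, t))"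
          by (simp add: u_def cw_def blinfun.diff_left blinfun.diff_right)
        ultimately show "(u has_vector_derivative A (p, t) (u t) + ?r t) (at t within ?K)"
          by (simp only:)
        have "norm (A (p, t) (u t)) \<le> norm (A (p, t)) * norm (u t)" by (rule norm_blinfun)
        also have "\<dots> \<le> L * norm (u t)" using A(2)[of "(p, t)"] p tI by (intro mult_right_mono) auto
        finally have 0: "norm (A (p, t) (u t)) \<le> L * norm (u t)" .
        have "norm ((A (p', t) - A (p, t) - DA (p, t) w) (y (p, t))) \<le> norm (A (p', t) - A (p, t) - DA (p, t) w) * norm (y (p, t))"
          by (rule norm_blinfun)
        also have "\<dots> \<le> (e1 * norm w) * Y"
          using d1(3)[OF b(1) t] Y(2)[OF t] e12 by (intro mult_mono) (auto simp: w_def)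
        finally have 1: "norm ((A (p', t) - A (p, t) - DA (p, t) w) (y (p, t))) \<le> (e1 * norm w) * Y" .
        have "norm (A (p', t) - A (p, t)) \<le> norm (A (p', t) - A (p, t) - DA (p, t) w) + norm (DA (p, t) w)"
          using norm_triangle_sub by (metis add.commute)
        also have "\<dots> \<le> e1 * norm w + M * norm w" using d1(3)[OF b(1) t] DAb[OF t, of w] by (auto simp: w_def)
        also have "\<dots> \<le> (M + 1) * norm w" using mult_right_mono[OF e12(2), of "norm w"] by (simp add: algebra_simps)
        finally have "norm (A (p', t) - A (p, t)) \<le> (M + 1) * norm w" .
        then have "norm (A (p', t) - A (p, t)) * norm (y (p', t) - y (p, t)) \<le> ((M + 1) * norm w) * e2"
          using d3(2)[OF b(3) t] M by (intro mult_mono) auto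
        then have 2: "norm ((A (p', t) - A (p, t)) (y (p', t) - y (p, t))) \<le> ((M + 1) * norm w) * e2"
          by (rule order_trans[OF norm_blinfun])
        have 3: "norm (c (p', t) - c (p, t) - Dc (p, t) w) \<le> e1 * norm w" using d2(2)[OF b(2) t] by (simp add: w_def)
        have "norm (A (p, t) (u t) + ?r t) \<le> L * norm (u t) + ((e1 * norm w) * Y + (((M + 1) * norm w) * e2 + e1 * norm w))"
          by (intro norm_triangle_le add_mono 0 1 2 3)
        then show "norm (A (p, t) (u t) + ?r t) \<le> L * norm (u t) + (e1 * (Y + 1) + (M + 1) * e2) * norm w"
          by (simp add: algebra_simps)
      next
        show "L * \<tau> \<le> 1 / 2" using mult_left_mono[of \<tau> T L] \<tau> L by simp
      qed (use L \<tau> e12 Y M in auto)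
      also have "u 0 = 0" unfolding u_def using Suc.prems(4) p p' \<eta>0 by simp
      finally have "norm (u t) \<le> (2 * \<tau> * (e1 * (Y + 1) + (M + 1) * e2)) * norm w" by (simp add: mult.assoc)
      also have "\<dots> \<le> e * norm w" using small by (rule mult_right_mono) simp
      finally show "norm (y (p', t) - y (p, t) - \<eta> (p' - p) (p, t)) \<le> e * norm (p' - p)" by (simp add: u_def w_def)
    qed
  qed
  show ?case
  proof (rule Ck_on_Suc_partials[OF U, where ft = "\<lambda>x. A x (y x) + c x" and fp = "\<lambda>x w. \<eta> w x"])
    show "Ck_on k (U \<times> ?I) (\<lambda>x. A x (y x) + c x)" by (intro Ck_on_add Ck_on_blinfun_apply Ak yk ck UI)
  qed (use Suc.prems(3) dp \<eta>k in auto)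
qed

section \<open>Smooth flows and the exponential map\<close>

text \<open>One \<open>d\<close> serves all base points \<open>a\<close> in \<open>K\<close>; this
  is needed because the base point moves along a flow line. The proof combines uniform continuity of
  the derivative on \<open>K\<close> with the mean value inequality on a segment.\<close>

lemma uniform_linearization:
  fixes H :: "'z::euclidean_space \<Rightarrow> 'b::real_normed_vector"
  assumes H: "Ck_on (Suc 0) V H" and V: "open V" and K: "compact K" "convex K" "K \<subseteq> V" and e: "0 < e"
  obtains d where "d > 0" "\<And>a b. a \<in> K \<Longrightarrow> b \<in> K \<Longrightarrow> norm (b - a) < d \<Longrightarrow>
    norm (H b - H a - frechet_derivative H (at a) (b - a)) \<le> e * norm (b - a)"
proof -
  let ?F = "\<lambda>x. Blinfun (frechet_derivative H (at x))"
  have F: "blinfun_apply (?F x) = frechet_derivative H (at x)" if "x \<in> K" for x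
    by (rule Blinfun_derivative[OF Ck_on_has_derivative[OF H]]) (use that K in auto)
  have "continuous_on K ?F"
    by (rule continuous_on_subset[OF Ck_on_continuous[OF Ck_on_Blinfun_derivative[OF H V]] K(3)])
  then have "uniformly_continuous_on K ?F" using K(1) by (rule compact_uniformly_continuous)
  then obtain d where d: "d > 0" "\<And>x x'. x \<in> K \<Longrightarrow> x' \<in> K \<Longrightarrow> dist x' x < d \<Longrightarrow> dist (?F x') (?F x) < e"
    using e unfolding uniformly_continuous_on_def by metis
  have "norm (H b - H a - frechet_derivative H (at a) (b - a)) \<le> e * norm (b - a)"
    if ab: "a \<in> K" "b \<in> K" "norm (b - a) < d" for a b
  proof -
    let ?S = "closed_segment a b"
    have SK: "?S \<subseteq> K" using ab K by (simp add: closed_segment_subset)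
    have "norm (H b - H a - frechet_derivative H (at a) (b - a)) \<le> norm (b - a) * e"
    proof (rule differentiable_bound_linearization[where S = ?S])
      fix t :: real assume "t \<in> {0..1}"
      moreover have "a + t *\<^sub>R (b - a) = (1 - t) *\<^sub>R a + t *\<^sub>R b" by (simp add: algebra_simps)
      ultimately show "a + t *\<^sub>R (b - a) \<in> ?S" unfolding in_segment by auto
    next
      fix x assume x: "x \<in> ?S"
      then have xK: "x \<in> K" using SK by auto
      then show "(H has_derivative frechet_derivative H (at x)) (at x within ?S)"
        using K(3) by (intro has_derivative_at_withinI[OF Ck_on_has_derivative[OF H]]) auto
      have "dist x a < d"
        using dist_in_closed_segment[OF x] ab(3) by (simp add: dist_norm norm_minus_commute)
      then have le: "norm (?F x - ?F a) \<le> e" using d(2)[OF ab(1) xK] by (simp add: dist_norm)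
      show "onorm (frechet_derivative H (at x) - frechet_derivative H (at a)) \<le> e"
      proof (rule onorm_bound)
        fix w
        have "(frechet_derivative H (at x) - frechet_derivative H (at a)) w = (?F x - ?F a) w"
          by (simp add: F xK ab blinfun.diff_left)
        also have "norm \<dots> \<le> norm (?F x - ?F a) * norm w" by (rule norm_blinfun)
        also have "\<dots> \<le> e * norm w" using le by (rule mult_right_mono) simp
        finally show "norm ((frechet_derivative H (at x) - frechet_derivative H (at a)) w) \<le> e * norm w" .
      qed (use e in simp)
    qed simp
    then show ?thesis by (simp add: mult.commute)
  qed
  with d(1) show ?thesis by (rule that)
qed

lemma bounded_continuous_image:
  fixes f :: "'a::t2_space \<Rightarrow> 'b::real_normed_vector"
  assumes "continuous_on S f" "compact K" "K \<subseteq> S"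
  obtains B where "B > 0" "\<And>x. x \<in> K \<Longrightarrow> norm (f x) \<le> B"
proof -
  have "bounded (f ` K)"
    using assms by (intro compact_imp_bounded compact_continuous_image) (auto intro: continuous_on_subset)
  then show ?thesis using that unfolding bounded_pos by auto
qed

text \<open>Composing \<open>H\<close> with the nearest-point projection onto a closed ball makes it
  globally Lipschitz; solutions starting in the half ball stay inside the ball up to time
  \<open>T\<close>, where the projection is invisible. The derivative in the initial point solves
  the linear equation with coefficient \<open>DH\<close> along the flow, so
  \<open>linear_ode_Ck\<close> raises the regularity of the flow one degree at a time. The last
  conclusion, uniqueness among curves that remain in the ball, is what later makes the exponential
  map homogeneous.\<close>

lemma smooth_flow:
  fixes H :: "'z::euclidean_space \<Rightarrow> 'z"
  assumes V: "open V" and H: "smooth_on V H" and z0: "z0 \<in> V"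
  obtains T R x where "0 < T" "0 < R" "cball z0 R \<subseteq> V"
    "smooth_on (ball z0 (R / 2) \<times> {-T<..<T}) x"
    "\<And>z. z \<in> ball z0 (R / 2) \<Longrightarrow> x (z, 0) = z"
    "\<And>z t. z \<in> ball z0 (R / 2) \<Longrightarrow> t \<in> {-T<..<T} \<Longrightarrow> x (z, t) \<in> cball z0 R"
    "\<And>z t. z \<in> ball z0 (R / 2) \<Longrightarrow> t \<in> {-T<..<T} \<Longrightarrow> ((\<lambda>t. x (z, t)) has_vector_derivative H (x (z, t))) (at t)"
    "\<And>z \<tau> y t. z \<in> ball z0 (R / 2) \<Longrightarrow> \<tau> < T \<Longrightarrow> (\<And>s. s \<in> {-\<tau>..\<tau>} \<Longrightarrow> y s \<in> cball z0 R) \<Longrightarrow>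
      (\<And>s. s \<in> {-\<tau>..\<tau>} \<Longrightarrow> (y has_vector_derivative H (y s)) (at s within {-\<tau>..\<tau>})) \<Longrightarrow>
      y 0 = z \<Longrightarrow> t \<in> {-\<tau>..\<tau>} \<Longrightarrow> y t = x (z, t)"
proof -
  obtain R where R: "R > 0" "cball z0 R \<subseteq> V" using V z0 open_contains_cball by blast
  define K where "K = cball z0 R"
  have K: "compact K" "convex K" "closed K" "K \<noteq> {}" "K \<subseteq> V" using R by (auto simp: K_def)
  have H1: "Ck_on (Suc 0) V H" by (rule smooth_onD[OF H])
  let ?F = "\<lambda>x. Blinfun (frechet_derivative H (at x))"
  have Fck: "Ck_on k V ?F" for k by (rule Ck_on_Blinfun_derivative[OF smooth_onD[OF H] V])
  have F: "blinfun_apply (?F x) = frechet_derivative H (at x)" if "x \<in> V" for x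
    by (rule Blinfun_derivative[OF Ck_on_has_derivative[OF H1 that]])
  obtain M where M: "M > 0" "\<And>x. x \<in> K \<Longrightarrow> norm (?F x) \<le> M"
    using bounded_continuous_image[OF Ck_on_continuous[OF Fck] K(1,5)] by metis
  obtain C where C: "C \<ge> 0" "\<And>x y. x \<in> K \<Longrightarrow> y \<in> K \<Longrightarrow> norm (H x - H y) \<le> C * norm (x - y)"
    using Ck_on_Lipschitz[OF _ V K(1,2,5), of H] H1 by auto
  obtain B where B: "B > 0" "\<And>x. x \<in> K \<Longrightarrow> norm (H x) \<le> B"
    using bounded_continuous_image[OF Ck_on_continuous[OF H1] K(1,5)] by metis
  define L where "L = max M C"
  have L: "0 < L" "M \<le> L" "C \<le> L" using M by (auto simp: L_def)
  have LM: "norm (?F x) \<le> L" if "x \<in> K" for x using M(2)[OF that] L by simp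
  have LC: "norm (H x - H y) \<le> L * norm (x - y)" if "x \<in> K" "y \<in> K" for x y
    using C(2)[OF that] mult_right_mono[OF L(3) norm_ge_zero[of "x - y"]] by simp
  \<comment> \<open>The first bound makes the Picard map a contraction and validates
    \<open>gronwall_small\<close>. With speed at most \<open>B\<close>, the second keeps the
    displacement below \<open>R / 2\<close>.\<close>
  define T where "T = min (1 / (2 * L)) (R / (2 * B))"
  have T: "0 < T" using L B R by (simp add: T_def)
  have LT: "L * T \<le> 1 / 2" using mult_left_mono[of T "1 / (2 * L)" L] L by (simp add: T_def)
  have BT: "B * T \<le> R / 2" using mult_left_mono[of T "R / (2 * B)" B] B by (simp add: T_def)
  let ?U = "ball z0 (R / 2)" and ?I = "{-T<..<T}"
  have UI: "open (?U \<times> ?I)" by (intro open_Times) auto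
  \<comment> \<open>Nearest-point projection onto a convex set does not increase distances, so the
    cut-off field keeps the Lipschitz constant \<open>L\<close>.\<close>
  define P where "P = closest_point K"
  have PK: "P y \<in> K" for y unfolding P_def by (rule closest_point_in_set[OF K(3,4)])
  have Pid: "P y = y" if "y \<in> K" for y unfolding P_def by (rule closest_point_self[OF that])
  have Plip: "norm (P y - P z) \<le> norm (y - z)" for y z
    unfolding P_def using closest_point_lipschitz[OF K(2,3,4), of y z] by (simp add: dist_norm)
  have Pcont: "continuous_on UNIV P"
    unfolding P_def by (rule continuous_on_closest_point[OF K(2,3,4)])
  have "\<exists>y. y 0 = z \<and> (\<forall>t\<in>{-T..T}. (y has_vector_derivative H (P (y t))) (at t within {-T..T}))" for z
  proof -
    obtain y where "y 0 = z" "\<And>t. t \<in> {-T..T} \<Longrightarrow> (y has_vector_derivative H (P (y t))) (at t within {-T..T})"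
    proof (rule picard_global[OF T _ LT, where F = "\<lambda>t y. H (P y)" and ?y0.0 = z])
      show "0 \<le> L" using L by simp
      fix \<phi> :: "real \<Rightarrow> 'z" assume "continuous_on {-T..T} \<phi>"
      then have "continuous_on {-T..T} (\<lambda>t. P (\<phi> t))" by (rule continuous_on_compose2[OF Pcont]) auto
      then show "continuous_on {-T..T} (\<lambda>t. H (P (\<phi> t)))"
        by (rule continuous_on_compose2[OF continuous_on_subset[OF Ck_on_continuous[OF H1] K(5)]]) (use PK in auto)
    next
      fix t y z
      have "norm (H (P y) - H (P z)) \<le> L * norm (P y - P z)" by (rule LC[OF PK PK])
      also have "\<dots> \<le> L * norm (y - z)" using Plip L by (intro mult_left_mono) auto
      finally show "norm (H (P y) - H (P z)) \<le> L * norm (y - z)" .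
    qed blast
    then show ?thesis by blast
  qed
  then obtain X where X: "\<And>z. X z 0 = z"
    "\<And>z t. t \<in> {-T..T} \<Longrightarrow> (X z has_vector_derivative H (P (X z t))) (at t within {-T..T})" by metis
  have XK: "X z t \<in> K" if z: "z \<in> ?U" and t: "t \<in> {-T..T}" for z t
  proof -
    have "norm (X z t - X z 0) \<le> B * \<bar>t - 0\<bar>"
      by (rule vector_mean_value_bound[OF _ X(2) B(2)[OF PK] t]) (use T in auto)
    also have "\<dots> \<le> B * T" using t B by (intro mult_left_mono) auto
    finally have "norm (X z t - z) \<le> R / 2" using BT X(1) by simp
    then show ?thesis
      using z dist_triangle[of z0 "X z t" z] by (simp add: K_def dist_norm norm_minus_commute)
  qed
  define x where "x p = X (fst p) (snd p)" for p
  have xK: "x (z, t) \<in> K" if "z \<in> ?U" "t \<in> ?I" for z t using XK[of z t] that by (simp add: x_def)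
  have x0: "x (z, 0) = z" for z by (simp add: x_def X)
  have dx: "((\<lambda>t. x (z, t)) has_vector_derivative H (x (z, t))) (at t)" if z: "z \<in> ?U" and t: "t \<in> ?I" for z t
  proof -
    have "(X z has_vector_derivative H (P (X z t))) (at t within {-T..T})" using t by (intro X(2)) auto
    moreover have "at t within {-T..T} = at t"
      using t by (intro at_within_interior) (auto simp: interior_atLeastAtMost_real)
    moreover have "P (X z t) = X z t" using t by (intro Pid XK z) auto
    ultimately show ?thesis by (simp add: x_def)
  qed
  have small: "L * \<tau> \<le> 1 / 2" if "\<tau> < T" for \<tau>
    using mult_left_mono[OF less_imp_le[OF that], of L] L LT by linarith
  have uniq: "y t = x (z, t)" if z: "z \<in> ?U" and \<tau>: "\<tau> < T" and yK: "\<And>s. s \<in> {-\<tau>..\<tau>} \<Longrightarrow> y s \<in> cball z0 R"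
    and y: "\<And>s. s \<in> {-\<tau>..\<tau>} \<Longrightarrow> (y has_vector_derivative H (y s)) (at s within {-\<tau>..\<tau>})"
    and y0: "y 0 = z" and t: "t \<in> {-\<tau>..\<tau>}" for z \<tau> y t
  proof -
    have "norm (y t - x (z, t)) \<le> 2 * norm (y 0 - x (z, 0)) + 2 * \<tau> * 0"
    proof (rule gronwall_small[where u' = "\<lambda>s. H (y s) - H (x (z, s))" and L = L, OF _ _ _ small[OF \<tau>] _ t])
      fix s assume s: "s \<in> {-\<tau>..\<tau>}"
      then have sI: "s \<in> ?I" using \<tau> by auto
      show "((\<lambda>t. y t - x (z, t)) has_vector_derivative H (y s) - H (x (z, s))) (at s within {-\<tau>..\<tau>})"
        by (intro has_vector_derivative_diff y s has_vector_derivative_at_within[OF dx[OF z sI]])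
      show "norm (H (y s) - H (x (z, s))) \<le> L * norm (y s - x (z, s)) + 0"
        using LC[OF _ xK[OF z sI], of "y s"] yK[OF s] by (simp add: K_def)
    qed (use L in auto)
    then show ?thesis using y0 x0 by simp
  qed
  have lip: "norm (x (z', t) - x (z, t)) \<le> 2 * norm (z' - z)"
    if z: "z \<in> ?U" "z' \<in> ?U" and t: "t \<in> ?I" for z z' t
  proof -
    have T': "\<bar>t\<bar> < T" using t by auto
    have "norm (x (z', t) - x (z, t)) \<le> 2 * norm (x (z', 0) - x (z, 0)) + 2 * \<bar>t\<bar> * 0"
    proof (rule gronwall_small[where u' = "\<lambda>s. H (x (z', s)) - H (x (z, s))" and L = L, OF _ _ _ small[OF T']])
      fix s assume s: "s \<in> {-\<bar>t\<bar>..\<bar>t\<bar>}"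
      then have sI: "s \<in> ?I" using T' by auto
      show "((\<lambda>t. x (z', t) - x (z, t)) has_vector_derivative H (x (z', s)) - H (x (z, s))) (at s within {-\<bar>t\<bar>..\<bar>t\<bar>})"
        by (intro has_vector_derivative_diff has_vector_derivative_at_within[OF dx[OF _ sI]] z)
      show "norm (H (x (z', s)) - H (x (z, s))) \<le> L * norm (x (z', s) - x (z, s)) + 0"
        using LC[OF xK[OF z(2) sI] xK[OF z(1) sI]] by simp
    qed (use L in auto)
    then show ?thesis using x0 by simp
  qed
  have smooth: "Ck_on k (?U \<times> ?I) x" for k
  proof (induction k)
    case 0
    have "continuous_on (?U \<times> ?I) x"
    proof (rule continuous_on_tube)
      fix z assume "z \<in> ?U"
      then show "continuous_on ?I (\<lambda>t. x (z, t))"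
        by (intro continuous_at_imp_continuous_on ballI has_vector_derivative_continuous[OF dx])
    next
      fix z \<tau> and e :: real assume *: "z \<in> ?U" "0 < \<tau>" "\<tau> < T" "0 < e"
      show "\<exists>d>0. \<forall>z'\<in>?U. dist z' z < d \<longrightarrow> (\<forall>t\<in>{-\<tau>..\<tau>}. norm (x (z', t) - x (z, t)) \<le> e)"
      proof (intro exI[of _ "e / 2"] conjI ballI impI)
        fix z' t assume z': "z' \<in> ?U" "dist z' z < e / 2" and "t \<in> {-\<tau>..\<tau>}"
        then have "t \<in> ?I" using * by auto
        from lip[OF *(1) z'(1) this] z'(2) show "norm (x (z', t) - x (z, t)) \<le> e" by (simp add: dist_norm)
      qed (use * in simp)
    qed
    then show ?case by simp
  next
    case (Suc k)
    have img: "x ` (?U \<times> ?I) \<subseteq> V" using xK K(5) by blast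
    \<comment> \<open>Coefficient of the variational equation. It is of class \<open>C^k\<close>
      because the flow is, by the induction hypothesis; then so is the solution \<eta>, whose
      initial value is \<open>w\<close> because \<open>x (z, 0) = z\<close>.\<close>
    define A where "A p = ?F (x p)" for p
    have Ak: "Ck_on k (?U \<times> ?I) A" unfolding A_def[abs_def] by (rule Ck_on_compose[OF Suc.IH Fck UI V img])
    have Ab: "norm (A p) \<le> L" if "p \<in> ?U \<times> ?I" for p using that xK LM by (auto simp: A_def)
    have Ac: "continuous_on ?I (\<lambda>t. A (z, t))" if "z \<in> ?U" for z by (rule continuous_on_time_slice[OF Ak that])
    obtain \<eta> where \<eta>0: "\<And>z w. z \<in> ?U \<Longrightarrow> \<eta> w (z, 0) = w"
      and \<eta>: "\<And>z w t. z \<in> ?U \<Longrightarrow> t \<in> ?I \<Longrightarrow>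
        ((\<lambda>t. \<eta> w (z, t)) has_vector_derivative A (z, t) (\<eta> w (z, t)) + 0) (at t)"
      and \<eta>_lin: "\<And>z t. z \<in> ?U \<Longrightarrow> t \<in> ?I \<Longrightarrow> linear (\<lambda>w. \<eta> w (z, t))"
      using linear_ode_family[OF T less_imp_le[OF L(1)] LT Ac Ab continuous_on_const linear_zero linear_ident] by blast
    have \<eta>k: "Ck_on k (?U \<times> ?I) (\<eta> w)" for w
      by (rule linear_ode_Ck[OF open_ball T _ LT Ak Ab Ck_on_const \<eta> \<eta>0]) (use L in auto)
    have dz: "((\<lambda>z. x (z, t)) has_derivative (\<lambda>w. \<eta> w (z, t))) (at z)" if z: "z \<in> ?U" and t: "t \<in> ?I" for z t
      unfolding has_derivative_at_alt
    proof (intro conjI allI impI)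
      show "bounded_linear (\<lambda>w. \<eta> w (z, t))" using \<eta>_lin[OF z t] by (simp add: linear_conv_bounded_linear)
      fix e :: real assume e: "0 < e"
      have T': "\<bar>t\<bar> < T" using t by auto
      \<comment> \<open>The factor 4 is the product of the 2 in \<open>gronwall_small\<close> and
        the 2 by which the flow may expand distances according to \<open>lip\<close>. The same
        expansion explains \<open>d / 2\<close> below.\<close>
      define e1 where "e1 = e / (4 * T)"
      have e1: "0 < e1" "4 * T * e1 = e" using e T by (auto simp: e1_def)
      obtain d where d: "d > 0" "\<And>a b. a \<in> K \<Longrightarrow> b \<in> K \<Longrightarrow> norm (b - a) < d \<Longrightarrow>
          norm (H b - H a - frechet_derivative H (at a) (b - a)) \<le> e1 * norm (b - a)"
        using uniform_linearization[OF H1 V K(1,2,5) e1(1)] by metis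
      obtain d' where d': "d' > 0" "ball z d' \<subseteq> ?U" using z openE[OF open_ball] by metis
      show "\<exists>d>0. \<forall>z'. norm (z' - z) < d \<longrightarrow> norm (x (z', t) - x (z, t) - \<eta> (z' - z) (z, t)) \<le> e * norm (z' - z)"
      proof (intro exI[of _ "min d' (d / 2)"] conjI allI impI)
        show "0 < min d' (d / 2)" using d d' by simp
        fix z' assume n: "norm (z' - z) < min d' (d / 2)"
        then have "z' \<in> ball z d'" by (simp add: dist_norm norm_minus_commute)
        then have z': "z' \<in> ?U" using d'(2) by blast
        define w where "w = z' - z"
        define u where "u t = x (z', t) - x (z, t) - \<eta> w (z, t)" for t
        let ?r = "\<lambda>s. H (x (z', s)) - H (x (z, s)) - A (z, s) (x (z', s) - x (z, s))"
        have "norm (u t) \<le> 2 * norm (u 0) + 2 * \<bar>t\<bar> * (e1 * (2 * norm w))"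
        proof (rule gronwall_small[where u' = "\<lambda>s. A (z, s) (u s) + ?r s" and L = L, OF _ _ _ small[OF T']])
          fix s assume s: "s \<in> {-\<bar>t\<bar>..\<bar>t\<bar>}"
          then have sI: "s \<in> ?I" using T' by auto
          have "(u has_vector_derivative H (x (z', s)) - H (x (z, s)) - (A (z, s) (\<eta> w (z, s)) + 0)) (at s within {-\<bar>t\<bar>..\<bar>t\<bar>})"
            unfolding u_def[abs_def]
            by (rule has_vector_derivative_at_within) (intro has_vector_derivative_diff dx \<eta> z z' sI)
          moreover have "A (z, s) (u s) + ?r s = H (x (z', s)) - H (x (z, s)) - (A (z, s) (\<eta> w (z, s)) + 0)"
            by (simp add: u_def blinfun.diff_right)
          ultimately show "(u has_vector_derivative A (z, s) (u s) + ?r s) (at s within {-\<bar>t\<bar>..\<bar>t\<bar>})" by (simp only:)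
          have "norm (A (z, s) (u s)) \<le> norm (A (z, s)) * norm (u s)" by (rule norm_blinfun)
          also have "\<dots> \<le> L * norm (u s)" using Ab[of "(z, s)"] z sI by (intro mult_right_mono) auto
          finally have 1: "norm (A (z, s) (u s)) \<le> L * norm (u s)" .
          have l: "norm (x (z', s) - x (z, s)) \<le> 2 * norm w" using lip[OF z z' sI] by (simp add: w_def)
          then have "norm (x (z', s) - x (z, s)) < d" using n by (simp add: w_def)
          then have "norm (?r s) \<le> e1 * norm (x (z', s) - x (z, s))"
            using d(2)[OF xK[OF z sI] xK[OF z' sI]] F[of "x (z, s)"] xK[OF z sI] K(5) by (auto simp: A_def)
          also have "\<dots> \<le> e1 * (2 * norm w)" using l e1 by (intro mult_left_mono) auto
          finally have 2: "norm (?r s) \<le> e1 * (2 * norm w)" .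
          show "norm (A (z, s) (u s) + ?r s) \<le> L * norm (u s) + e1 * (2 * norm w)"
            by (intro norm_triangle_le add_mono 1 2)
        qed (use L e1 in auto)
        also have "u 0 = 0" unfolding u_def by (simp add: x0 \<eta>0[OF z] w_def)
        also have "2 * norm (0::'z) + 2 * \<bar>t\<bar> * (e1 * (2 * norm w)) \<le> 2 * T * (e1 * (2 * norm w))"
          using T' e1 by (simp add: mult_right_mono)
        also have "\<dots> = (4 * T * e1) * norm w" by simp
        finally have "norm (u t) \<le> e * norm w" unfolding e1(2) .
        then show "norm (x (z', t) - x (z, t) - \<eta> (z' - z) (z, t)) \<le> e * norm (z' - z)" by (simp add: u_def w_def)
      qed
    qed
    show ?case
    proof (rule Ck_on_Suc_partials[where ft = "\<lambda>p. H (x p)" and fp = "\<lambda>p w. \<eta> w p"])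
      show "Ck_on k (?U \<times> ?I) (\<lambda>p. H (x p))" by (rule Ck_on_compose[OF Suc.IH smooth_onD[OF H] UI V img])
    qed (use dx dz \<eta>k in auto)
  qed
  show ?thesis
    by (rule that[of T R x]) (use T R smooth x0 xK dx uniq in \<open>auto simp: smooth_on_def K_def\<close>)
qed


section \<open>The geodesic equation as a first-order system\<close>

lemma has_vector_derivative_rescale:
  assumes "(f has_vector_derivative f') (at (c * t))"
  shows "((\<lambda>s. f (c * s)) has_vector_derivative c *\<^sub>R f') (at t)"
proof -
  have "((\<lambda>s. c * s) has_vector_derivative c) (at t)" by (auto intro!: derivative_eq_intros)
  from vector_diff_chain_at[OF this assms] show ?thesis by (simp add: o_def)
qed

lemma smooth_on_Pair:
  "smooth_on S f \<Longrightarrow> smooth_on S g \<Longrightarrow> open S \<Longrightarrow> smooth_on S (\<lambda>x. (f x, g x))"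
  unfolding smooth_on_def by (blast intro: Ck_on_Pair)

text \<open>Smoothness of \<open>G x u v\<close> is given for constant \<open>u\<close> and
  \<open>v\<close> only; expanding both moving arguments in bases reduces to that case.\<close>

lemma smooth_on_bilinear_family:
  fixes G :: "'a::euclidean_space \<Rightarrow> 'b::euclidean_space \<Rightarrow> 'c::euclidean_space \<Rightarrow> 'd::real_normed_vector"
  assumes G: "\<And>x. x \<in> S \<Longrightarrow> bilinear (G x)" "\<And>u v. smooth_on S (\<lambda>x. G x u v)"
    and f: "smooth_on T f" and g: "smooth_on T g" and h: "smooth_on T h" "h ` T \<subseteq> S" and op: "open S" "open T"
  shows "smooth_on T (\<lambda>x. G (h x) (f x) (g x))"
proof (rule smooth_on_congI[OF _ op(2)])
  show "smooth_on T (\<lambda>x. \<Sum>i\<in>Basis. \<Sum>j\<in>Basis. (f x \<bullet> i) *\<^sub>R (g x \<bullet> j) *\<^sub>R G (h x) i j)"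
    by (intro smooth_on_sum smooth_on_scaleR smooth_on_linear_compose[OF bounded_linear_inner_left]
        smooth_on_compose[OF h(1) G(2) op(2,1) h(2)] f g op)
  fix x assume x: "x \<in> T"
  then have b: "bilinear (G (h x))" using G h by blast
  have "G (h x) (\<Sum>i\<in>Basis. (f x \<bullet> i) *\<^sub>R i) (\<Sum>j\<in>Basis. (g x \<bullet> j) *\<^sub>R j) =
      (\<Sum>i\<in>Basis. \<Sum>j\<in>Basis. (f x \<bullet> i) *\<^sub>R (g x \<bullet> j) *\<^sub>R G (h x) i j)"
    by (simp only: bilinear_sum[OF b] bilinear_lmul[OF b] bilinear_rmul[OF b] sum.cartesian_product)
      (simp add: case_prod_unfold mult.commute)
  then show "(\<Sum>i\<in>Basis. \<Sum>j\<in>Basis. (f x \<bullet> i) *\<^sub>R (g x \<bullet> j) *\<^sub>R G (h x) i j) = G (h x) (f x) (g x)"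
    by (simp add: euclidean_representation)
qed

text \<open>\<open>H\<close> is the geodesic spray on pairs of position and velocity. The last
  conclusion says that each radial curve \<open>s \<mapsto> E (s y)\<close> satisfies the geodesic
  equation, with its velocity written as a derivative of \<open>E\<close>. It includes the end
  points \<open>l = 1\<close> and \<open>l = -1\<close>, so that later a whole segment through the
  origin may be used.\<close>

lemma smooth_exponential:
  fixes \<Gamma> :: "'e::euclidean_space \<Rightarrow> 'e \<Rightarrow> 'e \<Rightarrow> 'e"
  assumes V: "open V" "x0 \<in> V" and \<Gamma>: "\<And>x. x \<in> V \<Longrightarrow> bilinear (\<Gamma> x)" "\<And>u v. smooth_on V (\<lambda>x. \<Gamma> x u v)"
  obtains r E where "0 < r" "smooth_on (ball 0 r) E" "E ` ball 0 r \<subseteq> V" "E 0 = x0"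
    "\<And>w. frechet_derivative E (at 0) w = w"
    "\<And>y l. y \<in> ball 0 r \<Longrightarrow> \<bar>l\<bar> \<le> 1 \<Longrightarrow>
      ((\<lambda>s. frechet_derivative E (at (s *\<^sub>R y)) y) has_vector_derivative
        - \<Gamma> (E (l *\<^sub>R y)) (frechet_derivative E (at (l *\<^sub>R y)) y) (frechet_derivative E (at (l *\<^sub>R y)) y)) (at l)"
proof -
  define H where "H z = (snd z, - \<Gamma> (fst z) (snd z) (snd z))" for z :: "'e \<times> 'e"
  let ?V = "V \<times> (UNIV :: 'e set)"
  have opV: "open ?V" using V by (intro open_Times) auto
  have fst: "smooth_on S (\<lambda>z::'e \<times> 'e. fst z)" and snd: "smooth_on S (\<lambda>z::'e \<times> 'e. snd z)" if "open S" for S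
    using that by (auto intro!: smooth_on_linear bounded_linear_fst bounded_linear_snd)
  have "smooth_on ?V (\<lambda>z. \<Gamma> (fst z) (snd z) (snd z))"
    by (rule smooth_on_bilinear_family[OF \<Gamma> snd[OF opV] snd[OF opV] fst[OF opV] _ V(1) opV]) auto
  then have "smooth_on ?V (\<lambda>z. - \<Gamma> (fst z) (snd z) (snd z))"
    by (rule smooth_on_linear_compose[OF bounded_linear_minus[OF bounded_linear_ident] _ opV])
  with snd[OF opV] have H: "smooth_on ?V H"
    unfolding H_def[abs_def] by (rule smooth_on_Pair[OF _ _ opV])
  obtain T R x where TR: "0 < T" "0 < R" "cball (x0, 0) R \<subseteq> ?V"
    and x: "smooth_on (ball (x0, 0) (R / 2) \<times> {-T<..<T}) x"
    and x0: "\<And>z. z \<in> ball (x0, 0) (R / 2) \<Longrightarrow> x (z, 0) = z"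
    and xK: "\<And>z t. z \<in> ball (x0, 0) (R / 2) \<Longrightarrow> t \<in> {-T<..<T} \<Longrightarrow> x (z, t) \<in> cball (x0, 0) R"
    and dx: "\<And>z t. z \<in> ball (x0, 0) (R / 2) \<Longrightarrow> t \<in> {-T<..<T} \<Longrightarrow>
      ((\<lambda>t. x (z, t)) has_vector_derivative H (x (z, t))) (at t)"
    and uniq: "\<And>z \<tau> y t. z \<in> ball (x0, 0) (R / 2) \<Longrightarrow> \<tau> < T \<Longrightarrow>
      (\<And>s. s \<in> {-\<tau>..\<tau>} \<Longrightarrow> y s \<in> cball (x0, 0) R) \<Longrightarrow>
      (\<And>s. s \<in> {-\<tau>..\<tau>} \<Longrightarrow> (y has_vector_derivative H (y s)) (at s within {-\<tau>..\<tau>})) \<Longrightarrow>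
      y 0 = z \<Longrightarrow> t \<in> {-\<tau>..\<tau>} \<Longrightarrow> y t = x (z, t)"
    using smooth_flow[OF opV H, of "(x0, 0)"] V by blast
  define k where "k = T / 2"
  have k: "0 < k" "k < T" using TR by (auto simp: k_def)
  define r where "r = k * (R / 2)"
  have r: "0 < r" using k TR by (simp add: r_def)
  \<comment> \<open>The flow is available for times below \<open>T\<close> only, so
    \<open>E w\<close> follows the velocity \<open>w / k\<close> for time \<open>k\<close> instead
    of \<open>w\<close> for time 1. The radius \<open>r\<close> is such that \<open>w / k\<close>
    has norm below \<open>R / 2\<close>.\<close>
  define z where "z w = (x0, (1 / k) *\<^sub>R w)" for w :: 'e
  have zU: "z w \<in> ball (x0, 0) (R / 2)" if "w \<in> ball 0 r" for w
    using that k by (simp add: z_def r_def dist_Pair_Pair pos_divide_less_eq mult.commute)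
  define E where "E w = fst (x (z w, k))" for w
  have zd: "((\<lambda>w. (z w, k)) has_derivative (\<lambda>w. ((0, (1 / k) *\<^sub>R w), 0))) (at w)" for w
    unfolding z_def[abs_def] by (auto intro!: derivative_eq_intros)
  have "Ck_on j (ball 0 r) (\<lambda>w. (z w, k))" for j
  proof -
    have "Ck_on (Suc j) (ball 0 r) (\<lambda>w. (z w, k))"
      by (rule Ck_on_SucI[OF open_ball zd Ck_on_const])
    then show ?thesis by (rule Ck_on_Suc_imp)
  qed
  then have "smooth_on (ball 0 r) (\<lambda>w. (z w, k))" by (simp add: smooth_on_def)
  then have "smooth_on (ball 0 r) (\<lambda>w. x (z w, k))"
    by (rule smooth_on_compose[OF _ x]) (use zU k in \<open>auto intro!: open_Times\<close>)
  then have E: "smooth_on (ball 0 r) E"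
    unfolding E_def[abs_def] by (rule smooth_on_linear_compose[OF bounded_linear_fst _ open_ball])
  have EV: "E ` ball 0 r \<subseteq> V"
  proof
    fix e assume "e \<in> E ` ball 0 r"
    then obtain w where w: "w \<in> ball 0 r" "e = E w" by auto
    have "x (z w, k) \<in> ?V" using xK[OF zU[OF w(1)], of k] TR k by auto
    then show "e \<in> V" using w by (auto simp: E_def mem_Times_iff)
  qed
  have dfst: "((\<lambda>t. fst (x (z w, t))) has_vector_derivative snd (x (z w, t))) (at t)"
    and dsnd: "((\<lambda>t. snd (x (z w, t))) has_vector_derivative - \<Gamma> (fst (x (z w, t))) (snd (x (z w, t))) (snd (x (z w, t)))) (at t)"
    if "w \<in> ball 0 r" "t \<in> {-T<..<T}" for w t
    using bounded_linear.has_vector_derivative[OF bounded_linear_fst dx[OF zU[OF that(1)] that(2)]]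
      bounded_linear.has_vector_derivative[OF bounded_linear_snd dx[OF zU[OF that(1)] that(2)]]
    by (simp_all add: H_def)
  note scale = has_vector_derivative_rescale
  \<comment> \<open>Slowing a solution down by \<open>l\<close> and scaling its velocity by
    \<open>l\<close> gives another solution, because \<Gamma> is quadratic in the velocity. For
    \<open>\<bar>l\<bar> \<le> 1\<close> the velocity only shrinks, so the new curve stays in the
    ball in which uniqueness is known.\<close>
  have hom: "E (l *\<^sub>R w) = fst (x (z w, l * k))" if w: "w \<in> ball 0 r" and l: "\<bar>l\<bar> \<le> 1" for w l
  proof -
    define y where "y s = (fst (x (z w, l * s)), l *\<^sub>R snd (x (z w, l * s)))" for s
    have ls: "l * s \<in> {-T<..<T}" if "s \<in> {-k..k}" for s
    proof -
      have "\<bar>l * s\<bar> \<le> 1 * k" unfolding abs_mult using l that by (intro mult_mono) auto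
      then show ?thesis using k by auto
    qed
    have lw: "l *\<^sub>R w \<in> ball 0 r"
      using w mult_right_mono[OF l, of "norm w"] by simp
    have "y k = x (z (l *\<^sub>R w), k)"
    proof (rule uniq[OF zU[OF lw] k(2)])
      fix s assume s: "s \<in> {-k..k}"
      let ?X = "x (z w, l * s)"
      have "norm (fst ?X - x0, l *\<^sub>R snd ?X) \<le> norm (fst ?X - x0, snd ?X)"
        unfolding norm_Pair using l by (intro real_sqrt_le_mono add_left_mono power_mono) (auto simp: mult_left_le_one_le)
      also have "(fst ?X - x0, snd ?X) = ?X - (x0, 0)" by (simp add: prod_eq_iff)
      also have "norm \<dots> \<le> R" using xK[OF zU[OF w] ls[OF s]] by (simp add: dist_norm norm_minus_commute)
      finally show "y s \<in> cball (x0, 0) R" unfolding mem_cball dist_commute[of "(x0, 0)"] by (simp add: y_def dist_norm)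
      have b: "bilinear (\<Gamma> (fst ?X))"
        using xK[OF zU[OF w] ls[OF s]] TR(3) by (intro \<Gamma>(1)) (auto simp: mem_Times_iff)
      have "((\<lambda>s. l *\<^sub>R snd (x (z w, l * s))) has_vector_derivative l *\<^sub>R (l *\<^sub>R - \<Gamma> (fst ?X) (snd ?X) (snd ?X))) (at s)"
        by (rule bounded_linear.has_vector_derivative[OF bounded_linear_scaleR_right scale[OF dsnd[OF w ls[OF s]]]])
      from has_vector_derivative_Pair[OF scale[OF dfst[OF w ls[OF s]]] this]
      have "(y has_vector_derivative H (y s)) (at s)"
        unfolding y_def[abs_def] H_def by (simp add: bilinear_lmul[OF b] bilinear_rmul[OF b])
      then show "(y has_vector_derivative H (y s)) (at s within {-k..k})"
        by (rule has_vector_derivative_at_within)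
    qed (use k x0 zU[OF w] in \<open>auto simp: y_def z_def\<close>)
    then have "fst (y k) = fst (x (z (l *\<^sub>R w), k))" by (rule arg_cong)
    then show ?thesis by (simp add: E_def y_def)
  qed
  have main: "((\<lambda>s. frechet_derivative E (at (s *\<^sub>R y)) y) has_vector_derivative
        - \<Gamma> (E (l *\<^sub>R y)) (frechet_derivative E (at (l *\<^sub>R y)) y) (frechet_derivative E (at (l *\<^sub>R y)) y)) (at l)"
    and main0: "frechet_derivative E (at 0) y = y" if y: "y \<in> ball 0 r" and l: "\<bar>l\<bar> \<le> 1" for y l
  proof -
    \<comment> \<open>A slightly longer vector still inside the ball makes the radial curve of
      \<open>y\<close> defined on an open interval that contains \<open>[-1, 1]\<close>, so
      two-sided derivatives exist at the end points.\<close>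
    obtain \<mu> where \<mu>: "1 < \<mu>" "\<mu> *\<^sub>R y \<in> ball 0 r"
    proof (cases "y = 0")
      case True
      then show ?thesis using that[of 2] r by simp
    next
      case False
      obtain c where c: "norm y < c" "c < r" using y dense[of "norm y" r] by auto
      have "0 < c" using c(1) norm_ge_zero[of y] by linarith
      then show ?thesis using that[of "c / norm y"] c False by (simp add: pos_less_divide_eq)
    qed
    let ?w = "\<mu> *\<^sub>R y"
    \<comment> \<open>With this factor, \<open>E (s y)\<close> is the position at time
      \<open>\<kappa> * s\<close> on the flow line determined by the longer vector
      \<open>\<mu> y\<close>.\<close>
    define \<kappa> where "\<kappa> = k / \<mu>"
    have \<kappa>\<mu>: "\<kappa> * \<mu> = k" using \<mu> by (simp add: \<kappa>_def)
    have \<kappa>0: "0 < \<kappa>" using k \<mu> by (simp add: \<kappa>_def)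
    let ?J = "{-\<mu><..<\<mu>}"
    have Js: "\<kappa> * s \<in> {-T<..<T}" if "s \<in> ?J" for s
    proof -
      have "\<bar>s\<bar> < \<mu>" using that by auto
      then have "\<bar>\<kappa> * s\<bar> < \<kappa> * \<mu>" unfolding abs_mult using \<kappa>0 by simp
      then show ?thesis using \<kappa>\<mu> k by auto
    qed
    have sy: "s *\<^sub>R y \<in> ball 0 r" if "s \<in> ?J" for s
    proof -
      have "\<bar>s\<bar> \<le> \<mu>" using that by auto
      then have "\<bar>s\<bar> * norm y \<le> \<mu> * norm y" by (rule mult_right_mono) simp
      then show ?thesis using \<mu> by simp
    qed
    have Es: "E (s *\<^sub>R y) = fst (x (z ?w, \<kappa> * s))" if "s \<in> ?J" for s
    proof -
      have "\<bar>s / \<mu>\<bar> \<le> 1" using that \<mu> by (auto simp: abs_le_iff divide_simps)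
      from hom[OF \<mu>(2) this] \<mu>(1) show ?thesis by (simp add: \<kappa>_def mult.commute)
    qed
    have DE: "frechet_derivative E (at (s *\<^sub>R y)) y = \<kappa> *\<^sub>R snd (x (z ?w, \<kappa> * s))" if s: "s \<in> ?J" for s
    proof -
      have 1: "((\<lambda>s. E (0 + s *\<^sub>R y)) has_vector_derivative frechet_derivative E (at (0 + s *\<^sub>R y)) y) (at s)"
        by (rule has_vector_derivative_along_line) (use smooth_on_has_derivative[OF E] sy[OF s] in simp)
      have "((\<lambda>s. fst (x (z ?w, \<kappa> * s))) has_vector_derivative \<kappa> *\<^sub>R snd (x (z ?w, \<kappa> * s))) (at s)"
        by (rule scale[OF dfst[OF \<mu>(2) Js[OF s]]])
      then have "((\<lambda>s. E (0 + s *\<^sub>R y)) has_vector_derivative \<kappa> *\<^sub>R snd (x (z ?w, \<kappa> * s))) (at s)"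
        by (rule has_vector_derivative_transform_within_open[of _ _ _ ?J]) (use s Es in auto)
      from vector_derivative_unique_at[OF 1 this] show ?thesis by simp
    qed
    have lJ: "l \<in> ?J" and 0: "0 \<in> ?J" using l \<mu> by auto
    have z0: "x (z ?w, 0) = z ?w" by (rule x0[OF zU[OF \<mu>(2)]])
    have "\<kappa> *\<^sub>R snd (z ?w) = (\<kappa> * \<mu> / k) *\<^sub>R y" by (simp add: z_def)
    also have "\<dots> = y" using \<kappa>\<mu> k by simp
    finally show "frechet_derivative E (at 0) y = y" using DE[OF 0] z0 by simp
    let ?X = "x (z ?w, \<kappa> * l)"
    have b: "bilinear (\<Gamma> (fst ?X))"
      using xK[OF zU[OF \<mu>(2)] Js[OF lJ]] TR(3) by (intro \<Gamma>(1)) (auto simp: mem_Times_iff)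
    have "((\<lambda>s. \<kappa> *\<^sub>R snd (x (z ?w, \<kappa> * s))) has_vector_derivative \<kappa> *\<^sub>R (\<kappa> *\<^sub>R - \<Gamma> (fst ?X) (snd ?X) (snd ?X))) (at l)"
      by (rule bounded_linear.has_vector_derivative[OF bounded_linear_scaleR_right scale[OF dsnd[OF \<mu>(2) Js[OF lJ]]]])
    then have "((\<lambda>s. frechet_derivative E (at (s *\<^sub>R y)) y) has_vector_derivative
        \<kappa> *\<^sub>R (\<kappa> *\<^sub>R - \<Gamma> (fst ?X) (snd ?X) (snd ?X))) (at l)"
      by (rule has_vector_derivative_transform_within_open[of _ _ _ ?J]) (use lJ DE in auto)
    then show "((\<lambda>s. frechet_derivative E (at (s *\<^sub>R y)) y) has_vector_derivative
        - \<Gamma> (E (l *\<^sub>R y)) (frechet_derivative E (at (l *\<^sub>R y)) y) (frechet_derivative E (at (l *\<^sub>R y)) y)) (at l)"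
      by (simp add: DE[OF lJ] Es[OF lJ] bilinear_lmul[OF b] bilinear_rmul[OF b])
  qed
  \<comment> \<open>For vectors in the ball this was read off from the initial velocity; any other
    vector is first scaled into the ball, with 1 added to avoid division by 0.\<close>
  have DE0: "frechet_derivative E (at 0) w = w" for w
  proof -
    define c where "c = r / (norm w + 1)"
    have nw: "norm w + 1 > 0" using norm_ge_zero[of w] by linarith
    have c: "c > 0" unfolding c_def using r nw by simp
    have "c * (norm w + 1) = r" unfolding c_def using nw by simp
    then have "c * norm w < r" using c by (simp add: algebra_simps)
    then have "c *\<^sub>R w \<in> ball 0 r" using c by simp
    from main0[OF this, of 0] have "frechet_derivative E (at 0) (c *\<^sub>R w) = c *\<^sub>R w" by simp
    moreover have "linear (frechet_derivative E (at 0))"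
      using has_derivative_linear[OF smooth_on_has_derivative[OF E]] r by simp
    ultimately show ?thesis using c by (simp add: linear_scale)
  qed
  have "E 0 = x0" using hom[of 0 0] r x0[OF zU[of 0]] by (simp add: z_def)
  with r E EV DE0 main show ?thesis by (intro that[of r E]) auto
qed

section \<open>Inner forms and the Levi-Civita connection\<close>

lemma inner_formD:
  assumes "inner_form Q"
  shows "bilinear Q" "Q u v = Q v u" "u \<noteq> 0 \<Longrightarrow> 0 < Q u u" "Q u u = 0 \<longleftrightarrow> u = 0"
proof -
  show b: "bilinear Q" "Q u v = Q v u" "u \<noteq> 0 \<Longrightarrow> 0 < Q u u" using assms by (auto simp: inner_form_def)
  have "Q 0 0 = 0" by (rule bilinear_lzero[OF b(1)])
  then show "Q u u = 0 \<longleftrightarrow> u = 0" using assms by (force simp: inner_form_def)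
qed

lemma inner_form_eqI:
  assumes Q: "inner_form Q" and "\<And>w. Q a w = Q b w"
  shows "a = b"
proof -
  have "Q (a - b) (a - b) = 0" using assms(2) by (simp add: bilinear_lsub[OF inner_formD(1)[OF Q]])
  then show ?thesis using inner_formD(4)[OF Q] by simp
qed

lemma inner_form_sum_orthonormal:
  assumes Q: "inner_form Q" and E: "finite E" "\<forall>e\<in>E. \<forall>e'\<in>E. Q e e' = (if e = e' then 1 else 0)" and e: "e \<in> E"
  shows "Q (\<Sum>a\<in>E. c a *\<^sub>R a) e = c e"
proof -
  have "Q (\<Sum>a\<in>E. c a *\<^sub>R a) e = (\<Sum>a\<in>E. c a * Q a e)"
    using Q by (simp add: bilinear_def inner_form_def linear_sum linear_scale o_def)
  also have "\<dots> = (\<Sum>a\<in>E. if a = e then c e else 0)" using E e by (intro sum.cong) auto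
  finally show ?thesis using E e by simp
qed

text \<open>Orthonormalisation with respect to the metric \<open>Q\<close>, which is unrelated to
  the inner product of the coordinate space. Vectors already spanned are dropped
  (\<open>r = 0\<close>), so \<open>S\<close> need not be independent.\<close>

lemma gram_schmidt:
  fixes Q :: "'e::euclidean_space \<Rightarrow> 'e \<Rightarrow> real"
  assumes Q: "inner_form Q" and "finite S"
  shows "\<exists>E. finite E \<and> span E = span S \<and> (\<forall>e\<in>E. \<forall>e'\<in>E. Q e e' = (if e = e' then 1 else 0))"
  using assms(2)
proof (induction S)
  case empty
  then show ?case by (intro exI[of _ "{}"]) auto
next
  case (insert a S)
  then obtain E where E: "finite E" "span E = span S" "\<forall>e\<in>E. \<forall>e'\<in>E. Q e e' = (if e = e' then 1 else 0)" by blast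
  define p where "p = (\<Sum>e\<in>E. Q a e *\<^sub>R e)"
  define r where "r = a - p"
  have p: "p \<in> span E" unfolding p_def by (intro span_sum span_scale span_base)
  have rE: "Q r e = 0" if "e \<in> E" for e
    using inner_form_sum_orthonormal[OF Q E(1,3) that, of "\<lambda>e. Q a e"]
    by (simp add: r_def p_def bilinear_lsub[OF inner_formD(1)[OF Q]])
  have span: "span (insert r E) = span (insert a S)"
  proof -
    have "span (insert r E) = span (insert a E)"
    proof (intro subset_antisym span_minimal insert_subsetI)
      show "r \<in> span (insert a E)" unfolding r_def
        using p span_mono[of E "insert a E"] by (intro span_diff) (auto intro: span_base)
      have "p \<in> span (insert r E)" using p span_mono[of E "insert r E"] by auto
      then have "r + p \<in> span (insert r E)" by (intro span_add) (auto intro: span_base)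
      then show "a \<in> span (insert r E)" by (simp add: r_def)
    qed (auto intro: span_base subspace_span)
    also have "\<dots> = span (insert a S)" using E(2) by (metis span_insert)
    finally show ?thesis .
  qed
  show ?case
  proof (cases "r = 0")
    case True
    then have "span E = span (insert a S)" using span by simp
    then show ?thesis using E by blast
  next
    case False
    define n where "n = (1 / sqrt (Q r r)) *\<^sub>R r"
    have pos: "0 < Q r r" by (rule inner_formD(3)[OF Q False])
    have nE: "Q n e = 0" "Q e n = 0" if "e \<in> E" for e
      using rE[OF that] inner_formD(2)[OF Q, of e r]
      by (simp_all add: n_def bilinear_lmul[OF inner_formD(1)[OF Q]] bilinear_rmul[OF inner_formD(1)[OF Q]])
    have nn: "Q n n = 1"
      using pos by (simp add: n_def bilinear_lmul[OF inner_formD(1)[OF Q]] bilinear_rmul[OF inner_formD(1)[OF Q]] field_simps)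
    have "span (insert n E) = span (insert r E)"
    proof (intro subset_antisym span_minimal insert_subsetI)
      show "n \<in> span (insert r E)" unfolding n_def by (intro span_scale span_base) simp
      have "sqrt (Q r r) *\<^sub>R n \<in> span (insert n E)" by (intro span_scale span_base) simp
      then show "r \<in> span (insert n E)" using pos by (simp add: n_def)
    qed (auto intro: span_base subspace_span)
    moreover have "n \<notin> E" using nn nE by force
    ultimately show ?thesis
      using E span nn nE by (intro exI[of _ "insert n E"]) auto
  qed
qed

lemma orthonormal_basis_exists:
  fixes Q :: "'e::euclidean_space \<Rightarrow> 'e \<Rightarrow> real"
  assumes Q: "inner_form Q" and T: "subspace T"
  obtains E where "finite E" "orthonormal_basis Q T E"
proof -
  obtain S where S: "S \<subseteq> T" "independent S" "T \<subseteq> span S" using basis_exists[of T] by metis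
  then have "finite S" by (simp add: independent_imp_finite)
  from gram_schmidt[OF Q this] obtain E where E: "finite E" "span E = span S"
    "\<forall>e\<in>E. \<forall>e'\<in>E. Q e e' = (if e = e' then 1 else 0)" by blast
  have "span S = T" using S T by (meson span_minimal subset_antisym)
  then have "E \<subseteq> T" "span E = T" using E(2) span_superset by auto
  with E show ?thesis by (intro that[of E]) (auto simp: orthonormal_basis_def)
qed

lemma orthonormal_basis_card:
  fixes Q :: "'e::euclidean_space \<Rightarrow> 'e \<Rightarrow> real"
  assumes Q: "inner_form Q" and E: "orthonormal_basis Q T E"
  shows "finite E" "card E = dim T"
proof -
  have on: "\<forall>e\<in>E. \<forall>e'\<in>E. Q e e' = (if e = e' then 1 else 0)" "E \<subseteq> T" "span E = T"
    using E by (auto simp: orthonormal_basis_def)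
  have "independent E"
    unfolding independent_explicit_finite_subsets
  proof (intro allI impI ballI)
    fix A c v assume A: "A \<subseteq> E" "finite A" "(\<Sum>a\<in>A. c a *\<^sub>R a) = 0" and v: "v \<in> A"
    have "Q (\<Sum>a\<in>A. c a *\<^sub>R a) v = c v"
      by (rule inner_form_sum_orthonormal[OF Q A(2) _ v]) (use A on in blast)
    then show "c v = 0" using A(3) bilinear_lzero[OF inner_formD(1)[OF Q]] by simp
  qed
  then show "finite E" "card E = dim T"
    using on(3) dim_span_eq_card_independent[of E] by (auto simp: independent_imp_finite)
qed

lemma tangential_eqI:
  assumes Q: "inner_form Q" and T: "subspace T" and t: "t \<in> T" "\<And>u. u \<in> T \<Longrightarrow> Q (w - t) u = 0"
  shows "tangential Q T w = t"
  unfolding tangential_def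
proof (rule the_equality)
  show "t \<in> T \<and> (\<forall>u\<in>T. Q (w - t) u = 0)" using t by simp
  fix t' assume t': "t' \<in> T \<and> (\<forall>u\<in>T. Q (w - t') u = 0)"
  then have d: "t - t' \<in> T" using T t by (simp add: subspace_diff)
  have "Q (t - t') (t - t') = Q (w - t') (t - t') - Q (w - t) (t - t')"
    by (simp flip: bilinear_lsub[OF inner_formD(1)[OF Q]])
  then have "Q (t - t') (t - t') = 0" using t(2)[OF d] t' d by simp
  then show "t' = t" using inner_formD(4)[OF Q] by simp
qed

lemma tangential_props:
  fixes Q :: "'e::euclidean_space \<Rightarrow> 'e \<Rightarrow> real"
  assumes Q: "inner_form Q" and T: "subspace T"
  shows "tangential Q T w \<in> T" "u \<in> T \<Longrightarrow> Q (w - tangential Q T w) u = 0"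
proof -
  obtain E where E: "finite E" "orthonormal_basis Q T E" using orthonormal_basis_exists[OF Q T] .
  have on: "\<forall>e\<in>E. \<forall>e'\<in>E. Q e e' = (if e = e' then 1 else 0)" "span E = T"
    using E(2) by (auto simp: orthonormal_basis_def)
  define t where "t = (\<Sum>e\<in>E. Q w e *\<^sub>R e)"
  have t: "t \<in> T" unfolding t_def on(2)[symmetric] by (intro span_sum span_scale span_base)
  have lin: "linear (Q (w - t))" using inner_formD(1)[OF Q] by (simp add: bilinear_def)
  have "Q (w - t) e = 0" if "e \<in> E" for e
    using inner_form_sum_orthonormal[OF Q E(1) on(1) that, of "\<lambda>e. Q w e"]
    by (simp add: t_def bilinear_lsub[OF inner_formD(1)[OF Q]])
  then have 0: "Q (w - t) u = 0" if "u \<in> T" for u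
    using linear_eq_0_on_span[OF lin, of E u] that on(2) by auto
  have "tangential Q T w = t" by (rule tangential_eqI[OF Q T t 0])
  then show "tangential Q T w \<in> T" "u \<in> T \<Longrightarrow> Q (w - tangential Q T w) u = 0" using t 0 by auto
qed

section \<open>Christoffel symbols of a smooth metric\<close>

definition smooth_metric :: "'e::euclidean_space set \<Rightarrow> ('e \<Rightarrow> 'e \<Rightarrow> 'e \<Rightarrow> real) \<Rightarrow> bool" where
  "smooth_metric V G \<longleftrightarrow> open V \<and> (\<forall>x\<in>V. inner_form (G x)) \<and> (\<forall>u v. smooth_on V (\<lambda>x. G x u v))"

lemma smooth_metricD:
  assumes "smooth_metric V G"
  shows "open V" "x \<in> V \<Longrightarrow> inner_form (G x)" "smooth_on V (\<lambda>x. G x u v)" "x \<in> V \<Longrightarrow> bilinear (G x)"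
  using assms by (auto simp: smooth_metric_def inner_form_def)

text \<open>Index lowering: the operator that represents the metric with respect to the inner
  product of the coordinate space. It turns regularity of the metric into regularity of one
  operator-valued map.\<close>

definition flat :: "('e::euclidean_space \<Rightarrow> 'e \<Rightarrow> 'e \<Rightarrow> real) \<Rightarrow> 'e \<Rightarrow> 'e \<Rightarrow>\<^sub>L 'e" where
  "flat G x = Blinfun (\<lambda>u. \<Sum>j\<in>Basis. G x u j *\<^sub>R j)"

lemma bilinear_inner_sum:
  fixes Q :: "'e::euclidean_space \<Rightarrow> 'e \<Rightarrow> real"
  assumes "linear (Q u)"
  shows "(\<Sum>j\<in>Basis. Q u j *\<^sub>R j) \<bullet> w = Q u w"
proof -
  have "Q u w = Q u (\<Sum>j\<in>Basis. (w \<bullet> j) *\<^sub>R j)" by (simp add: euclidean_representation)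
  also have "\<dots> = (\<Sum>j\<in>Basis. (w \<bullet> j) * Q u j)"
    using assms by (simp add: linear_sum linear_scale)
  finally show ?thesis unfolding inner_sum_left by (simp add: inner_commute mult.commute)
qed

lemma flat_apply:
  assumes G: "smooth_metric V G" and x: "x \<in> V"
  shows "flat G x u = (\<Sum>j\<in>Basis. G x u j *\<^sub>R j)" "flat G x u \<bullet> w = G x u w"
proof -
  have b: "linear (\<lambda>u. G x u j)" "linear (G x u)" for u j
    using smooth_metricD(4)[OF G x] by (auto simp: bilinear_def)
  have "bounded_linear (\<lambda>u. \<Sum>j\<in>Basis. G x u j *\<^sub>R j)"
    using b(1) by (intro bounded_linear_sum bounded_linear_scaleR_const) (simp add: linear_conv_bounded_linear)
  then show eq: "flat G x u = (\<Sum>j\<in>Basis. G x u j *\<^sub>R j)" by (simp add: flat_def bounded_linear_Blinfun_apply)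
  show "flat G x u \<bullet> w = G x u w" unfolding eq using b(2) by (rule bilinear_inner_sum)
qed

lemma flat_smooth:
  assumes G: "smooth_metric V G"
  shows "Ck_on k V (flat G)"
proof (rule Ck_on_blinfunI[OF _ smooth_metricD(1)[OF G]])
  fix i
  have "Ck_on k V (\<lambda>x. \<Sum>j\<in>Basis. G x i j *\<^sub>R j)"
    by (intro Ck_on_sum Ck_on_scaleR Ck_on_const smooth_onD[OF smooth_metricD(3)[OF G]] smooth_metricD(1)[OF G])
  then show "Ck_on k V (\<lambda>x. flat G x i)"
    by (rule Ck_on_congI[OF _ smooth_metricD(1)[OF G]]) (simp add: flat_apply(1)[OF G])
qed

text \<open>Index raising. Definiteness makes \<open>flat G x\<close> injective, hence invertible,
  and \<open>Ck_on_blinfun_inverse\<close> makes the inverse smooth in \<open>x\<close>. It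
  transports the smoothness of the metric derivatives to the Christoffel symbols.\<close>

lemma smooth_metric_sharp:
  assumes G: "smooth_metric V G"
  obtains S :: "'e::euclidean_space \<Rightarrow> 'e \<Rightarrow>\<^sub>L 'e"
  where "\<And>k. Ck_on k V S" "\<And>x w v. x \<in> V \<Longrightarrow> G x (S x w) v = w \<bullet> v"
proof -
  have "\<exists>S. S o\<^sub>L flat G x = id_blinfun \<and> flat G x o\<^sub>L S = id_blinfun" if x: "x \<in> V" for x
  proof -
    have lin: "linear (blinfun_apply (flat G x))"
      using blinfun.bounded_linear_right[of "flat G x"] by (simp add: linear_conv_bounded_linear)
    have "inj (blinfun_apply (flat G x))"
    proof (rule injI)
      fix a b assume "flat G x a = flat G x b"
      then have "flat G x a \<bullet> w = flat G x b \<bullet> w" for w by simp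
      then show "a = b" unfolding flat_apply(2)[OF G x]
        by (rule inner_form_eqI[OF smooth_metricD(2)[OF G x]])
    qed
    from linear_injective_isomorphism[OF lin this] obtain f where f: "linear f"
      "\<forall>u. f (flat G x u) = u" "\<forall>u. flat G x (f u) = u" by blast
    have "blinfun_apply (Blinfun f) = f" using f(1) by (simp add: bounded_linear_Blinfun_apply linear_conv_bounded_linear)
    then show ?thesis using f by (intro exI[of _ "Blinfun f"] conjI blinfun_eqI) simp_all
  qed
  then obtain S where S: "\<And>x. x \<in> V \<Longrightarrow> S x o\<^sub>L flat G x = id_blinfun"
    "\<And>x. x \<in> V \<Longrightarrow> flat G x o\<^sub>L S x = id_blinfun" by metis
  show ?thesis
  proof (rule that[of S])
    show "Ck_on k V S" for k by (rule Ck_on_blinfun_inverse[OF flat_smooth[OF G] smooth_metricD(1)[OF G] S])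
    fix x w v assume x: "x \<in> V"
    have "flat G x (S x w) = w" using S(2)[OF x] by (metis blinfun_apply_blinfun_compose blinfun_apply_id_blinfun)
    then show "G x (S x w) v = w \<bullet> v" using flat_apply(2)[OF G x, of "S x w" v] by simp
  qed
qed

abbreviation metric_deriv :: "('e::euclidean_space \<Rightarrow> 'e \<Rightarrow> 'e \<Rightarrow> real) \<Rightarrow> 'e \<Rightarrow> 'e \<Rightarrow> 'e \<Rightarrow> 'e \<Rightarrow> real" where
  "metric_deriv G x u v w \<equiv> frechet_derivative (\<lambda>y. G y v w) (at x) u"

text \<open>The derivative of the metric is defined for each fixed pair \<open>v\<close>,
  \<open>w\<close> separately; expressed through \<open>flat\<close> it is visibly linear in
  both.\<close>

lemma metric_deriv_flat:
  assumes G: "smooth_metric V G" and x: "x \<in> V"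
  shows "metric_deriv G x u v w = frechet_derivative (flat G) (at x) u v \<bullet> w"
proof -
  have "(flat G has_derivative frechet_derivative (flat G) (at x)) (at x)"
    by (rule Ck_on_has_derivative[OF flat_smooth[OF G] x])
  then have "((\<lambda>y. flat G y v) has_derivative (\<lambda>u. frechet_derivative (flat G) (at x) u v)) (at x)"
    by (rule bounded_linear.has_derivative[OF blinfun.bounded_linear_left])
  then have "((\<lambda>y. flat G y v \<bullet> w) has_derivative (\<lambda>u. frechet_derivative (flat G) (at x) u v \<bullet> w)) (at x)"
    by (rule bounded_linear.has_derivative[OF bounded_linear_inner_left])
  then have "((\<lambda>y. G y v w) has_derivative (\<lambda>u. frechet_derivative (flat G) (at x) u v \<bullet> w)) (at x)"
    by (rule has_derivative_transform_within_open[OF _ smooth_metricD(1)[OF G] x]) (simp add: flat_apply(2)[OF G])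
  from frechet_derivative_at[OF this] show ?thesis by metis
qed

lemma metric_deriv_linear:
  assumes G: "smooth_metric V G" and x: "x \<in> V"
  shows "linear (\<lambda>u. metric_deriv G x u v w)" "linear (\<lambda>v. metric_deriv G x u v w)"
    "linear (\<lambda>w. metric_deriv G x u v w)" "metric_deriv G x u v w = metric_deriv G x u w v"
proof -
  show "linear (\<lambda>u. metric_deriv G x u v w)"
    by (rule has_derivative_linear[OF smooth_on_has_derivative[OF smooth_metricD(3)[OF G] x]])
  show "linear (\<lambda>v. metric_deriv G x u v w)" "linear (\<lambda>w. metric_deriv G x u v w)"
    unfolding metric_deriv_flat[OF G x]
    by (auto intro!: linearI simp: blinfun.add_right blinfun.scaleR_right inner_add_left inner_add_right)
  have "(\<lambda>y. G y v w) differentiable (at x)"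
    using smooth_on_has_derivative[OF smooth_metricD(3)[OF G] x] by (auto simp: differentiable_def)
  from frechet_derivative_transform_within_open[OF this smooth_metricD(1)[OF G] x, of "\<lambda>y. G y w v"]
  show "metric_deriv G x u v w = metric_deriv G x u w v"
    using inner_formD(2)[OF smooth_metricD(2)[OF G]] by metis
qed

text \<open>The right-hand side of the Koszul formula for constant coordinate fields, for which the
  bracket terms vanish.\<close>

definition koszul :: "('e::euclidean_space \<Rightarrow> 'e \<Rightarrow> 'e \<Rightarrow> real) \<Rightarrow> 'e \<Rightarrow> 'e \<Rightarrow> 'e \<Rightarrow> 'e \<Rightarrow> real" where
  "koszul G x u v w = (metric_deriv G x u v w + metric_deriv G x v u w - metric_deriv G x w u v) / 2"

lemma levi_civita_ex:
  assumes G: "smooth_metric V G"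
  obtains \<Gamma> where "\<And>x. x \<in> V \<Longrightarrow> bilinear (\<Gamma> x)" "\<And>x u v. x \<in> V \<Longrightarrow> \<Gamma> x u v = \<Gamma> x v u"
    "\<And>x u v w. x \<in> V \<Longrightarrow> G x (\<Gamma> x u v) w = koszul G x u v w" "\<And>u v. smooth_on V (\<lambda>x. \<Gamma> x u v)"
proof -
  obtain S :: "'a \<Rightarrow> 'a \<Rightarrow>\<^sub>L 'a" where S: "\<And>k. Ck_on k V S" "\<And>x w v. x \<in> V \<Longrightarrow> G x (S x w) v = w \<bullet> v"
    using smooth_metric_sharp[OF G] by metis
  define \<Gamma> where "\<Gamma> x u v = S x (\<Sum>j\<in>Basis. koszul G x u v j *\<^sub>R j)" for x u v
  note op = smooth_metricD(1)[OF G]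
  note ml = metric_deriv_linear[OF G]
  have lin: "linear (koszul G x u v)" if "x \<in> V" for x u v
    unfolding koszul_def
    by (rule linearI) (simp_all add: linear_add[OF ml(1)[OF that]] linear_add[OF ml(3)[OF that]]
      linear_scale[OF ml(1)[OF that]] linear_scale[OF ml(3)[OF that]] field_simps)
  have eq: "G x (\<Gamma> x u v) w = koszul G x u v w" if "x \<in> V" for x u v w
    unfolding \<Gamma>_def using that by (simp add: S(2) bilinear_inner_sum[of "koszul G x u" v, OF lin])
  have kadd: "koszul G x (u + u') v w = koszul G x u v w + koszul G x u' v w"
    and kscale: "koszul G x (c *\<^sub>R u) v w = c * koszul G x u v w" if "x \<in> V" for x u u' v w c
    using linear_add[OF ml(1)[OF that]] linear_add[OF ml(2)[OF that]] linear_scale[OF ml(1)[OF that]] linear_scale[OF ml(2)[OF that]]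
    by (simp_all add: koszul_def field_simps)
  have ksym: "koszul G x u v w = koszul G x v u w" if "x \<in> V" for x u v w
    unfolding koszul_def ml(4)[OF that, where u = w and v = u and w = v] by simp
  have sym: "\<Gamma> x u v = \<Gamma> x v u" if "x \<in> V" for x u v
    unfolding \<Gamma>_def using ksym[OF that, of u v] by simp
  have l1: "linear (\<lambda>u. \<Gamma> x u v)" if x: "x \<in> V" for x v
    unfolding \<Gamma>_def
    by (rule linearI) (simp_all add: kadd[OF x] kscale[OF x] scaleR_left_distrib sum.distrib blinfun.add_right
        scaleR_sum_right[symmetric] blinfun.scaleR_right scaleR_scaleR[symmetric] del: scaleR_scaleR)
  then have l2: "linear (\<lambda>v. \<Gamma> x u v)" if "x \<in> V" for x u
    using l1[OF that, of u] sym[OF that] by simp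
  have "smooth_on V (\<lambda>x. \<Gamma> x u v)" for u v
  proof -
    have "Ck_on k V (\<lambda>x. metric_deriv G x a b c)" for a b c k
      by (rule smooth_onD[OF smooth_on_frechet_derivative[OF smooth_metricD(3)[OF G]]])
    then have "Ck_on k V (\<lambda>x. (1/2) *\<^sub>R (metric_deriv G x u v j + metric_deriv G x v u j - metric_deriv G x j u v))" for j k
      by (intro Ck_on_scaleR Ck_on_const Ck_on_add Ck_on_diff op)
    then have "Ck_on k V (\<lambda>x. koszul G x u v j)" for k j by (simp add: koszul_def del: Ck_on.simps)
    then have "Ck_on k V (\<lambda>x. \<Gamma> x u v)" for k
      unfolding \<Gamma>_def by (intro Ck_on_blinfun_apply S(1) Ck_on_sum Ck_on_scaleR Ck_on_const op)
    then show ?thesis by (simp add: smooth_on_def)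
  qed
  with l1 l2 sym eq show ?thesis by (intro that[of \<Gamma>]) (auto simp: bilinear_def)
qed

text \<open>Adding the compatibility equations for two cyclic permutations of the arguments and
  subtracting the third cancels all but one term, by symmetry of \<Gamma>. Existence and uniqueness
  of the connection thus reduce to nondegeneracy of \<open>G x\<close>.\<close>

lemma metric_connection_koszul:
  assumes G: "smooth_metric V G" and x: "x \<in> V" and sym: "\<And>u v. \<Gamma> u v = \<Gamma> v u"
  shows "(\<forall>u v w. metric_deriv G x u v w = G x (\<Gamma> u v) w + G x v (\<Gamma> u w)) \<longleftrightarrow>
    (\<forall>u v w. G x (\<Gamma> u v) w = koszul G x u v w)"
proof (intro iffI allI)
  fix u v w assume *: "\<forall>u v w. metric_deriv G x u v w = G x (\<Gamma> u v) w + G x v (\<Gamma> u w)"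
  note c = inner_formD(2)[OF smooth_metricD(2)[OF G x]]
  show "G x (\<Gamma> u v) w = koszul G x u v w"
    unfolding koszul_def *[rule_format]
    using c[of "\<Gamma> u w" v] c[of "\<Gamma> v w" u] c[of "\<Gamma> w v" u] sym[of u v] sym[of u w] sym[of v w] by simp
next
  fix u v w assume *: "\<forall>u v w. G x (\<Gamma> u v) w = koszul G x u v w"
  have "G x v (\<Gamma> u w) = koszul G x u w v"
    using inner_formD(2)[OF smooth_metricD(2)[OF G x], of v "\<Gamma> u w"] * by simp
  moreover have "koszul G x u w v = (metric_deriv G x u v w + metric_deriv G x w u v - metric_deriv G x v u w) / 2"
    unfolding koszul_def metric_deriv_linear(4)[OF G x, where u = u and v = w and w = v] ..
  moreover have "koszul G x u v w = (metric_deriv G x u v w + metric_deriv G x v u w - metric_deriv G x w u v) / 2"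
    by (simp only: koszul_def)
  ultimately show "metric_deriv G x u v w = G x (\<Gamma> u v) w + G x v (\<Gamma> u w)"
    using * by (simp add: field_simps)
qed

lemma levi_civita_eqI:
  assumes G: "smooth_metric V G" and x: "x \<in> V" and \<Gamma>: "bilinear \<Gamma>" "\<And>u v. \<Gamma> u v = \<Gamma> v u"
    "\<And>u v w. metric_deriv G x u v w = G x (\<Gamma> u v) w + G x v (\<Gamma> u w)"
  shows "levi_civita G x = \<Gamma>"
  unfolding levi_civita_def
proof (rule the_equality)
  show "bilinear \<Gamma> \<and> (\<forall>u v. \<Gamma> u v = \<Gamma> v u) \<and> (\<forall>u v w. metric_deriv G x u v w = G x (\<Gamma> u v) w + G x v (\<Gamma> u w))"
    using \<Gamma> by blast
  fix \<Gamma>' assume *: "bilinear \<Gamma>' \<and> (\<forall>u v. \<Gamma>' u v = \<Gamma>' v u) \<and>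
    (\<forall>u v w. metric_deriv G x u v w = G x (\<Gamma>' u v) w + G x v (\<Gamma>' u w))"
  have "G x (\<Gamma> u v) w = koszul G x u v w" for u v w
    using metric_connection_koszul[OF G x, of \<Gamma>] \<Gamma> by blast
  moreover have "G x (\<Gamma>' u v) w = koszul G x u v w" for u v w
    using metric_connection_koszul[OF G x, of \<Gamma>'] * by blast
  ultimately have "\<Gamma>' u v = \<Gamma> u v" for u v
    by (intro inner_form_eqI[OF smooth_metricD(2)[OF G x]]) simp
  then show "\<Gamma>' = \<Gamma>" by blast
qed

lemma levi_civita_props:
  assumes G: "smooth_metric V G"
  shows "x \<in> V \<Longrightarrow> bilinear (levi_civita G x)" "x \<in> V \<Longrightarrow> levi_civita G x u v = levi_civita G x v u"
    "x \<in> V \<Longrightarrow> metric_deriv G x u v w = G x (levi_civita G x u v) w + G x v (levi_civita G x u w)"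
    "smooth_on V (\<lambda>x. levi_civita G x u v)"
proof -
  obtain \<Gamma> where \<Gamma>: "\<And>x. x \<in> V \<Longrightarrow> bilinear (\<Gamma> x)" "\<And>x u v. x \<in> V \<Longrightarrow> \<Gamma> x u v = \<Gamma> x v u"
    "\<And>x u v w. x \<in> V \<Longrightarrow> G x (\<Gamma> x u v) w = koszul G x u v w" "\<And>u v. smooth_on V (\<lambda>x. \<Gamma> x u v)"
    using levi_civita_ex[OF G] by metis
  have m: "metric_deriv G x u v w = G x (\<Gamma> x u v) w + G x v (\<Gamma> x u w)" if "x \<in> V" for x u v w
    using metric_connection_koszul[OF G that, of "\<Gamma> x"] \<Gamma>(2,3)[OF that] by blast
  have eq: "levi_civita G x = \<Gamma> x" if "x \<in> V" for x
  proof (rule levi_civita_eqI[OF G that])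
    show "bilinear (\<Gamma> x)" by (rule \<Gamma>(1)[OF that])
    show "\<Gamma> x u v = \<Gamma> x v u" for u v by (rule \<Gamma>(2)[OF that])
    show "metric_deriv G x u v w = G x (\<Gamma> x u v) w + G x v (\<Gamma> x u w)" for u v w by (rule m[OF that])
  qed
  show "x \<in> V \<Longrightarrow> bilinear (levi_civita G x)" "x \<in> V \<Longrightarrow> levi_civita G x u v = levi_civita G x v u"
    "x \<in> V \<Longrightarrow> metric_deriv G x u v w = G x (levi_civita G x u v) w + G x v (levi_civita G x u w)"
    by (simp add: eq \<Gamma>(1), simp only: eq \<Gamma>(2)[of x u v], simp only: eq m)
  show "smooth_on V (\<lambda>x. levi_civita G x u v)"
    by (rule smooth_on_congI[OF \<Gamma>(4) smooth_metricD(1)[OF G]]) (simp add: eq)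
qed

section \<open>Change of coordinates for the connection\<close>

lemma has_derivative_derivative_apply:
  fixes f :: "'d::euclidean_space \<Rightarrow> 'e::real_normed_vector"
  assumes f: "Ck_on 2 V f" and V: "open V" and g: "(g has_derivative g') (at x)" "g x \<in> V"
    and Y: "(Y has_derivative Y') (at x)"
  shows "((\<lambda>x. frechet_derivative f (at (g x)) (Y x)) has_derivative
    (\<lambda>h. frechet_derivative (\<lambda>z. frechet_derivative f (at z) (Y x)) (at (g x)) (g' h) +
      frechet_derivative f (at (g x)) (Y' h))) (at x)"
proof -
  have f2: "Ck_on (Suc (Suc 0)) V f" using f by (simp add: numeral_2_eq_2 del: Ck_on.simps)
  \<comment> \<open>Base point and argument both move, so the product rule is applied to the
    derivative as an operator-valued map and then translated back to derivatives in fixed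
    directions.\<close>
  define F where "F z = Blinfun (frechet_derivative f (at z))" for z
  have F: "Ck_on (Suc 0) V F" unfolding F_def[abs_def] by (rule Ck_on_Blinfun_derivative[OF f2 V])
  have app: "blinfun_apply (F z) = frechet_derivative f (at z)" if "z \<in> V" for z
    unfolding F_def by (rule Blinfun_derivative[OF Ck_on_has_derivative[OF f2 that]])
  define F' where "F' = frechet_derivative F (at (g x))"
  have F': "(F has_derivative F') (at (g x))" unfolding F'_def by (rule Ck_on_has_derivative[OF F g(2)])
  have 2: "frechet_derivative (\<lambda>z. frechet_derivative f (at z) v) (at (g x)) u = F' u v" for u v
  proof -
    have "((\<lambda>z. F z v) has_derivative (\<lambda>u. F' u v)) (at (g x))"
      by (rule bounded_linear.has_derivative[OF blinfun.bounded_linear_left F'])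
    then have "((\<lambda>z. frechet_derivative f (at z) v) has_derivative (\<lambda>u. F' u v)) (at (g x))"
      by (rule has_derivative_transform_within_open[OF _ V g(2)]) (simp add: app)
    from frechet_derivative_at[OF this] show ?thesis by metis
  qed
  have "((\<lambda>x. F (g x) (Y x)) has_derivative (\<lambda>h. F (g x) (Y' h) + F' (g' h) (Y x))) (at x)"
    by (rule bounded_bilinear.FDERIV[OF bounded_bilinear_blinfun_apply has_derivative_compose[OF g(1) F'] Y])
  moreover have "\<forall>\<^sub>F z in at x. F (g z) (Y z) = frechet_derivative f (at (g z)) (Y z)"
  proof -
    have "(g \<longlongrightarrow> g x) (at x)" using has_derivative_continuous[OF g(1)] by (simp add: isCont_def)
    from topological_tendstoD[OF this V g(2)] show ?thesis by eventually_elim (simp add: app)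
  qed
  ultimately have "((\<lambda>x. frechet_derivative f (at (g x)) (Y x)) has_derivative (\<lambda>h. F (g x) (Y' h) + F' (g' h) (Y x))) (at x)"
    by (rule has_derivative_transform_eventually) (simp_all add: app g)
  then show ?thesis by (simp add: 2 app g add.commute)
qed

text \<open>The product rule with three factors, again through \<open>flat\<close>, because the
  metric components are differentiable only with their arguments held constant.\<close>

lemma has_derivative_metric_apply:
  assumes G: "smooth_metric V G" and f: "(f has_derivative f') (at x)" "f x \<in> V"
    and a: "(a has_derivative a') (at x)" and b: "(b has_derivative b') (at x)"
  shows "((\<lambda>x. G (f x) (a x) (b x)) has_derivative
    (\<lambda>h. metric_deriv G (f x) (f' h) (a x) (b x) + G (f x) (a' h) (b x) + G (f x) (a x) (b' h))) (at x)"
proof -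
  have F': "(flat G has_derivative frechet_derivative (flat G) (at (f x))) (at (f x))"
    by (rule Ck_on_has_derivative[OF flat_smooth[OF G] f(2)])
  have "((\<lambda>x. flat G (f x) (a x)) has_derivative (\<lambda>h. flat G (f x) (a' h) + frechet_derivative (flat G) (at (f x)) (f' h) (a x))) (at x)"
    by (rule bounded_bilinear.FDERIV[OF bounded_bilinear_blinfun_apply has_derivative_compose[OF f(1) F'] a])
  from bounded_bilinear.FDERIV[OF bounded_bilinear_inner this b]
  have "((\<lambda>x. flat G (f x) (a x) \<bullet> b x) has_derivative
    (\<lambda>h. flat G (f x) (a x) \<bullet> b' h + (flat G (f x) (a' h) + frechet_derivative (flat G) (at (f x)) (f' h) (a x)) \<bullet> b x)) (at x)" .
  moreover have "\<forall>\<^sub>F z in at x. flat G (f z) (a z) \<bullet> b z = G (f z) (a z) (b z)"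
  proof -
    have "(f \<longlongrightarrow> f x) (at x)" using has_derivative_continuous[OF f(1)] by (simp add: isCont_def)
    from topological_tendstoD[OF this smooth_metricD(1)[OF G] f(2)]
    show ?thesis by eventually_elim (simp add: flat_apply(2)[OF G])
  qed
  ultimately have "((\<lambda>x. G (f x) (a x) (b x)) has_derivative
    (\<lambda>h. flat G (f x) (a x) \<bullet> b' h + (flat G (f x) (a' h) + frechet_derivative (flat G) (at (f x)) (f' h) (a x)) \<bullet> b x)) (at x)"
    by (rule has_derivative_transform_eventually) (simp_all add: flat_apply(2)[OF G] f)
  then show ?thesis
    by (simp add: inner_add_left flat_apply(2)[OF G f(2)] metric_deriv_flat[OF G f(2)] algebra_simps)
qed

text \<open>The inhomogeneous transformation law of Christoffel symbols. Solving it for the unknown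
  side gives a form that is symmetric (second derivatives commute) and compatible with
  \<open>G\<close> (differentiate the relation \<open>rel\<close>); uniqueness of the Levi-Civita
  connection then identifies it.\<close>

lemma levi_civita_transform:
  fixes \<phi> :: "'e::euclidean_space \<Rightarrow> 'e"
  assumes G: "smooth_metric V G" and G': "smooth_metric V' G'" and \<phi>: "smooth_on V \<phi>" "\<phi> ` V \<subseteq> V'"
    and rel: "\<And>x u v. x \<in> V \<Longrightarrow>
      G x u v = G' (\<phi> x) (frechet_derivative \<phi> (at x) u) (frechet_derivative \<phi> (at x) v)"
    and x: "x \<in> V"
  shows "frechet_derivative \<phi> (at x) (levi_civita G x u v) =
    levi_civita G' (\<phi> x) (frechet_derivative \<phi> (at x) u) (frechet_derivative \<phi> (at x) v) +
    frechet_derivative (\<lambda>z. frechet_derivative \<phi> (at z) v) (at x) u"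
proof -
  let ?D = "frechet_derivative \<phi> (at x)"
  define D2 where "D2 u v = frechet_derivative (\<lambda>z. frechet_derivative \<phi> (at z) v) (at x) u" for u v
  let ?L = "levi_civita G' (\<phi> x)"
  have y: "\<phi> x \<in> V'" using \<phi> x by auto
  note b = smooth_metricD(4)[OF G x] and b' = smooth_metricD(4)[OF G' y] and bL = levi_civita_props(1)[OF G' y]
  note op = smooth_metricD(1)[OF G]
  have dphi: "(\<phi> has_derivative ?D) (at x)" by (rule smooth_on_has_derivative[OF \<phi>(1) x])
  have lin: "linear ?D" by (rule has_derivative_linear[OF dphi])
  \<comment> \<open>Invertibility is not assumed: \<open>rel\<close> makes the derivative an
    isometry of definite forms, hence injective.\<close>
  have inj: "inj ?D"
  proof (rule injI)
    fix a b assume "?D a = ?D b"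
    then have "G x (a - b) (a - b) = 0"
      unfolding rel[OF x] by (simp add: linear_diff[OF lin] bilinear_lzero[OF b'])
    then show "a = b" using inner_formD(4)[OF smooth_metricD(2)[OF G x]] by simp
  qed
  obtain K where K: "linear K" "\<And>w. K (?D w) = w" "\<And>w. ?D (K w) = w"
    using linear_injective_isomorphism[OF lin inj] by blast
  have dD: "((\<lambda>z. frechet_derivative \<phi> (at z) v) has_derivative (\<lambda>u. D2 u v)) (at x)" for v
    unfolding D2_def by (rule smooth_on_has_derivative[OF smooth_on_frechet_derivative[OF \<phi>(1)] x])
  have D2sym: "D2 u v = D2 v u" for u v
    unfolding D2_def by (rule second_derivative_symmetric[OF smooth_onD[OF \<phi>(1)] op x])
  have D2l1: "linear (\<lambda>u. D2 u v)" for v by (rule has_derivative_linear[OF dD])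
  have D2l2: "linear (D2 u)" for u
  proof -
    have "D2 u = (\<lambda>v. D2 v u)" by (rule ext) (rule D2sym)
    with D2l1[of u] show ?thesis by (simp only:)
  qed
  define \<Gamma> where "\<Gamma> u v = K (?L (?D u) (?D v) + D2 u v)" for u v
  have "levi_civita G x = \<Gamma>"
  proof (rule levi_civita_eqI[OF G x])
    show "bilinear \<Gamma>"
      unfolding bilinear_def \<Gamma>_def
      by (auto intro!: linearI simp: linear_add[OF lin] linear_scale[OF lin] linear_add[OF K(1)] linear_scale[OF K(1)]
         bilinear_ladd[OF bL] bilinear_radd[OF bL] bilinear_lmul[OF bL] bilinear_rmul[OF bL]
         linear_add[OF D2l1] linear_add[OF D2l2] linear_scale[OF D2l1] linear_scale[OF D2l2] scaleR_right_distrib)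
    show "\<Gamma> u v = \<Gamma> v u" for u v
      unfolding \<Gamma>_def using levi_civita_props(2)[OF G' y, of "?D u" "?D v"] D2sym[of u v] by simp
    fix u v w
    define R where "R h = metric_deriv G' (\<phi> x) (?D h) (?D v) (?D w) + G' (\<phi> x) (D2 h v) (?D w) + G' (\<phi> x) (?D v) (D2 h w)" for h
    have "((\<lambda>z. G' (\<phi> z) (frechet_derivative \<phi> (at z) v) (frechet_derivative \<phi> (at z) w)) has_derivative R) (at x)"
      unfolding R_def[abs_def] by (rule has_derivative_metric_apply[OF G' dphi y dD dD])
    then have "((\<lambda>z. G z v w) has_derivative R) (at x)"
      by (rule has_derivative_transform_within_open[OF _ op x]) (simp only: rel)
    from frechet_derivative_at[OF this] have "metric_deriv G x u v w = R u" by simp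
    also have "R u = metric_deriv G' (\<phi> x) (?D u) (?D v) (?D w) + G' (\<phi> x) (D2 u v) (?D w) + G' (\<phi> x) (?D v) (D2 u w)"
      by (rule R_def)
    also have "\<dots> = G x (\<Gamma> u v) w + G x v (\<Gamma> u w)"
      unfolding rel[OF x] \<Gamma>_def K(3) levi_civita_props(3)[OF G' y]
      by (simp add: bilinear_ladd[OF b'] bilinear_radd[OF b'])
    finally show "metric_deriv G x u v w = G x (\<Gamma> u v) w + G x v (\<Gamma> u w)" .
  qed
  then show ?thesis by (simp add: \<Gamma>_def K(3) D2_def)
qed

section \<open>Charts and tangent spaces\<close>

lemma chart_inverse:
  assumes "is_chart c"
  shows "p \<in> cdom c \<Longrightarrow> inv_coord c (coord c p) = p"
    "x \<in> coord c ` cdom c \<Longrightarrow> coord c (inv_coord c x) = x"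
    "x \<in> coord c ` cdom c \<Longrightarrow> inv_coord c x \<in> cdom c"
    "continuous_on (cdom c) (coord c)" "continuous_on (coord c ` cdom c) (inv_coord c)"
    "open (cdom c)" "open (coord c ` cdom c)"
  using assms by (auto simp: is_chart_def homeomorphism_def)

lemma chart_image_open:
  assumes c: "is_chart c" and U: "open U"
  shows "open (coord c ` (cdom c \<inter> U))"
proof -
  have "coord c ` (cdom c \<inter> U) = coord c ` cdom c \<inter> inv_coord c -` U"
    using chart_inverse[OF c] by force
  then show ?thesis
    using continuous_open_preimage[OF chart_inverse(5,7)[OF c] U] by simp
qed

lemma inv_coord_mem_iff:
  assumes c: "is_chart c" and x: "x \<in> coord c ` cdom c"
  shows "inv_coord c x \<in> S \<longleftrightarrow> x \<in> coord c ` (cdom c \<inter> S)"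
proof -
  obtain p where p: "p \<in> cdom c" "x = coord c p" using x by auto
  have "coord c p' = coord c p \<Longrightarrow> p' \<in> cdom c \<Longrightarrow> p' = p" for p'
    using chart_inverse(1)[OF c] p(1) by metis
  then show ?thesis using p chart_inverse(1)[OF c p(1)] by auto
qed

lemma smooth_on_continuous: "smooth_on S f \<Longrightarrow> continuous_on S f"
  by (rule Ck_on_continuous[OF smooth_onD])

lemma smooth_on_has_vector_derivative:
  fixes f :: "real \<Rightarrow> 'a::real_normed_vector"
  assumes "smooth_on S f" "t \<in> S"
  shows "(f has_vector_derivative vector_derivative f (at t)) (at t)"
  using differentiableI[OF smooth_on_has_derivative[OF assms]] by (simp only: vector_derivative_works)

lemma smooth_on_vector_derivative:
  fixes f :: "real \<Rightarrow> 'a::real_normed_vector"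
  assumes "smooth_on S f" "open S"
  shows "smooth_on S (\<lambda>t. vector_derivative f (at t))"
proof (rule smooth_on_congI[OF smooth_on_frechet_derivative[OF assms(1), of 1] assms(2)])
  fix t assume "t \<in> S"
  from smooth_on_has_derivative[OF assms(1) this]
  show "frechet_derivative f (at t) 1 = vector_derivative f (at t)"
    by (simp add: frechet_derivative_eq_vector_derivative differentiableI)
qed

text \<open>The part of \<open>f'\<close> orthogonal to \<open>W\<close> pairs to zero with every
  value of \<open>f\<close>, hence with \<open>f'\<close>, hence with itself.\<close>

lemma vector_derivative_in_subspace:
  fixes f :: "real \<Rightarrow> 'a::euclidean_space"
  assumes W: "subspace W" and f: "(f has_vector_derivative f') (at t)" and J: "open J" "t \<in> J"
    and fW: "\<And>s. s \<in> J \<Longrightarrow> f s \<in> W"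
  shows "f' \<in> W"
proof -
  obtain y z where yz: "y \<in> span W" "\<And>w. w \<in> span W \<Longrightarrow> orthogonal z w" "f' = y + z"
    using orthogonal_subspace_decomp_exists[of W f'] by metis
  have sW: "span W = W" using W by (simp add: span_eq_iff)
  have "((\<lambda>s. z \<bullet> f s) has_vector_derivative z \<bullet> f') (at t)"
    by (rule bounded_linear.has_vector_derivative[OF bounded_linear_inner_right f])
  moreover have "((\<lambda>s. z \<bullet> f s) has_vector_derivative 0) (at t)"
    by (rule has_vector_derivative_transform_within_open[OF has_vector_derivative_const J])
      (use fW yz(2) sW in \<open>simp add: orthogonal_def\<close>)
  ultimately have "z \<bullet> f' = 0" by (rule vector_derivative_unique_at)
  moreover have "z \<bullet> y = 0" using yz(1,2) by (simp add: orthogonal_def)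
  ultimately have "z = 0" using yz(3) by (simp add: inner_add_right)
  then show ?thesis using yz(1,3) sW by simp
qed

lemma open_real_symmetric_interval:
  assumes "open J" "(0::real) \<in> J"
  obtains e where "0 < e" "{-e<..<e} \<subseteq> J"
proof -
  obtain e where "0 < e" "ball 0 e \<subseteq> J" using assms openE by blast
  then show ?thesis by (intro that[of e]) (auto simp: ball_eq_greaterThanLessThan)
qed

lemma tangent_spaceI:
  assumes c: "is_chart c" and p: "p \<in> cdom c" and \<sigma>: "smooth_on {-e<..<e} \<sigma>" "0 < e" "\<sigma> 0 = coord c p"
    and S: "\<And>t. t \<in> {-e<..<e} \<Longrightarrow> \<sigma> t \<in> coord c ` (cdom c \<inter> S)"
    and v: "(\<sigma> has_vector_derivative v) (at 0)"
  shows "v \<in> tangent_space c S p"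
proof -
  define \<gamma> where "\<gamma> t = inv_coord c (\<sigma> t)" for t
  have in_c: "\<sigma> t \<in> coord c ` cdom c" if "t \<in> {-e<..<e}" for t using S[OF that] by auto
  have eq: "(coord c \<circ> \<gamma>) t = \<sigma> t" if "t \<in> {-e<..<e}" for t
    using chart_inverse(2)[OF c in_c[OF that]] by (simp add: \<gamma>_def)
  have "\<gamma> 0 = p" using chart_inverse(1)[OF c p] \<sigma>(3) by (simp add: \<gamma>_def)
  moreover have "\<gamma> t \<in> S \<inter> cdom c" if "t \<in> {-e<..<e}" for t
    using S[OF that] inv_coord_mem_iff[OF c in_c[OF that], of S] chart_inverse(3)[OF c in_c[OF that]] by (simp add: \<gamma>_def)
  moreover have "smooth_on {-e<..<e} (coord c \<circ> \<gamma>)"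
    by (rule smooth_on_congI[OF \<sigma>(1)]) (use eq in auto)
  moreover have "((coord c \<circ> \<gamma>) has_vector_derivative v) (at 0)"
    by (rule has_vector_derivative_transform_within_open[OF v, of "{-e<..<e}"]) (use eq \<sigma> in auto)
  then have "v = vector_derivative (coord c \<circ> \<gamma>) (at 0)" by (simp add: vector_derivative_at)
  ultimately show ?thesis unfolding tangent_space_def using \<sigma>(2) by blast
qed

lemma tangent_spaceE:
  assumes "v \<in> tangent_space c S p"
  obtains \<sigma> e where "0 < e" "smooth_on {-e<..<e} \<sigma>" "\<sigma> 0 = coord c p"
    "\<And>t. t \<in> {-e<..<e} \<Longrightarrow> \<sigma> t \<in> coord c ` (cdom c \<inter> S)" "(\<sigma> has_vector_derivative v) (at 0)"
proof -
  obtain \<gamma> e where \<gamma>: "e > 0" "\<gamma> 0 = p" "\<forall>t\<in>{-e<..<e}. \<gamma> t \<in> S \<inter> cdom c"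
    "smooth_on {-e<..<e} (coord c \<circ> \<gamma>)" "v = vector_derivative (coord c \<circ> \<gamma>) (at 0)"
    using assms unfolding tangent_space_def by blast
  show ?thesis
    by (rule that[of e "coord c \<circ> \<gamma>"]) (use \<gamma> smooth_on_has_vector_derivative[OF \<gamma>(4), of 0] in auto)
qed

lemma inverse_derivative:
  fixes \<psi> :: "'e::euclidean_space \<Rightarrow> 'e"
  assumes \<psi>: "smooth_on U \<psi>" and \<theta>: "smooth_on V \<theta>" and op: "open U" "open V" and hom: "homeomorphism U V \<psi> \<theta>" and x: "x \<in> U"
  shows "frechet_derivative \<theta> (at (\<psi> x)) (frechet_derivative \<psi> (at x) v) = v"
proof -
  have V: "\<psi> x \<in> V" using hom x by (auto simp: homeomorphism_def)
  have "((\<lambda>x. \<theta> (\<psi> x)) has_derivative (\<lambda>v. frechet_derivative \<theta> (at (\<psi> x)) (frechet_derivative \<psi> (at x) v))) (at x)"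
    by (rule has_derivative_compose[OF smooth_on_has_derivative[OF \<psi> x] smooth_on_has_derivative[OF \<theta> V]])
  moreover have "((\<lambda>x. \<theta> (\<psi> x)) has_derivative (\<lambda>v. v)) (at x)"
    by (rule has_derivative_transform_within_open[OF has_derivative_ident op(1) x])
      (use hom in \<open>simp add: homeomorphism_def\<close>)
  ultimately have "(\<lambda>v. frechet_derivative \<theta> (at (\<psi> x)) (frechet_derivative \<psi> (at x) v)) = (\<lambda>v. v)"
    by (rule has_derivative_unique)
  then show ?thesis by metis
qed

text \<open>Velocities of curves in \<open>S\<close> are mapped into \<open>W\<close> by the
  derivative of \<psi>; conversely a line in \<open>W\<close> is carried back by \<theta> to a curve
  in \<open>S\<close>. With \<psi> the identity this covers slices of a chart, and with a general
  \<psi> the preimage of a slice under the immersion.\<close>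

lemma tangent_space_straightened:
  fixes c :: "('a::topological_space, 'e::euclidean_space) chart" and \<psi> \<theta> :: "'e \<Rightarrow> 'e"
  assumes c: "is_chart c" and p: "p \<in> cdom c \<inter> S"
    and \<psi>: "smooth_on U \<psi>" and \<theta>: "smooth_on V \<theta>" and op: "open U" "open V" and hom: "homeomorphism U V \<psi> \<theta>"
    and U: "coord c p \<in> U" "U \<subseteq> coord c ` cdom c" and W: "subspace W"
    and S: "\<And>p'. p' \<in> cdom c \<Longrightarrow> coord c p' \<in> U \<Longrightarrow> p' \<in> S \<longleftrightarrow> \<psi> (coord c p') \<in> W"
  shows "tangent_space c S p = {v. frechet_derivative \<psi> (at (coord c p)) v \<in> W}"
proof (intro subset_antisym subsetI)
  let ?D = "frechet_derivative \<psi> (at (coord c p))"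
  fix v assume "v \<in> tangent_space c S p"
  then obtain \<sigma> e where \<sigma>: "0 < e" "smooth_on {-e<..<e} \<sigma>" "\<sigma> 0 = coord c p"
    "\<And>t. t \<in> {-e<..<e} \<Longrightarrow> \<sigma> t \<in> coord c ` (cdom c \<inter> S)" "(\<sigma> has_vector_derivative v) (at 0)"
    using tangent_spaceE by metis
  define J where "J = {-e<..<e} \<inter> \<sigma> -` U"
  have J: "open J" "0 \<in> J"
    unfolding J_def using \<sigma> U continuous_open_preimage[OF smooth_on_continuous[OF \<sigma>(2)] _ op(1)] by auto
  have "?D v \<in> W"
  proof (rule vector_derivative_in_subspace[where J = J and t = 0 and f = "\<lambda>t. \<psi> (\<sigma> t)"])
    have "(\<psi> has_derivative ?D) (at (\<sigma> 0))" unfolding \<sigma>(3) by (rule smooth_on_has_derivative[OF \<psi> U(1)])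
    from vector_derivative_diff_chain_within[OF has_vector_derivative_at_within[OF \<sigma>(5), of UNIV] has_derivative_at_withinI[OF this]]
    show "((\<lambda>t. \<psi> (\<sigma> t)) has_vector_derivative ?D v) (at 0)" by (simp add: o_def)
    fix t assume t: "t \<in> J"
    then obtain p' where "p' \<in> cdom c" "p' \<in> S" "\<sigma> t = coord c p'" using \<sigma>(4)[of t] by (auto simp: J_def)
    then show "\<psi> (\<sigma> t) \<in> W" using S[of p'] t by (auto simp: J_def)
  qed (use W J in auto)
  then show "v \<in> {v. ?D v \<in> W}" by simp
next
  let ?x = "coord c p"
  fix v assume "v \<in> {v. frechet_derivative \<psi> (at ?x) v \<in> W}"
  then have v: "frechet_derivative \<psi> (at ?x) v \<in> W" by simp
  define w where "w = frechet_derivative \<psi> (at ?x) v"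
  have V: "\<psi> ?x \<in> V" using hom U by (auto simp: homeomorphism_def)
  have px: "\<psi> ?x \<in> W" using S[of p] p U by auto
  have "open ((\<lambda>t::real. \<psi> ?x + t *\<^sub>R w) -` V)"
    by (intro open_vimage op continuous_intros)
  moreover have "0 \<in> (\<lambda>t::real. \<psi> ?x + t *\<^sub>R w) -` V" using V by simp
  ultimately obtain e where e: "0 < e" "{-e<..<e} \<subseteq> (\<lambda>t::real. \<psi> ?x + t *\<^sub>R w) -` V"
    by (rule open_real_symmetric_interval)
  show "v \<in> tangent_space c S p"
  proof (rule tangent_spaceI[OF c, where e = e and \<sigma> = "\<lambda>t. \<theta> (\<psi> ?x + t *\<^sub>R w)"])
    have "smooth_on {-e<..<e} (\<lambda>t::real. \<psi> ?x + t *\<^sub>R w)"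
      by (intro smooth_on_add smooth_on_const smooth_on_linear bounded_linear_scaleR_left) auto
    then show "smooth_on {-e<..<e} (\<lambda>t. \<theta> (\<psi> ?x + t *\<^sub>R w))"
      by (rule smooth_on_compose[OF _ \<theta> _ op(2)]) (use e in auto)
    show "\<theta> (\<psi> ?x + 0 *\<^sub>R w) = ?x" using hom U by (simp add: homeomorphism_def)
    fix t assume "t \<in> {-e<..<e}"
    then have tV: "\<psi> ?x + t *\<^sub>R w \<in> V" using e by auto
    then have tU: "\<theta> (\<psi> ?x + t *\<^sub>R w) \<in> U" and \<psi>\<theta>: "\<psi> (\<theta> (\<psi> ?x + t *\<^sub>R w)) = \<psi> ?x + t *\<^sub>R w"
      using hom by (auto simp: homeomorphism_def)
    then obtain p' where p': "p' \<in> cdom c" "\<theta> (\<psi> ?x + t *\<^sub>R w) = coord c p'" using U by auto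
    have "\<psi> ?x + t *\<^sub>R w \<in> W" using W px v by (simp add: w_def subspace_add subspace_scale)
    then have "p' \<in> S" using S[OF p'(1)] tU \<psi>\<theta> p'(2) by simp
    with p' show "\<theta> (\<psi> ?x + t *\<^sub>R w) \<in> coord c ` (cdom c \<inter> S)" by auto
  next
    have "(\<theta> has_derivative frechet_derivative \<theta> (at (\<psi> ?x))) (at (\<psi> ?x + 0 *\<^sub>R w))"
      using smooth_on_has_derivative[OF \<theta> V] by simp
    from has_vector_derivative_along_line[OF this]
    show "((\<lambda>t. \<theta> (\<psi> ?x + t *\<^sub>R w)) has_vector_derivative v) (at 0)"
      using inverse_derivative[OF \<psi> \<theta> op hom U(1), of v] by (simp add: w_def)
  qed (use p e in auto)
qed

lemma tangent_space_slice:
  assumes c: "is_chart c" and p: "p \<in> cdom c" and W: "subspace W" "coord c p \<in> W"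
    and S: "\<And>p'. p' \<in> cdom c \<Longrightarrow> p' \<in> S \<longleftrightarrow> coord c p' \<in> W"
  shows "tangent_space c S p = W"
proof -
  let ?U = "coord c ` cdom c"
  have "tangent_space c S p = {v. frechet_derivative (\<lambda>x. x) (at (coord c p)) v \<in> W}"
    by (rule tangent_space_straightened[OF c, where U = ?U and V = ?U and \<theta> = "\<lambda>x. x"])
      (use chart_inverse(7)[OF c] p W S in \<open>auto intro!: smooth_on_linear bounded_linear_ident simp: homeomorphism_def\<close>)
  then show ?thesis by simp
qed

lemma tangent_space_UNIV:
  assumes "is_chart c" "p \<in> cdom c"
  shows "tangent_space c UNIV p = UNIV"
  by (rule tangent_space_slice[OF assms]) auto

section \<open>Atlases, chart changes and the metric in charts\<close>

lemma smooth_structureD: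
  assumes "smooth_structure A"
  shows "c \<in> A \<Longrightarrow> is_chart c"
    "c \<in> A \<Longrightarrow> d \<in> A \<Longrightarrow> smooth_on (coord c ` (cdom c \<inter> cdom d)) (transition c d)"
    "\<exists>c\<in>A. p \<in> cdom c"
proof -
  show "c \<in> A \<Longrightarrow> is_chart c" using assms unfolding smooth_structure_def by blast
  show "c \<in> A \<Longrightarrow> d \<in> A \<Longrightarrow> smooth_on (coord c ` (cdom c \<inter> cdom d)) (transition c d)"
    using assms unfolding smooth_structure_def compatible_def by blast
  have "p \<in> (\<Union>c\<in>A. cdom c)" using assms unfolding smooth_structure_def by blast
  then show "\<exists>c\<in>A. p \<in> cdom c" by (simp only: UN_iff)
qed

lemma transition_coord:
  assumes "is_chart c" "p \<in> cdom c"
  shows "transition c d (coord c p) = coord d p"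
  using chart_inverse(1)[OF assms] by (simp add: transition_def)

lemma chart_overlap_open:
  assumes "is_chart c" "is_chart d"
  shows "open (coord c ` (cdom c \<inter> cdom d))"
  using chart_image_open[OF assms(1) chart_inverse(6)[OF assms(2)]] .

text \<open>Rests on maximality of the atlas: a chart followed by a diffeomorphism is compatible
  with every member of \<open>A\<close>, since both transition maps factor through those of
  \<open>c\<close>, and so belongs to \<open>A\<close>. This is how normal coordinates become an
  admissible chart.\<close>

lemma chart_change:
  fixes A :: "('a::{t2_space, second_countable_topology}, 'e::euclidean_space) chart set"
  assumes A: "smooth_structure A" and c: "c \<in> A" and V: "open V" "V \<subseteq> coord c ` cdom c" and O: "open O'"
    and hom: "homeomorphism V O' \<theta> E" and \<theta>: "smooth_on V \<theta>" and E: "smooth_on O' E"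
  defines "c' \<equiv> (inv_coord c ` V, \<theta> \<circ> coord c)"
  shows "c' \<in> A" "coord c' ` cdom c' = O'" "\<And>x. x \<in> O' \<Longrightarrow> inv_coord c' x = inv_coord c (E x)"
    "\<And>p. p \<in> cdom c' \<longleftrightarrow> p \<in> cdom c \<and> coord c p \<in> V" "coord c' p = \<theta> (coord c p)"
proof -
  note chA = smooth_structureD(1)[OF A] and smA = smooth_structureD(2)[OF A]
  note ch = chA[OF c]
  note ci = chart_inverse[OF ch]
  have h: "\<And>x. x \<in> V \<Longrightarrow> E (\<theta> x) = x" "\<And>x. x \<in> O' \<Longrightarrow> \<theta> (E x) = x" "\<theta> ` V = O'" "E ` O' = V"
    "continuous_on V \<theta>" "continuous_on O' E"
    using hom by (auto simp: homeomorphism_def)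
  show dom: "p \<in> cdom c' \<longleftrightarrow> p \<in> cdom c \<and> coord c p \<in> V" for p
  proof
    assume "p \<in> cdom c'"
    then obtain x where "x \<in> V" "p = inv_coord c x" by (auto simp: c'_def)
    then show "p \<in> cdom c \<and> coord c p \<in> V" using ci V by auto
  next
    assume "p \<in> cdom c \<and> coord c p \<in> V"
    then have "p = inv_coord c (coord c p)" "coord c p \<in> V" using ci by auto
    then show "p \<in> cdom c'" unfolding c'_def by (auto simp: image_iff)
  qed
  show co: "coord c' p = \<theta> (coord c p)" for p by (simp add: c'_def)
  have "coord c ` cdom c' = V" using dom V by auto
  then show im: "coord c' ` cdom c' = O'" using h(3) co by (metis (no_types, lifting) image_cong image_image)
  have Ein: "inv_coord c (E x) \<in> cdom c'" "coord c' (inv_coord c (E x)) = x" if "x \<in> O'" for x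
    using that h V ci dom co by auto
  have inj: "inj_on (coord c') (cdom c')"
  proof (rule inj_onI)
    fix p p' assume *: "p \<in> cdom c'" "p' \<in> cdom c'" "coord c' p = coord c' p'"
    then have "coord c p = coord c p'" using co dom h(1) by metis
    then show "p = p'" using * dom ci(1) by metis
  qed
  show inv: "inv_coord c' x = inv_coord c (E x)" if "x \<in> O'" for x
    using inv_into_f_f[OF inj Ein(1)[OF that]] Ein(2)[OF that] by (simp add: inv_coord_def)
  have open_dom: "open (cdom c')"
  proof -
    have "cdom c' = cdom c \<inter> coord c -` V" using dom by auto
    then show ?thesis using continuous_open_preimage[OF ci(4,6) V(1)] by simp
  qed
  have ch': "is_chart c'"
    unfolding is_chart_def im
  proof (intro conjI open_dom O homeomorphismI)
    show "continuous_on (cdom c') (coord c')"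
    proof -
      have "continuous_on (cdom c') (\<lambda>p. \<theta> (coord c p))"
        by (rule continuous_on_compose2[OF h(5) continuous_on_subset[OF ci(4)]]) (use dom in auto)
      moreover have "coord c' = (\<lambda>p. \<theta> (coord c p))" by (rule ext) (rule co)
      ultimately show ?thesis by (simp only:)
    qed
    have "continuous_on O' (\<lambda>x. inv_coord c (E x))"
      by (rule continuous_on_compose2[OF ci(5) h(6)]) (use h V in auto)
    then show "continuous_on O' (inv_coord c')" using inv by (simp cong: continuous_on_cong)
    show "inv_coord c' ` O' \<subseteq> cdom c'" using inv Ein by auto
    show "coord c' (inv_coord c' y) = y" if "y \<in> O'" for y using inv Ein that by simp
    show "inv_coord c' (coord c' x) = x" if "x \<in> cdom c'" for x
      using inj that by (simp add: inv_coord_def)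
    show "coord c' ` cdom c' \<subseteq> O'" using im by simp
  qed
  have "compatible c' d" if d: "d \<in> A" for d
    unfolding compatible_def
  proof
    let ?V = "coord c ` (cdom c \<inter> cdom d)"
    let ?X = "coord c' ` (cdom c' \<inter> cdom d)" and ?Y = "coord d ` (cdom c' \<inter> cdom d)"
    have opX: "open ?X" by (rule chart_overlap_open[OF ch' chA[OF d]])
    have opY: "open ?Y" using chart_overlap_open[OF chA[OF d] ch'] by (simp add: Int_commute)
    have X: "?X \<subseteq> O'" using im by auto
    have EX: "E ` ?X \<subseteq> ?V" using dom co h by auto
    have "smooth_on ?X (\<lambda>x. transition c d (E x))"
      by (rule smooth_on_compose[OF smooth_on_subset[OF E X] smA[OF c d] opX _ EX])
        (rule chart_overlap_open[OF ch chA[OF d]])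
    then show "smooth_on ?X (transition c' d)"
      by (rule smooth_on_congI[OF _ opX]) (use X inv in \<open>auto simp: transition_def\<close>)
    have Y: "?Y \<subseteq> coord d ` (cdom d \<inter> cdom c)" using dom by auto
    have TY: "transition d c ` ?Y \<subseteq> V"
      using dom chart_inverse(1)[OF chA[OF d]] by (auto simp: transition_def)
    have "smooth_on ?Y (\<lambda>x. \<theta> (transition d c x))"
      by (rule smooth_on_compose[OF smooth_on_subset[OF smA[OF d c] Y] \<theta> opY V(1) TY])
    then show "smooth_on ?Y (transition d c')" by (simp add: transition_def c'_def o_def)
  qed
  with ch' A show "c' \<in> A" unfolding smooth_structure_def by blast
qed

lemma smooth_metric_subset: "smooth_metric V G \<Longrightarrow> open U \<Longrightarrow> U \<subseteq> V \<Longrightarrow> smooth_metric U G"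
  unfolding smooth_metric_def by (meson smooth_on_subset subsetD)

lemma riemannian_manifoldD:
  assumes "riemannian_manifold A g"
  shows "smooth_structure A" "c \<in> A \<Longrightarrow> smooth_metric (coord c ` cdom c) (g c)"
    "c \<in> A \<Longrightarrow> d \<in> A \<Longrightarrow> x \<in> coord c ` (cdom c \<inter> cdom d) \<Longrightarrow> g c x u v = g d (transition c d x)
          (frechet_derivative (transition c d) (at x) u) (frechet_derivative (transition c d) (at x) v)"
proof -
  show A: "smooth_structure A" using assms by (simp add: riemannian_manifold_def)
  have R: "riemannian_metric A g" using assms by (simp add: riemannian_manifold_def)
  show "c \<in> A \<Longrightarrow> smooth_metric (coord c ` cdom c) (g c)"
    using R chart_inverse(7)[OF smooth_structureD(1)[OF A]] by (simp add: riemannian_metric_def smooth_metric_def)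
  show "c \<in> A \<Longrightarrow> d \<in> A \<Longrightarrow> x \<in> coord c ` (cdom c \<inter> cdom d) \<Longrightarrow> g c x u v = g d (transition c d x)
          (frechet_derivative (transition c d) (at x) u) (frechet_derivative (transition c d) (at x) v)"
    using R unfolding riemannian_metric_def by blast
qed

lemma levi_civita_chart_change:
  assumes M: "riemannian_manifold A g" and c: "c \<in> A" and d: "d \<in> A" and x: "x \<in> coord c ` (cdom c \<inter> cdom d)"
  shows "frechet_derivative (transition c d) (at x) (levi_civita (g c) x u v) =
    levi_civita (g d) (transition c d x) (frechet_derivative (transition c d) (at x) u) (frechet_derivative (transition c d) (at x) v) +
    frechet_derivative (\<lambda>z. frechet_derivative (transition c d) (at z) v) (at x) u"
proof -
  note A = riemannian_manifoldD(1)[OF M]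
  have op: "open (coord c ` (cdom c \<inter> cdom d))"
    by (rule chart_overlap_open) (use smooth_structureD(1)[OF A] c d in auto)
  show ?thesis
  proof (rule levi_civita_transform[OF smooth_metric_subset[OF riemannian_manifoldD(2)[OF M c] op]
        riemannian_manifoldD(2)[OF M d] smooth_structureD(2)[OF A c d]])
    show "transition c d ` coord c ` (cdom c \<inter> cdom d) \<subseteq> coord d ` cdom d"
      using transition_coord[OF smooth_structureD(1)[OF A c], of _ d] by auto
  qed (use x riemannian_manifoldD(3)[OF M c d] in auto)
qed

lemma transition_derivative_inverse:
  assumes A: "smooth_structure A" and c: "c \<in> A" and d: "d \<in> A" and p: "p \<in> cdom c" "p \<in> cdom d"
  shows "frechet_derivative (transition d c) (at (coord d p)) (frechet_derivative (transition c d) (at (coord c p)) v) = v"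
proof -
  note ch = smooth_structureD(1)[OF A c] and dh = smooth_structureD(1)[OF A d]
  let ?U = "coord c ` (cdom c \<inter> cdom d)" and ?V = "coord d ` (cdom d \<inter> cdom c)"
  have "homeomorphism ?U ?V (transition c d) (transition d c)"
    by (rule homeomorphismI)
      (use smooth_on_continuous[OF smooth_structureD(2)[OF A c d]] smooth_on_continuous[OF smooth_structureD(2)[OF A d c]]
        transition_coord[OF ch, of _ d] transition_coord[OF dh, of _ c] in auto)
  from inverse_derivative[OF smooth_structureD(2)[OF A c d] smooth_structureD(2)[OF A d c]
      chart_overlap_open[OF ch dh] chart_overlap_open[OF dh ch] this, of "coord c p" v]
  show ?thesis using p transition_coord[OF ch p(1)] by auto
qed

section \<open>Normal charts and totally geodesic slices\<close>

lemma cov_deriv_curve: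
  assumes J: "open J" "t \<in> J" and \<sigma>: "\<And>s. s \<in> J \<Longrightarrow> (\<sigma> has_vector_derivative \<sigma>' s) (at s)"
    and a: "(\<sigma>' has_vector_derivative a) (at t)"
  shows "cov_deriv G \<sigma> (\<lambda>\<tau>. vector_derivative \<sigma> (at \<tau>)) t 1 = a + levi_civita G (\<sigma> t) (\<sigma>' t) (\<sigma>' t)"
proof -
  have v: "vector_derivative \<sigma> (at s) = \<sigma>' s" if "s \<in> J" for s
    using \<sigma>[OF that] by (rule vector_derivative_at)
  have "((\<lambda>\<tau>. vector_derivative \<sigma> (at \<tau>)) has_vector_derivative a) (at t)"
    by (rule has_vector_derivative_transform_within_open[OF a J]) (simp add: v)
  then have 1: "frechet_derivative (\<lambda>\<tau>. vector_derivative \<sigma> (at \<tau>)) (at t) = (\<lambda>h. h *\<^sub>R a)"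
    by (metis frechet_derivative_at has_vector_derivative_def)
  have 2: "frechet_derivative \<sigma> (at t) = (\<lambda>h. h *\<^sub>R \<sigma>' t)"
    using \<sigma>[OF J(2)] by (metis frechet_derivative_at has_vector_derivative_def)
  show ?thesis unfolding cov_deriv_def 1 2 v[OF J(2)] by simp
qed

text \<open>The coordinate map is a local inverse of the exponential map, so radial lines are
  geodesics and the Christoffel symbols at a point of such a line vanish on its direction. Both
  \<open>y\<close> and its multiple are required to lie in the image of the chart, because the
  domain provided by the inverse function theorem need not be star-shaped.\<close>

lemma normal_chart:
  fixes A :: "('a::{t2_space, second_countable_topology}, 'e::euclidean_space) chart set"
  assumes M: "riemannian_manifold A g" and c: "c \<in> A" and p: "p \<in> cdom c"
  obtains c' where "c' \<in> A" "p \<in> cdom c'" "coord c' p = 0"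
    "\<And>y l. y \<in> coord c' ` cdom c' \<Longrightarrow> \<bar>l\<bar> \<le> 1 \<Longrightarrow> l *\<^sub>R y \<in> coord c' ` cdom c' \<Longrightarrow>
      levi_civita (g c') (l *\<^sub>R y) y y = 0"
proof -
  note A = riemannian_manifoldD(1)[OF M] and G = riemannian_manifoldD(2)[OF M c]
  note ch = smooth_structureD(1)[OF A c]
  let ?V0 = "coord c ` cdom c" and ?\<Gamma> = "levi_civita (g c)"
  obtain r E where r: "0 < r" and E: "smooth_on (ball 0 r) E" "E ` ball 0 r \<subseteq> ?V0" "E 0 = coord c p"
    and DE0: "\<And>w. frechet_derivative E (at 0) w = w"
    and geo: "\<And>y l. y \<in> ball 0 r \<Longrightarrow> \<bar>l\<bar> \<le> 1 \<Longrightarrow>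
      ((\<lambda>s. frechet_derivative E (at (s *\<^sub>R y)) y) has_vector_derivative
        - ?\<Gamma> (E (l *\<^sub>R y)) (frechet_derivative E (at (l *\<^sub>R y)) y) (frechet_derivative E (at (l *\<^sub>R y)) y)) (at l)"
    using smooth_exponential[OF chart_inverse(7)[OF ch], of "coord c p" ?\<Gamma>]
      levi_civita_props(1,4)[OF G] p by blast
  have "frechet_derivative E (at 0) = (\<lambda>w. w)" using DE0 by blast
  then have inj: "inj (frechet_derivative E (at 0))" by (simp add: inj_on_def)
  obtain U V \<theta> where U: "open U" "U \<subseteq> ball 0 r" "0 \<in> U" and V: "open V" and hom: "homeomorphism U V E \<theta>"
    and \<theta>: "smooth_on V \<theta>"
    using smooth_inverse_function[OF open_ball E(1) _ inj] r by (metis centre_in_ball)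
  note EU = smooth_on_subset[OF E(1) U(2)]
  have EV: "E ` U = V" "\<And>x. x \<in> U \<Longrightarrow> \<theta> (E x) = x" using hom by (auto simp: homeomorphism_def)
  have V0: "V \<subseteq> ?V0" using EV U(2) E(2) by blast
  have hom': "homeomorphism V U \<theta> E" using hom by (rule homeomorphism_symD)
  define c' where "c' = (inv_coord c ` V, \<theta> \<circ> coord c)"
  note cc = chart_change[OF A c V V0 U(1) hom' \<theta> EU, folded c'_def]
  note ch' = smooth_structureD(1)[OF A cc(1)]
  have xV: "coord c p \<in> V" using EV(1) U(3) E(3) by force
  have pc': "p \<in> cdom c'" using cc(4) p xV by blast
  have p0: "coord c' p = 0" using cc(5)[of p] EV(2)[OF U(3)] E(3) by simp
  have trE: "transition c' c x = E x" if "x \<in> U" for x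
  proof -
    have "E x \<in> ?V0" using that EV(1) V0 by blast
    then show ?thesis using cc(3)[OF that] chart_inverse(2)[OF ch] by (simp add: transition_def)
  qed
  have DtrE: "frechet_derivative (transition c' c) (at x) = frechet_derivative E (at x)" if "x \<in> U" for x
    by (rule frechet_derivative_transform_within_open[symmetric, OF _ U(1) that])
      (use trE differentiableI[OF smooth_on_has_derivative[OF EU that]] in auto)
  have "levi_civita (g c') (l *\<^sub>R y) y y = 0" if y: "y \<in> U" and l: "\<bar>l\<bar> \<le> 1" and ly: "l *\<^sub>R y \<in> U" for y l
  proof -
    let ?x = "l *\<^sub>R y" and ?L = "levi_civita (g c') (l *\<^sub>R y) y y"
    let ?D2 = "frechet_derivative (\<lambda>z. frechet_derivative E (at z) y) (at ?x) y"
    have "?x \<in> coord c' ` cdom c'" using ly cc(2) by simp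
    then have x: "?x \<in> coord c' ` (cdom c' \<inter> cdom c)" using cc(4) by blast
    have d: "((\<lambda>z. frechet_derivative E (at z) y) has_derivative
        frechet_derivative (\<lambda>z. frechet_derivative E (at z) y) (at ?x)) (at ?x)"
      by (rule smooth_on_has_derivative[OF smooth_on_frechet_derivative[OF EU] ly])
    then have "((\<lambda>z. frechet_derivative E (at z) y) has_derivative
        frechet_derivative (\<lambda>z. frechet_derivative E (at z) y) (at ?x)) (at (0 + l *\<^sub>R y))" by simp
    from has_vector_derivative_along_line[OF this]
    have "((\<lambda>s. frechet_derivative E (at (s *\<^sub>R y)) y) has_vector_derivative ?D2) (at l)" by simp
    moreover have "y \<in> ball 0 r" using y U(2) by blast
    \<comment> \<open>Two evaluations of the same acceleration of the radial curve: as a second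
      derivative of \<open>E\<close>, and by the geodesic equation. In the transformation law under
      \<open>E\<close> the two terms on the right then cancel.\<close>
    ultimately have D2: "?D2 = - ?\<Gamma> (E ?x) (frechet_derivative E (at ?x) y) (frechet_derivative E (at ?x) y)"
      using vector_derivative_unique_at geo[OF _ l] by blast
    have "frechet_derivative (\<lambda>z. frechet_derivative E (at z) y) (at ?x) =
        frechet_derivative (\<lambda>z. frechet_derivative (transition c' c) (at z) y) (at ?x)"
      by (rule frechet_derivative_transform_within_open[OF differentiableI[OF d] U(1) ly]) (simp add: DtrE)
    then have "frechet_derivative E (at ?x) ?L = 0"
      using levi_civita_chart_change[OF M cc(1) c x, of y y] D2 by (simp add: DtrE[OF ly] trE[OF ly])
    moreover have "linear (frechet_derivative \<theta> (at (E ?x)))"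
      using EV(1) ly by (intro has_derivative_linear[OF smooth_on_has_derivative[OF \<theta>]]) blast
    ultimately show ?thesis
      using inverse_derivative[OF EU \<theta> U(1) V hom ly, of ?L] by (simp add: linear_0)
  qed
  then show ?thesis using that[OF cc(1) pc' p0] by (simp add: cc(2))
qed

text \<open>The minimum of the quadratic form over \<open>K\<close> times the unit sphere is
  positive. Together with \<open>smooth_metric_bounded\<close> this compares metric and norm with
  constants uniform in the base point, as the estimate of accelerations requires.\<close>

lemma smooth_metric_coercive:
  fixes G :: "'e::euclidean_space \<Rightarrow> 'e \<Rightarrow> 'e \<Rightarrow> real"
  assumes G: "smooth_metric V G" and K: "compact K" "K \<subseteq> V"
  obtains a where "0 < a" "\<And>x u. x \<in> K \<Longrightarrow> a * (norm u)\<^sup>2 \<le> G x u u"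
proof (cases "K = {}")
  case True
  then show ?thesis using that[of 1] by simp
next
  case False
  let ?S = "K \<times> sphere 0 (1::real) :: ('e \<times> 'e) set"
  have "continuous_on ?S (\<lambda>z. flat G (fst z))"
    by (rule continuous_on_compose2[OF Ck_on_continuous[OF flat_smooth[OF G]]]) (use K in \<open>auto intro!: continuous_intros\<close>)
  then have "continuous_on ?S (\<lambda>z. flat G (fst z) (snd z) \<bullet> snd z)" by (intro continuous_intros)
  moreover have "compact ?S" using K by (intro compact_Times) auto
  moreover have "?S \<noteq> {}" using False by (auto simp: sphere_eq_empty)
  ultimately obtain z where z: "z \<in> ?S"
    "\<And>z'. z' \<in> ?S \<Longrightarrow> flat G (fst z) (snd z) \<bullet> snd z \<le> flat G (fst z') (snd z') \<bullet> snd z'"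
    using continuous_attains_inf[of ?S "\<lambda>z. flat G (fst z) (snd z) \<bullet> snd z"] by blast
  define a where "a = G (fst z) (snd z) (snd z)"
  have zV: "fst z \<in> V" "snd z \<noteq> 0" using z(1) K by auto
  have "0 < a" unfolding a_def by (rule inner_formD(3)[OF smooth_metricD(2)[OF G zV(1)] zV(2)])
  moreover have "a * (norm u)\<^sup>2 \<le> G x u u" if x: "x \<in> K" for x u
  proof (cases "u = 0")
    case True
    then show ?thesis using bilinear_lzero[OF smooth_metricD(4)[OF G]] x K by auto
  next
    case False
    let ?v = "(1 / norm u) *\<^sub>R u"
    have b: "bilinear (G x)" using smooth_metricD(4)[OF G] x K by blast
    have "(x, ?v) \<in> ?S" using x False by simp
    have xV: "x \<in> V" using x K by blast
    from z(2)[OF \<open>(x, ?v) \<in> ?S\<close>] have "a \<le> G x ?v ?v"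
      unfolding fst_conv snd_conv flat_apply(2)[OF G zV(1)] flat_apply(2)[OF G xV] a_def .
    also have "\<dots> = G x u u / (norm u)\<^sup>2"
      by (simp add: bilinear_lmul[OF b] bilinear_rmul[OF b] power2_eq_square)
    finally show ?thesis using False by (simp add: pos_le_divide_eq)
  qed
  ultimately show ?thesis by (rule that)
qed

lemma smooth_metric_bounded:
  assumes G: "smooth_metric V G" and K: "compact K" "K \<subseteq> V"
  obtains b where "0 < b" "\<And>x u v. x \<in> K \<Longrightarrow> \<bar>G x u v\<bar> \<le> b * norm u * norm v"
proof -
  obtain b where b: "0 < b" "\<And>x. x \<in> K \<Longrightarrow> norm (flat G x) \<le> b"
    using bounded_continuous_image[OF Ck_on_continuous[OF flat_smooth[OF G]] K] by metis
  have "\<bar>G x u v\<bar> \<le> b * norm u * norm v" if x: "x \<in> K" for x u v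
  proof -
    have "\<bar>G x u v\<bar> = \<bar>flat G x u \<bullet> v\<bar>" using flat_apply(2)[OF G] x K by auto
    also have "\<dots> \<le> norm (flat G x u) * norm v" by (rule Cauchy_Schwarz_ineq2)
    also have "\<dots> \<le> (norm (flat G x) * norm u) * norm v" by (intro mult_right_mono norm_blinfun) simp
    also have "\<dots> \<le> b * norm u * norm v" using b(2)[OF x] by (intro mult_right_mono) auto
    finally show ?thesis .
  qed
  with b(1) show ?thesis by (rule that)
qed

text \<open>In a normal chart the straight lines through the origin are geodesics. A geodesic of a linear slice
  satisfies a differential inequality that forces it to coincide with the line having the same
  initial velocity; no smoothness of the projection onto the slice is needed because the line
  makes the Christoffel term vanish.\<close>

lemma slice_geodesic_is_line:
  fixes G :: "'e::euclidean_space \<Rightarrow> 'e \<Rightarrow> 'e \<Rightarrow> real"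
  assumes G: "smooth_metric V G" and V0: "0 \<in> V"
    and normal: "\<And>y l. y \<in> V \<Longrightarrow> \<bar>l\<bar> \<le> 1 \<Longrightarrow> l *\<^sub>R y \<in> V \<Longrightarrow> levi_civita G (l *\<^sub>R y) y y = 0"
    and W: "subspace W" and I: "open I" "0 \<in> I"
    and \<sigma>: "smooth_on I \<sigma>" "\<And>t. t \<in> I \<Longrightarrow> \<sigma> t \<in> V \<inter> W" "\<sigma> 0 = 0"
    and geo: "\<And>t. t \<in> I \<Longrightarrow>
      tangential (G (\<sigma> t)) W (cov_deriv G \<sigma> (\<lambda>\<tau>. vector_derivative \<sigma> (at \<tau>)) t 1) = 0"
  obtains e w where "0 < e" "{-e<..<e} \<subseteq> I"
    "\<And>t. t \<in> {-e<..<e} \<Longrightarrow> \<sigma> t = t *\<^sub>R w \<and> levi_civita G (t *\<^sub>R w) w w = 0"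
proof -
  note opV = smooth_metricD(1)[OF G]
  define \<sigma>' where "\<sigma>' t = vector_derivative \<sigma> (at t)" for t
  define \<sigma>'' where "\<sigma>'' t = vector_derivative \<sigma>' (at t)" for t
  have sm': "smooth_on I \<sigma>'" unfolding \<sigma>'_def[abs_def] by (rule smooth_on_vector_derivative[OF \<sigma>(1) I(1)])
  have d1: "(\<sigma> has_vector_derivative \<sigma>' t) (at t)" if "t \<in> I" for t
    unfolding \<sigma>'_def by (rule smooth_on_has_vector_derivative[OF \<sigma>(1) that])
  have d2: "(\<sigma>' has_vector_derivative \<sigma>'' t) (at t)" if "t \<in> I" for t
    unfolding \<sigma>''_def by (rule smooth_on_has_vector_derivative[OF sm' that])
  have W1: "\<sigma>' t \<in> W" if "t \<in> I" for t
    by (rule vector_derivative_in_subspace[OF W d1[OF that] I(1) that]) (use \<sigma>(2) in auto)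
  have W2: "\<sigma>'' t \<in> W" if "t \<in> I" for t
    by (rule vector_derivative_in_subspace[OF W d2[OF that] I(1) that]) (rule W1)
  \<comment> \<open>The Christoffel term as a function of position and velocity jointly. Being
    smooth, it is Lipschitz near the initial state, so its value on the geodesic is controlled by
    the distance to the line, where it vanishes.\<close>
  define N where "N z = levi_civita G (fst z) (snd z) (snd z)" for z :: "'e \<times> 'e"
  have opVU: "open (V \<times> (UNIV :: 'e set))" using opV by (intro open_Times) auto
  have N: "smooth_on (V \<times> UNIV) N"
    unfolding N_def[abs_def]
    by (rule smooth_on_bilinear_family[OF levi_civita_props(1,4)[OF G]])
      (use opV opVU in \<open>auto intro!: smooth_on_linear bounded_linear_fst bounded_linear_snd\<close>)
  define w where "w = \<sigma>' 0"
  obtain \<rho> where \<rho>: "0 < \<rho>" "cball 0 \<rho> \<subseteq> V" using opV V0 open_contains_cball by blast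
  let ?K = "cball (0::'e) \<rho>" and ?K2 = "cball w 1"
  obtain C where C: "0 \<le> C" "\<And>z z'. z \<in> ?K \<times> ?K2 \<Longrightarrow> z' \<in> ?K \<times> ?K2 \<Longrightarrow> norm (N z - N z') \<le> C * norm (z - z')"
  proof (rule Ck_on_Lipschitz[OF smooth_onD[OF N] opVU])
    show "compact (?K \<times> ?K2)" by (intro compact_Times) auto
    show "convex (?K \<times> ?K2)" by (intro convex_Times) auto
    show "?K \<times> ?K2 \<subseteq> V \<times> UNIV" using \<rho> by auto
  qed blast
  obtain a where a: "0 < a" "\<And>x u. x \<in> ?K \<Longrightarrow> a * (norm u)\<^sup>2 \<le> G x u u"
    using smooth_metric_coercive[OF G compact_cball \<rho>(2)] by metis
  obtain b where b: "0 < b" "\<And>x u v. x \<in> ?K \<Longrightarrow> \<bar>G x u v\<bar> \<le> b * norm u * norm v"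
    using smooth_metric_bounded[OF G compact_cball \<rho>(2)] by metis
  \<comment> \<open>The summand 1 bounds the derivative \<open>\<sigma>' - w\<close> of the position
    component of \<open>u\<close>. The other one bounds the acceleration, with \<open>C\<close> from
    the Lipschitz estimate and \<open>b / a\<close> from the comparison of metric and norm.\<close>
  define L where "L = 1 + b / a * C"
  have L: "1 \<le> L" using a b C by (simp add: L_def)
  define J where "J = (I \<inter> \<sigma> -` ball 0 \<rho>) \<inter> (I \<inter> \<sigma>' -` ball w 1)"
  have "open J"
    unfolding J_def by (intro open_Int continuous_open_preimage smooth_on_continuous[OF \<sigma>(1)] smooth_on_continuous[OF sm'] I(1) open_ball)
  moreover have "0 \<in> J" using I(2) \<sigma>(3) \<rho> by (simp add: J_def w_def)
  ultimately obtain e0 where e0: "0 < e0" "{-e0<..<e0} \<subseteq> J" by (rule open_real_symmetric_interval)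
  \<comment> \<open>Keeps the closed interval inside \<open>J\<close>, makes
    \<open>L * e \<le> 1 / 2\<close> for \<open>gronwall_small\<close>, and keeps the line in the
    ball of radius \<rho>.\<close>
  define e where "e = min (e0 / 2) (min (1 / (2 * L)) (\<rho> / (norm w + 1)))"
  have nw: "0 < norm w + 1" using norm_ge_zero[of w] by linarith
  have e: "0 < e" "e < e0" "e \<le> 1 / (2 * L)" "e \<le> \<rho> / (norm w + 1)"
    using e0 L \<rho> nw by (auto simp: e_def)
  have Le: "L * e \<le> 1 / 2" using mult_left_mono[OF e(3), of L] L by simp
  have ew: "e * norm w \<le> \<rho>"
  proof -
    have "e * (norm w + 1) \<le> \<rho>" using e(4) nw by (simp add: pos_le_divide_eq)
    then show ?thesis using e(1) by (simp add: algebra_simps)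
  qed
  have mem: "t \<in> I" "\<sigma> t \<in> ?K" "\<sigma>' t \<in> ?K2" "t *\<^sub>R w \<in> ?K" if t: "t \<in> {-e..e}" for t
  proof -
    have "t \<in> {-e0<..<e0}" using t e by auto
    then show "t \<in> I" "\<sigma> t \<in> ?K" "\<sigma>' t \<in> ?K2" using e0(2) by (auto simp: J_def)
    have "\<bar>t\<bar> * norm w \<le> e * norm w" using t by (intro mult_right_mono) auto
    then show "t *\<^sub>R w \<in> ?K" using ew by simp
  qed
  \<comment> \<open>The velocity \<open>w\<close> itself need not lie in \<open>V\<close>, so the
    normality condition is used for \<open>y = e w\<close> and \<open>l = t / e\<close>, and the
    factor \<open>e\<close> is removed by bilinearity.\<close>
  have line0: "levi_civita G (t *\<^sub>R w) w w = 0" if t: "t \<in> {-e..e}" for t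
  proof -
    have V: "t *\<^sub>R w \<in> V" using mem(4)[OF t] \<rho> by blast
    have "e *\<^sub>R w \<in> V" using mem(4)[of e] e \<rho> by auto
    moreover have "\<bar>t / e\<bar> \<le> 1" using t e by (auto simp: abs_le_iff divide_simps)
    ultimately have "levi_civita G ((t / e) *\<^sub>R (e *\<^sub>R w)) (e *\<^sub>R w) (e *\<^sub>R w) = 0"
      using V e by (intro normal) auto
    then show ?thesis
      using e by (simp add: bilinear_lmul[OF levi_civita_props(1)[OF G V]] bilinear_rmul[OF levi_civita_props(1)[OF G V]])
  qed
  define u where "u t = (\<sigma> t - t *\<^sub>R w, \<sigma>' t - w)" for t
  have "u t = 0" if t: "t \<in> {-e..e}" for t
  proof -
    have "norm (u t) \<le> 2 * norm (u 0) + 2 * e * 0"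
    proof (rule gronwall_small[where u' = "\<lambda>t. (\<sigma>' t - w, \<sigma>'' t)" and L = L, OF _ _ _ Le _ t])
      fix t assume t: "t \<in> {-e..e}"
      have "((\<lambda>t. t *\<^sub>R w) has_vector_derivative w) (at t)" by (auto intro!: derivative_eq_intros)
      from has_vector_derivative_Pair[OF has_vector_derivative_diff[OF d1[OF mem(1)[OF t]] this]
          has_vector_derivative_diff[OF d2[OF mem(1)[OF t]] has_vector_derivative_const[of w]]]
      have "(u has_vector_derivative (\<sigma>' t - w, \<sigma>'' t)) (at t)" unfolding u_def[abs_def] by simp
      then show "(u has_vector_derivative (\<sigma>' t - w, \<sigma>'' t)) (at t within {-e..e})"
        by (rule has_vector_derivative_at_within)
      let ?x = "\<sigma> t" and ?n = "N (\<sigma> t, \<sigma>' t) - N (t *\<^sub>R w, w)"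
      have xV: "?x \<in> V" using mem(2)[OF t] \<rho> by blast
      note Q = smooth_metricD(2)[OF G xV]
      have N0: "N (t *\<^sub>R w, w) = 0" using line0[OF t] by (simp add: N_def)
      have "cov_deriv G \<sigma> (\<lambda>\<tau>. vector_derivative \<sigma> (at \<tau>)) t 1 = \<sigma>'' t + levi_civita G ?x (\<sigma>' t) (\<sigma>' t)"
        by (rule cov_deriv_curve[OF I(1) mem(1)[OF t] d1 d2[OF mem(1)[OF t]]])
      then have "cov_deriv G \<sigma> (\<lambda>\<tau>. vector_derivative \<sigma> (at \<tau>)) t 1 = \<sigma>'' t + ?n" using N0 by (simp add: N_def)
      \<comment> \<open>The geodesic equation of the slice says that \<open>\<sigma>'' + ?n\<close>
        is orthogonal to \<open>W\<close>, while \<open>\<sigma>''\<close> lies in \<open>W\<close>.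
        Testing with \<open>\<sigma>''\<close> bounds the acceleration by \<open>?n\<close>, and the
        projection disappears from the argument.\<close>
      with tangential_props(2)[OF Q W W2[OF mem(1)[OF t]], of "\<sigma>'' t + ?n"] geo[OF mem(1)[OF t]]
      have "G ?x (\<sigma>'' t + ?n) (\<sigma>'' t) = 0" by simp
      then have "G ?x (\<sigma>'' t) (\<sigma>'' t) = - G ?x ?n (\<sigma>'' t)"
        by (simp add: bilinear_ladd[OF inner_formD(1)[OF Q]])
      also have "\<dots> \<le> b * norm ?n * norm (\<sigma>'' t)" using b(2)[OF mem(2)[OF t], of ?n "\<sigma>'' t"] by linarith
      finally have "a * (norm (\<sigma>'' t))\<^sup>2 \<le> b * norm ?n * norm (\<sigma>'' t)"
        using a(2)[OF mem(2)[OF t], of "\<sigma>'' t"] by linarith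
      then have "a * norm (\<sigma>'' t) \<le> b * norm ?n"
        by (cases "\<sigma>'' t = 0") (use b in \<open>auto simp: power2_eq_square mult.assoc[symmetric]\<close>)
      then have 1: "norm (\<sigma>'' t) \<le> b / a * norm ?n" using a(1) by (simp add: pos_le_divide_eq mult.commute)
      have "(\<sigma> t, \<sigma>' t) - (t *\<^sub>R w, w) = u t" by (simp add: u_def)
      then have "norm ?n \<le> C * norm (u t)"
        using C(2)[of "(\<sigma> t, \<sigma>' t)" "(t *\<^sub>R w, w)"] mem[OF t] by auto
      then have "b / a * norm ?n \<le> b / a * (C * norm (u t))" using a b by (intro mult_left_mono) auto
      with 1 have 2: "norm (\<sigma>'' t) \<le> b / a * C * norm (u t)" by simp
      have "norm (\<sigma>' t - w, \<sigma>'' t) \<le> norm (\<sigma>' t - w) + norm (\<sigma>'' t)" by (rule norm_Pair_le)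
      also have "norm (\<sigma>' t - w) \<le> norm (u t)" unfolding u_def by (rule norm_snd_le)
      finally show "norm (\<sigma>' t - w, \<sigma>'' t) \<le> L * norm (u t) + 0" using 2 by (simp add: L_def algebra_simps)
    qed (use L in auto)
    moreover have "u 0 = 0" using \<sigma>(3) by (simp add: u_def w_def zero_prod_def)
    ultimately show ?thesis by simp
  qed
  then have eq: "\<sigma> t = t *\<^sub>R w" if "t \<in> {-e..e}" for t using that by (simp add: u_def zero_prod_def)
  show ?thesis
  proof (rule that[of e w])
    show "{-e<..<e} \<subseteq> I" using mem(1) by auto
  qed (use e eq line0 in auto)
qed


text \<open>By \<open>slice_geodesic_is_line\<close> every geodesic of the slice through
  \<open>p\<close> is a line in the chart \<open>c\<close> near \<open>p\<close>, and the
  Christoffel term vanishes along it, so the ambient equation holds in \<open>c\<close>. The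
  remaining work is that \<open>geodesic\<close> demands the equation in every chart
  \<open>d\<close> of the atlas.\<close>

lemma normal_slice:
  fixes A :: "('a::{t2_space, second_countable_topology}, 'e::euclidean_space) chart set"
  assumes M: "riemannian_manifold A g" and c: "c \<in> A" and p: "p \<in> cdom c" "coord c p = 0"
    and normal: "\<And>y l. y \<in> coord c ` cdom c \<Longrightarrow> \<bar>l\<bar> \<le> 1 \<Longrightarrow> l *\<^sub>R y \<in> coord c ` cdom c \<Longrightarrow>
      levi_civita (g c) (l *\<^sub>R y) y y = 0"
    and W: "subspace W" and S: "\<And>p'. p' \<in> S \<longleftrightarrow> p' \<in> cdom c \<and> coord c p' \<in> W"
  shows "submanifold A (dim W) S" "p \<in> S" "tangent_space c S p = W" "totally_geodesic_at A g S p"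
proof -
  note A = riemannian_manifoldD(1)[OF M] and G = riemannian_manifoldD(2)[OF M c]
  note ch = smooth_structureD(1)[OF A c]
  note ci = chart_inverse[OF ch]
  let ?V = "coord c ` cdom c"
  have slice: "coord c ` (cdom c \<inter> S) = ?V \<inter> W" using S by auto
  show "submanifold A (dim W) S" unfolding submanifold_def using S W c slice by blast
  show pS: "p \<in> S" using S p W by (simp add: subspace_0)
  have tan: "tangent_space c S p' = W" if "p' \<in> S" for p'
    by (rule tangent_space_slice[OF ch _ W]) (use S that in auto)
  then show "tangent_space c S p = W" using pS by blast
  have V0: "0 \<in> ?V" using p by force
  show "totally_geodesic_at A g S p"
    unfolding totally_geodesic_at_def
  proof (intro allI impI)
    fix I \<gamma> assume *: "0 \<in> I \<and> geodesic A g S I \<gamma> \<and> \<gamma> 0 = p"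
    have I: "open I" "is_interval I" "continuous_on I \<gamma>" "\<gamma> ` I \<subseteq> S" "0 \<in> I" "\<gamma> 0 = p"
      and geo: "\<And>d. d \<in> A \<Longrightarrow> smooth_on {t \<in> I. \<gamma> t \<in> cdom d} (coord d \<circ> \<gamma>)"
      "\<And>t. t \<in> I \<Longrightarrow> \<gamma> t \<in> cdom c \<Longrightarrow> tangential (g c (coord c (\<gamma> t))) (tangent_space c S (\<gamma> t))
             (cov_deriv (g c) (coord c \<circ> \<gamma>) (\<lambda>\<tau>. vector_derivative (coord c \<circ> \<gamma>) (at \<tau>)) t 1) = 0"
      using * c unfolding geodesic_def by blast+
    have \<gamma>c: "\<gamma> t \<in> S" "\<gamma> t \<in> cdom c" if "t \<in> I" for t using I(4) that S by blast+
    then have "{t \<in> I. \<gamma> t \<in> cdom c} = I" by blast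
    then have sm: "smooth_on I (coord c \<circ> \<gamma>)" using geo(1)[OF c] by simp
    obtain e w where e: "0 < e" "{-e<..<e} \<subseteq> I"
      "\<And>t. t \<in> {-e<..<e} \<Longrightarrow> (coord c \<circ> \<gamma>) t = t *\<^sub>R w \<and> levi_civita (g c) (t *\<^sub>R w) w w = 0"
    proof (rule slice_geodesic_is_line[OF G V0 normal W I(1,5) sm])
      fix t assume t: "t \<in> I"
      show "(coord c \<circ> \<gamma>) t \<in> ?V \<inter> W" using \<gamma>c[OF t] S by auto
      show "tangential (g c ((coord c \<circ> \<gamma>) t)) W
          (cov_deriv (g c) (coord c \<circ> \<gamma>) (\<lambda>\<tau>. vector_derivative (coord c \<circ> \<gamma>) (at \<tau>)) t 1) = 0"
        using geo(2)[OF t \<gamma>c(2)[OF t]] tan[OF \<gamma>c(1)[OF t]] by simp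
    qed (use I p in auto)
    let ?J = "{-e<..<e}"
    have "geodesic A g UNIV ?J \<gamma>"
      unfolding geodesic_def
    proof (intro conjI ballI impI)
      show "continuous_on ?J \<gamma>" by (rule continuous_on_subset[OF I(3) e(2)])
      fix d assume d: "d \<in> A"
      show "smooth_on {t \<in> ?J. \<gamma> t \<in> cdom d} (coord d \<circ> \<gamma>)"
        by (rule smooth_on_subset[OF geo(1)[OF d]]) (use e(2) in auto)
      fix t assume t: "t \<in> ?J" "\<gamma> t \<in> cdom d"
      note dh = smooth_structureD(1)[OF A d]
      let ?U = "coord c ` (cdom c \<inter> cdom d)" and ?\<phi> = "transition c d"
      let ?D = "\<lambda>x. frechet_derivative ?\<phi> (at x)"
      let ?D2 = "frechet_derivative (\<lambda>z. ?D z w) (at (t *\<^sub>R w)) w"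
      note \<phi> = smooth_structureD(2)[OF A c d]
      have opU: "open ?U" by (rule chart_overlap_open[OF ch dh])
      have tI: "s \<in> I" if "s \<in> ?J" for s using that e(2) by blast
      have line: "coord c (\<gamma> s) = s *\<^sub>R w" if "s \<in> ?J" for s using e(3)[OF that] by simp
      have tU: "t *\<^sub>R w \<in> ?U" using line[OF t(1)] \<gamma>c(2)[OF tI[OF t(1)]] t(2) by force
      have \<phi>line: "(coord d \<circ> \<gamma>) s = ?\<phi> (s *\<^sub>R w)" if "s \<in> ?J" for s
        using transition_coord[OF ch \<gamma>c(2)[OF tI[OF that]], of d] line[OF that] by simp
      define K where "K = ?J \<inter> (\<lambda>s. s *\<^sub>R w) -` ?U"
      have K: "open K" "t \<in> K"
        unfolding K_def using opU t(1) tU by (auto intro!: open_Int open_vimage continuous_intros)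
      have dline: "((\<lambda>s. f (s *\<^sub>R w)) has_vector_derivative f' w) (at s)"
        if "(f has_derivative f') (at (s *\<^sub>R w))" for f :: "'e \<Rightarrow> 'e" and f' s
        using has_vector_derivative_along_line[of f f' 0 s w] that by simp
      have "cov_deriv (g d) (coord d \<circ> \<gamma>) (\<lambda>\<tau>. vector_derivative (coord d \<circ> \<gamma>) (at \<tau>)) t 1 =
        ?D2 + levi_civita (g d) ((coord d \<circ> \<gamma>) t) (?D (t *\<^sub>R w) w) (?D (t *\<^sub>R w) w)"
      proof (rule cov_deriv_curve[OF K, where \<sigma>' = "\<lambda>s. ?D (s *\<^sub>R w) w"])
        fix s assume s: "s \<in> K"
        then have "((\<lambda>s. ?\<phi> (s *\<^sub>R w)) has_vector_derivative ?D (s *\<^sub>R w) w) (at s)"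
          by (intro dline smooth_on_has_derivative[OF \<phi>]) (simp add: K_def)
        then show "((coord d \<circ> \<gamma>) has_vector_derivative ?D (s *\<^sub>R w) w) (at s)"
          by (rule has_vector_derivative_transform_within_open[OF _ K(1) s]) (use \<phi>line in \<open>auto simp: K_def\<close>)
      next
        show "((\<lambda>s. ?D (s *\<^sub>R w) w) has_vector_derivative ?D2) (at t)"
          by (rule dline[OF smooth_on_has_derivative[OF smooth_on_frechet_derivative[OF \<phi>] tU]])
      qed
      \<comment> \<open>Read from right to left, the transformation law identifies the acceleration
        computed in \<open>d\<close> with the image of the Christoffel term in \<open>c\<close>,
        which is zero on the line.\<close>
      also have "\<dots> = ?D (t *\<^sub>R w) (levi_civita (g c) (t *\<^sub>R w) w w)"
        using levi_civita_chart_change[OF M c d tU, of w w] \<phi>line[OF t(1)] by (simp add: add.commute)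
      also have "\<dots> = 0"
        using e(3)[OF t(1)] linear_0[OF has_derivative_linear[OF smooth_on_has_derivative[OF \<phi> tU]]] by simp
      finally have 0: "cov_deriv (g d) (coord d \<circ> \<gamma>) (\<lambda>\<tau>. vector_derivative (coord d \<circ> \<gamma>) (at \<tau>)) t 1 = 0" .
      have Q: "inner_form (g d (coord d (\<gamma> t)))"
        by (rule smooth_metricD(2)[OF riemannian_manifoldD(2)[OF M d]]) (use t in auto)
      show "tangential (g d (coord d (\<gamma> t))) (tangent_space d UNIV (\<gamma> t))
          (cov_deriv (g d) (coord d \<circ> \<gamma>) (\<lambda>\<tau>. vector_derivative (coord d \<circ> \<gamma>) (at \<tau>)) t 1) = 0"
        unfolding 0 tangent_space_UNIV[OF dh t(2)]
        by (rule tangential_eqI[OF Q subspace_UNIV]) (auto simp: bilinear_lzero[OF inner_formD(1)[OF Q]])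
    qed (auto simp: is_interval_convex_1)
    with e show "\<exists>e>0. {-e<..<e} \<subseteq> I \<and> geodesic A g UNIV {-e<..<e} \<gamma>" by blast
  qed
qed

section \<open>Second fundamental forms\<close>

lemma coord_rep_coord:
  assumes "is_chart b" "p \<in> cdom b"
  shows "coord_rep b c \<iota> (coord b p) = coord c (\<iota> p)"
  using chart_inverse(1)[OF assms] by (simp add: coord_rep_def)

lemma immersionD:
  assumes "immersion B A \<iota>" and b: "b \<in> B" "is_chart b" and c: "c \<in> A" "is_chart c"
  shows "open (coord b ` (cdom b \<inter> \<iota> -` cdom c))"
    "smooth_on (coord b ` (cdom b \<inter> \<iota> -` cdom c)) (coord_rep b c \<iota>)"
    "p \<in> cdom b \<Longrightarrow> \<iota> p \<in> cdom c \<Longrightarrow> (coord_rep b c \<iota> has_derivative differential b c \<iota> p) (at (coord b p))"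
    "p \<in> cdom b \<Longrightarrow> \<iota> p \<in> cdom c \<Longrightarrow> inj (differential b c \<iota> p)"
    "p \<in> cdom b \<Longrightarrow> \<iota> p \<in> cdom c \<Longrightarrow> linear (differential b c \<iota> p)"
proof -
  have cont: "continuous_on UNIV \<iota>" using assms(1) by (simp add: immersion_def)
  have "open (\<iota> -` cdom c)" using cont chart_inverse(6)[OF c(2)] by (simp add: open_vimage)
  then show "open (coord b ` (cdom b \<inter> \<iota> -` cdom c))" by (rule chart_image_open[OF b(2)])
  show sm: "smooth_on (coord b ` (cdom b \<inter> \<iota> -` cdom c)) (coord_rep b c \<iota>)"
    using assms(1) b c unfolding immersion_def by blast
  show "p \<in> cdom b \<Longrightarrow> \<iota> p \<in> cdom c \<Longrightarrow> inj (differential b c \<iota> p)"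
    using assms(1) b c unfolding immersion_def by blast
  show d: "p \<in> cdom b \<Longrightarrow> \<iota> p \<in> cdom c \<Longrightarrow> (coord_rep b c \<iota> has_derivative differential b c \<iota> p) (at (coord b p))"
    unfolding differential_def by (rule smooth_on_has_derivative[OF sm]) auto
  show "p \<in> cdom b \<Longrightarrow> \<iota> p \<in> cdom c \<Longrightarrow> linear (differential b c \<iota> p)"
    using d by (blast intro: has_derivative_linear)
qed

lemma differential_target_change:
  assumes I: "immersion B A \<iota>" and b: "b \<in> B" "is_chart b" and A: "smooth_structure A" and c: "c \<in> A" and d: "d \<in> A"
    and p: "p \<in> cdom b" "\<iota> p \<in> cdom c" "\<iota> p \<in> cdom d"
  shows "differential b d \<iota> p v = frechet_derivative (transition c d) (at (coord c (\<iota> p))) (differential b c \<iota> p v)"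
proof -
  note ch = smooth_structureD(1)[OF A c] and dh = smooth_structureD(1)[OF A d]
  let ?U = "coord b ` (cdom b \<inter> \<iota> -` (cdom c \<inter> cdom d))"
  have "open (\<iota> -` (cdom c \<inter> cdom d))"
    using I chart_inverse(6)[OF ch] chart_inverse(6)[OF dh] by (auto simp: immersion_def intro!: open_vimage)
  then have opU: "open ?U" by (rule chart_image_open[OF b(2)])
  have pU: "coord b p \<in> ?U" using p by auto
  have "(transition c d has_derivative frechet_derivative (transition c d) (at (coord c (\<iota> p)))) (at (coord_rep b c \<iota> (coord b p)))"
    unfolding coord_rep_coord[OF b(2) p(1)]
    by (rule smooth_on_has_derivative[OF smooth_structureD(2)[OF A c d]]) (use p in auto)
  from has_derivative_compose[OF immersionD(3)[OF I b c ch p(1,2)] this]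
  have "((\<lambda>x. transition c d (coord_rep b c \<iota> x)) has_derivative
    (\<lambda>v. frechet_derivative (transition c d) (at (coord c (\<iota> p))) (differential b c \<iota> p v))) (at (coord b p))" .
  then have "(coord_rep b d \<iota> has_derivative
    (\<lambda>v. frechet_derivative (transition c d) (at (coord c (\<iota> p))) (differential b c \<iota> p v))) (at (coord b p))"
  proof (rule has_derivative_transform_within_open[OF _ opU pU])
    fix x assume "x \<in> ?U"
    then obtain p' where p': "p' \<in> cdom b" "\<iota> p' \<in> cdom c" "x = coord b p'" by auto
    then show "transition c d (coord_rep b c \<iota> x) = coord_rep b d \<iota> x"
      using transition_coord[OF ch p'(2), of d] coord_rep_coord[OF b(2) p'(1), of c \<iota>] coord_rep_coord[OF b(2) p'(1), of d \<iota>] by simp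
  qed
  from has_derivative_unique[OF this immersionD(3)[OF I b d dh p(1,3)]] show ?thesis by metis
qed

lemma differential_source_change:
  assumes I: "immersion B A \<iota>" and B: "smooth_structure B" and b: "b \<in> B" and b': "b' \<in> B" and c: "c \<in> A" "is_chart c"
    and p: "p \<in> cdom b" "p \<in> cdom b'" "\<iota> p \<in> cdom c"
  shows "differential b c \<iota> p v = differential b' c \<iota> p (frechet_derivative (transition b b') (at (coord b p)) v)"
proof -
  note bh = smooth_structureD(1)[OF B b] and bh' = smooth_structureD(1)[OF B b']
  let ?U = "coord b ` (cdom b \<inter> cdom b')"
  have opU: "open ?U" by (rule chart_overlap_open[OF bh bh'])
  have pU: "coord b p \<in> ?U" using p by auto
  have "(coord_rep b' c \<iota> has_derivative differential b' c \<iota> p) (at (transition b b' (coord b p)))"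
    unfolding transition_coord[OF bh p(1)] by (rule immersionD(3)[OF I b' bh' c p(2,3)])
  from has_derivative_compose[OF smooth_on_has_derivative[OF smooth_structureD(2)[OF B b b'] pU] this]
  have "((\<lambda>x. coord_rep b' c \<iota> (transition b b' x)) has_derivative
    (\<lambda>v. differential b' c \<iota> p (frechet_derivative (transition b b') (at (coord b p)) v))) (at (coord b p))" .
  then have "(coord_rep b c \<iota> has_derivative
    (\<lambda>v. differential b' c \<iota> p (frechet_derivative (transition b b') (at (coord b p)) v))) (at (coord b p))"
  proof (rule has_derivative_transform_within_open[OF _ opU pU])
    fix x assume "x \<in> ?U"
    then obtain p' where p': "p' \<in> cdom b" "p' \<in> cdom b'" "x = coord b p'" by auto
    then show "coord_rep b' c \<iota> (transition b b' x) = coord_rep b c \<iota> x"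
      using transition_coord[OF bh p'(1), of b'] coord_rep_coord[OF bh p'(1), of c \<iota>] coord_rep_coord[OF bh' p'(2), of c \<iota>] by simp
  qed
  from has_derivative_unique[OF this immersionD(3)[OF I b bh c p(1,3)]] show ?thesis by metis
qed

lemma tangent_space_chart_change:
  assumes A: "smooth_structure A" and c: "c \<in> A" and d: "d \<in> A" and p: "p \<in> cdom c" "p \<in> cdom d"
    and v: "v \<in> tangent_space c S p"
  shows "frechet_derivative (transition c d) (at (coord c p)) v \<in> tangent_space d S p"
proof -
  note ch = smooth_structureD(1)[OF A c] and dh = smooth_structureD(1)[OF A d]
  note \<phi> = smooth_structureD(2)[OF A c d]
  let ?U = "coord c ` (cdom c \<inter> cdom d)"
  have opU: "open ?U" by (rule chart_overlap_open[OF ch dh])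
  obtain \<sigma> e where \<sigma>: "0 < e" "smooth_on {-e<..<e} \<sigma>" "\<sigma> 0 = coord c p"
    "\<And>t. t \<in> {-e<..<e} \<Longrightarrow> \<sigma> t \<in> coord c ` (cdom c \<inter> S)" "(\<sigma> has_vector_derivative v) (at 0)"
    using tangent_spaceE[OF v] by metis
  have "open ({-e<..<e} \<inter> \<sigma> -` ?U)"
    by (rule continuous_open_preimage[OF smooth_on_continuous[OF \<sigma>(2)] _ opU]) simp
  moreover have "0 \<in> {-e<..<e} \<inter> \<sigma> -` ?U" using \<sigma> p by auto
  ultimately obtain e' where e': "0 < e'" "{-e'<..<e'} \<subseteq> {-e<..<e} \<inter> \<sigma> -` ?U"
    by (rule open_real_symmetric_interval)
  show ?thesis
  proof (rule tangent_spaceI[OF dh p(2), where e = e' and \<sigma> = "\<lambda>t. transition c d (\<sigma> t)"])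
    show "smooth_on {-e'<..<e'} (\<lambda>t. transition c d (\<sigma> t))"
      by (rule smooth_on_compose[OF smooth_on_subset[OF \<sigma>(2)] \<phi> _ opU]) (use e' in auto)
    show "transition c d (\<sigma> 0) = coord d p" using \<sigma>(3) transition_coord[OF ch p(1)] by simp
    fix t assume t: "t \<in> {-e'<..<e'}"
    then have "t \<in> {-e<..<e}" "\<sigma> t \<in> ?U" using e'(2) by blast+
    then obtain p' p'' where p': "p' \<in> cdom c" "p' \<in> cdom d" "\<sigma> t = coord c p'"
      and p'': "p'' \<in> cdom c" "p'' \<in> S" "\<sigma> t = coord c p''" using \<sigma>(4)[of t] by blast
    have "p' = p''" using p' p'' chart_inverse(1)[OF ch] by metis
    then show "transition c d (\<sigma> t) \<in> coord d ` (cdom d \<inter> S)"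
      using p' p'' transition_coord[OF ch p'(1), of d] by auto
  next
    have "(transition c d has_derivative frechet_derivative (transition c d) (at (coord c p))) (at (\<sigma> 0))"
      unfolding \<sigma>(3) by (rule smooth_on_has_derivative[OF \<phi>]) (use p in auto)
    from vector_derivative_diff_chain_within[OF has_vector_derivative_at_within[OF \<sigma>(5), of UNIV] has_derivative_at_withinI[OF this]]
    show "((\<lambda>t. transition c d (\<sigma> t)) has_vector_derivative frechet_derivative (transition c d) (at (coord c p)) v) (at 0)"
      by (simp add: o_def)
  qed (rule e'(1))
qed

text \<open>The part of the ambient derivative that depends only on the values of the two fields at
  \<open>p\<close>. It depends on the chart \<open>b\<close>, but agrees with the second fundamental
  form of \<Sigma> modulo tangent vectors of \<Sigma>, and so serves as a common reference for all
  submanifolds of \<Sigma> through \<open>p\<close>.\<close>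

definition hessian_form ::
    "('p, 'd::euclidean_space) chart \<Rightarrow> ('a, 'e::euclidean_space) chart \<Rightarrow>
     ('a, 'e) metric_components \<Rightarrow> ('p \<Rightarrow> 'a) \<Rightarrow> 'p \<Rightarrow> 'd \<Rightarrow> 'd \<Rightarrow> 'e" where
  "hessian_form b c g \<iota> p u v =
     frechet_derivative (\<lambda>z. frechet_derivative (coord_rep b c \<iota>) (at z) v) (at (coord b p)) u +
     levi_civita (g c) (coord_rep b c \<iota> (coord b p)) (differential b c \<iota> p u) (differential b c \<iota> p v)"

text \<open>Differentiating the push-forward of \<open>Y\<close> by the product rule splits off the
  term that contains the derivative of \<open>Y\<close>; this term is tangent to the immersed
  manifold.\<close>

lemma ambient_derivative_eq:
  assumes f: "smooth_on U (coord_rep b c \<iota>)" "open U" "coord b p \<in> U"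
    and Y: "(Y has_derivative Y') (at (coord b p))"
  shows "ambient_derivative b c g \<iota> p X Y =
    hessian_form b c g \<iota> p (X (coord b p)) (Y (coord b p)) + differential b c \<iota> p (Y' (X (coord b p)))"
proof -
  have "((\<lambda>y. frechet_derivative (coord_rep b c \<iota>) (at y) (Y y)) has_derivative
    (\<lambda>h. frechet_derivative (\<lambda>z. frechet_derivative (coord_rep b c \<iota>) (at z) (Y (coord b p))) (at (coord b p)) h +
      frechet_derivative (coord_rep b c \<iota>) (at (coord b p)) (Y' h))) (at (coord b p))"
    by (rule has_derivative_derivative_apply[OF smooth_onD[OF f(1)] f(2) has_derivative_ident f(3) Y])
  from frechet_derivative_at[OF this, symmetric]
  show ?thesis by (simp add: ambient_derivative_def cov_deriv_def hessian_form_def differential_def)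
qed

lemma linear_image_subspace_diff:
  assumes "linear D" "x - y \<in> T"
  shows "D x - D y \<in> D ` T"
  using assms by (metis image_eqI linear_diff)

lemma tangent_field_nearE:
  assumes "tangent_field_near b S p X"
  obtains V where "open V" "p \<in> V" "V \<subseteq> cdom b" "smooth_on (coord b ` V) X"
    "\<And>x. x \<in> S \<inter> V \<Longrightarrow> X (coord b x) \<in> tangent_space b S x"
  using assms by (auto simp: tangent_field_near_def)

text \<open>The defining description denotes something only if tangent fields with prescribed values
  exist and the normal part of the derivative does not depend on their choice; both are obtained by
  flattening \<open>S\<close> to the subspace \<open>P\<close>. In the first conclusion
  \<open>x\<close> is an arbitrary vector, not necessarily tangent to \<open>S\<close>: only the
  class modulo vectors tangent to the immersed manifold matters later.\<close>

lemma second_fundamental_form_straightened: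
  fixes b :: "('p::topological_space, 'd::euclidean_space) chart" and c :: "('a::topological_space, 'e::euclidean_space) chart"
    and \<psi> \<kappa> :: "'d \<Rightarrow> 'd"
  assumes b: "is_chart b" and p: "p \<in> cdom b \<inter> S"
    and \<psi>: "smooth_on U \<psi>" and \<kappa>: "smooth_on V \<kappa>" and op: "open U" "open V" and hom: "homeomorphism U V \<psi> \<kappa>"
    and U: "coord b p \<in> U" "U \<subseteq> coord b ` cdom b" and P: "subspace P"
    and S: "\<And>p'. p' \<in> cdom b \<Longrightarrow> coord b p' \<in> U \<Longrightarrow> p' \<in> S \<longleftrightarrow> \<psi> (coord b p') \<in> P"
    and f: "smooth_on \<Omega> (coord_rep b c \<iota>)" "open \<Omega>" "coord b p \<in> \<Omega>"
    and Q: "inner_form (g c (coord c (\<iota> p)))"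
    and uv: "u \<in> tangent_space b S p" "v \<in> tangent_space b S p"
  shows "\<exists>x. second_fundamental_form b c g \<iota> S p u v = hessian_form b c g \<iota> p u v + differential b c \<iota> p x"
    "w \<in> tangent_space b S p \<Longrightarrow>
      g c (coord c (\<iota> p)) (second_fundamental_form b c g \<iota> S p u v) (differential b c \<iota> p w) = 0"
proof -
  let ?y = "coord b p" and ?T = "tangent_space b S p" and ?D = "differential b c \<iota> p"
  let ?Q = "g c (coord c (\<iota> p))"
  let ?a = "ambient_derivative b c g \<iota> p" and ?B = "hessian_form b c g \<iota> p"
  define tg where "tg = tangential ?Q (?D ` ?T)"
  have tangent: "tangent_space b S p' = {v. frechet_derivative \<psi> (at (coord b p')) v \<in> P}"
    if "p' \<in> cdom b" "p' \<in> S" "coord b p' \<in> U" for p'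
    by (rule tangent_space_straightened[OF b _ \<psi> \<kappa> op hom _ U(2) P S]) (use that in auto)
  have T: "?T = {v. frechet_derivative \<psi> (at ?y) v \<in> P}" using tangent p U by auto
  have linD: "linear ?D" unfolding differential_def by (rule has_derivative_linear[OF smooth_on_has_derivative[OF f(1,3)]])
  have lin\<psi>: "linear (frechet_derivative \<psi> (at y))" if "y \<in> U" for y
    by (rule has_derivative_linear[OF smooth_on_has_derivative[OF \<psi> that]])
  have subT: "subspace ?T"
    unfolding T using P lin\<psi>[OF U(1)]
    by (auto simp: subspace_def linear_0 linear_add linear_scale)
  have subDT: "subspace (?D ` ?T)" by (rule linear_subspace_image[OF linD subT])
  have field_deriv: "(Y has_derivative frechet_derivative Y (at ?y)) (at ?y)" if Y: "tangent_field_near b S p Y" for Y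
  proof -
    obtain V' where V': "p \<in> V'" "smooth_on (coord b ` V') Y"
      using tangent_field_nearE[OF Y] by metis
    show ?thesis by (rule smooth_on_has_derivative[OF V'(2) imageI[OF V'(1)]])
  qed
  \<comment> \<open>The extension is the field that \<psi> maps to the constant field
    \<open>z\<close> of \<open>P\<close>.\<close>
  have ex: "\<exists>Y. tangent_field_near b S p Y \<and> Y ?y = v" if v: "v \<in> ?T" for v
  proof -
    define z where "z = frechet_derivative \<psi> (at ?y) v"
    define Y where "Y y = frechet_derivative \<kappa> (at (\<psi> y)) z" for y
    have \<psi>V: "\<psi> ` U \<subseteq> V" using hom by (auto simp: homeomorphism_def)
    have smY: "smooth_on U Y" unfolding Y_def[abs_def]
      by (rule smooth_on_compose[OF \<psi> smooth_on_frechet_derivative[OF \<kappa>] op \<psi>V])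
    define V' where "V' = cdom b \<inter> coord b -` U"
    have V': "open V'" "p \<in> V'" "V' \<subseteq> cdom b"
      unfolding V'_def using continuous_open_preimage[OF chart_inverse(4,6)[OF b] op(1)] p U by auto
    have imV': "coord b ` V' \<subseteq> U" by (auto simp: V'_def)
    have zP: "z \<in> P" using v T by (simp add: z_def)
    have "Y (coord b x) \<in> tangent_space b S x" if "x \<in> S \<inter> V'" for x
    proof -
      have x: "x \<in> cdom b" "x \<in> S" "coord b x \<in> U" using that by (auto simp: V'_def)
      have "\<kappa> (\<psi> (coord b x)) = coord b x" "\<psi> (coord b x) \<in> V" using hom x(3) by (auto simp: homeomorphism_def)
      with inverse_derivative[OF \<kappa> \<psi> op(2,1) homeomorphism_symD[OF hom], of "\<psi> (coord b x)" z]
      have "frechet_derivative \<psi> (at (coord b x)) (Y (coord b x)) = z" by (simp add: Y_def)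
      then show ?thesis using tangent[OF x] zP by simp
    qed
    then have "tangent_field_near b S p Y"
      unfolding tangent_field_near_def using V' smooth_on_subset[OF smY imV'] by blast
    moreover have "Y ?y = v" unfolding Y_def z_def by (rule inverse_derivative[OF \<psi> \<kappa> op hom U(1)])
    ultimately show ?thesis by blast
  qed
  \<comment> \<open>Along a curve in \<open>S\<close> with velocity \<open>u\<close>, the derivative
    of \<psi> maps \<open>Y - Z\<close> into \<open>P\<close>. Differentiating at the point where
    \<open>Y\<close> and \<open>Z\<close> agree shows that the difference of their derivatives along
    \<open>u\<close> is tangent to \<open>S\<close>.\<close>
  have same: "frechet_derivative Y (at ?y) u - frechet_derivative Z (at ?y) u \<in> ?T"
    if Y: "tangent_field_near b S p Y" and Z: "tangent_field_near b S p Z" and YZ: "Y ?y = Z ?y" for Y Z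
  proof -
    obtain VY where VY: "open VY" "p \<in> VY" "VY \<subseteq> cdom b" "\<And>x. x \<in> S \<inter> VY \<Longrightarrow> Y (coord b x) \<in> tangent_space b S x"
      using tangent_field_nearE[OF Y] by metis
    obtain VZ where VZ: "open VZ" "p \<in> VZ" "VZ \<subseteq> cdom b" "\<And>x. x \<in> S \<inter> VZ \<Longrightarrow> Z (coord b x) \<in> tangent_space b S x"
      using tangent_field_nearE[OF Z] by metis
    obtain \<sigma> e where \<sigma>: "0 < e" "smooth_on {-e<..<e} \<sigma>" "\<sigma> 0 = ?y"
      "\<And>t. t \<in> {-e<..<e} \<Longrightarrow> \<sigma> t \<in> coord b ` (cdom b \<inter> S)" "(\<sigma> has_vector_derivative u) (at 0)"
      using tangent_spaceE[OF uv(1)] by metis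
    let ?N = "coord b ` (cdom b \<inter> (VY \<inter> VZ)) \<inter> U"
    have "open ?N" using chart_image_open[OF b open_Int[OF VY(1) VZ(1)]] op by blast
    define J where "J = {-e<..<e} \<inter> \<sigma> -` ?N"
    have J: "open J" "0 \<in> J"
      unfolding J_def using continuous_open_preimage[OF smooth_on_continuous[OF \<sigma>(2)] _ \<open>open ?N\<close>] \<sigma> p U VY(2) VZ(2) by auto
    let ?X = "\<lambda>t. Y (\<sigma> t) - Z (\<sigma> t)"
    let ?X' = "\<lambda>h. frechet_derivative Y (at ?y) (h *\<^sub>R u) - frechet_derivative Z (at ?y) (h *\<^sub>R u)"
    have d\<sigma>: "(\<sigma> has_derivative (\<lambda>h. h *\<^sub>R u)) (at 0)" using \<sigma>(5) by (simp add: has_vector_derivative_def)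
    have dX: "(?X has_derivative ?X') (at 0)"
      using field_deriv[OF Y] field_deriv[OF Z]
      by (intro has_derivative_diff has_derivative_compose[OF d\<sigma>]) (simp_all add: \<sigma>(3))
    \<comment> \<open>The contribution of the moving base point: it is applied to
      \<open>Y - Z\<close> at \<open>p\<close>, which is 0, and therefore drops out of the product
      rule below.\<close>
    have "frechet_derivative (\<lambda>z. frechet_derivative \<psi> (at z) 0) (at ?y) = frechet_derivative (\<lambda>z. 0::'d) (at ?y)"
      by (rule frechet_derivative_transform_within_open[symmetric, OF _ op(1) U(1)]) (simp_all add: linear_0[OF lin\<psi>])
    moreover have "((\<lambda>t. frechet_derivative \<psi> (at (\<sigma> t)) (?X t)) has_derivative
      (\<lambda>h. frechet_derivative (\<lambda>z. frechet_derivative \<psi> (at z) (?X 0)) (at (\<sigma> 0)) (h *\<^sub>R u) +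
        frechet_derivative \<psi> (at (\<sigma> 0)) (?X' h))) (at 0)"
      by (rule has_derivative_derivative_apply[OF smooth_onD[OF \<psi>] op(1) d\<sigma> _ dX]) (use \<sigma>(3) U in simp)
    ultimately have "((\<lambda>t. frechet_derivative \<psi> (at (\<sigma> t)) (?X t)) has_derivative
        (\<lambda>h. frechet_derivative \<psi> (at ?y) (?X' h))) (at 0)" by (simp add: \<sigma>(3) YZ)
    moreover have "frechet_derivative \<psi> (at ?y) (?X' h) = h *\<^sub>R frechet_derivative \<psi> (at ?y) (?X' 1)" for h
      using has_derivative_linear[OF field_deriv[OF Y]] has_derivative_linear[OF field_deriv[OF Z]] lin\<psi>[OF U(1)]
      by (simp add: linear_scale flip: scaleR_diff_right)
    ultimately have "((\<lambda>t. frechet_derivative \<psi> (at (\<sigma> t)) (?X t)) has_vector_derivative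
        frechet_derivative \<psi> (at ?y) (?X' 1)) (at 0)" by (simp add: has_vector_derivative_def)
    then have "frechet_derivative \<psi> (at ?y) (?X' 1) \<in> P"
    proof (rule vector_derivative_in_subspace[OF P _ J])
      fix t assume t: "t \<in> J"
      then obtain x where x: "x \<in> cdom b" "x \<in> VY" "x \<in> VZ" "\<sigma> t = coord b x" "coord b x \<in> U" by (auto simp: J_def)
      obtain x' where x': "x' \<in> cdom b" "x' \<in> S" "\<sigma> t = coord b x'" using \<sigma>(4)[of t] t by (auto simp: J_def)
      have "x = x'" using x x' chart_inverse(1)[OF b] by metis
      then have xS: "x \<in> S" using x' by simp
      have "frechet_derivative \<psi> (at (coord b x)) (Y (coord b x)) \<in> P" "frechet_derivative \<psi> (at (coord b x)) (Z (coord b x)) \<in> P"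
        using VY(4)[of x] VZ(4)[of x] tangent[OF x(1) xS x(5)] x xS by auto
      then show "frechet_derivative \<psi> (at (\<sigma> t)) (?X t) \<in> P"
        unfolding x(4) linear_diff[OF lin\<psi>[OF x(5)]] by (rule subspace_diff[OF P])
    qed
    then show ?thesis using T by simp
  qed
  obtain X where X: "tangent_field_near b S p X" "X ?y = u" using ex[OF uv(1)] by blast
  obtain Y where Y: "tangent_field_near b S p Y" "Y ?y = v" using ex[OF uv(2)] by blast
  note amb = ambient_derivative_eq[OF f field_deriv]
  have ind: "induced_derivative b c g \<iota> S p X Y = tg (?a X Y)" for X Y by (simp add: induced_derivative_def tg_def)
  have II: "second_fundamental_form b c g \<iota> S p u v = ?a X Y - tg (?a X Y)"
    unfolding second_fundamental_form_def ind
  proof (rule the_equality)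
    show "\<exists>X' Y'. tangent_field_near b S p X' \<and> tangent_field_near b S p Y' \<and> X' ?y = u \<and> Y' ?y = v \<and>
        ?a X' Y' = tg (?a X' Y') + (?a X Y - tg (?a X Y))"
      using X Y by (intro exI[of _ X] exI[of _ Y]) simp
    fix w assume "\<exists>X' Y'. tangent_field_near b S p X' \<and> tangent_field_near b S p Y' \<and> X' ?y = u \<and> Y' ?y = v \<and>
        ?a X' Y' = tg (?a X' Y') + w"
    then obtain X' Y' where X': "X' ?y = u" and Y': "tangent_field_near b S p Y'" "Y' ?y = v"
      and w: "?a X' Y' = tg (?a X' Y') + w" by blast
    define t where "t = ?D (frechet_derivative Y' (at ?y) u) - ?D (frechet_derivative Y (at ?y) u)"
    have t: "t \<in> ?D ` ?T"
      unfolding t_def by (rule linear_image_subspace_diff[OF linD same[OF Y'(1) Y(1)]]) (simp add: Y Y')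
    have eq: "?a X' Y' = ?a X Y + t" by (simp add: amb Y(1) Y'(1) X' X(2) Y(2) Y'(2) t_def)
    \<comment> \<open>Since \<open>t\<close> is tangent to \<open>S\<close>, projection changes by
      \<open>t\<close> as well, so the normal part is the same for both choices of fields.\<close>
    have "tg (?a X Y + t) = tg (?a X Y) + t"
      unfolding tg_def
    proof (rule tangential_eqI[OF Q subDT])
      show "tangential ?Q (?D ` ?T) (?a X Y) + t \<in> ?D ` ?T"
        by (rule subspace_add[OF subDT tangential_props(1)[OF Q subDT] t])
      fix w assume "w \<in> ?D ` ?T"
      from tangential_props(2)[OF Q subDT this]
      show "?Q (?a X Y + t - (tangential ?Q (?D ` ?T) (?a X Y) + t)) w = 0" by simp
    qed
    then show "w = ?a X Y - tg (?a X Y)" using w eq by (simp add: algebra_simps)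
  qed
  have "tg (?a X Y) \<in> ?D ` ?T" unfolding tg_def by (rule tangential_props(1)[OF Q subDT])
  then obtain x where "tg (?a X Y) = ?D x" by blast
  then have "second_fundamental_form b c g \<iota> S p u v = ?B u v + ?D (frechet_derivative Y (at ?y) u - x)"
    unfolding II by (simp add: amb[OF Y(1)] X(2) Y(2) linear_diff[OF linD])
  then show "\<exists>x. second_fundamental_form b c g \<iota> S p u v = ?B u v + ?D x" by blast
  show "w \<in> ?T \<Longrightarrow> ?Q (second_fundamental_form b c g \<iota> S p u v) (?D w) = 0"
    unfolding II tg_def by (rule tangential_props(2)[OF Q subDT]) simp
qed

section \<open>Linear algebra of normal spaces and umbilic forms\<close>

lemma orthogonal_left_inverse:
  fixes D :: "'d::euclidean_space \<Rightarrow> 'e::euclidean_space"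
  assumes Q: "inner_form Q" and D: "linear D" "inj D"
  obtains \<tau> where "linear \<tau>" "\<And>u. \<tau> (D u) = u" "\<And>w. \<tau> w = 0 \<longleftrightarrow> (\<forall>u. Q w (D u) = 0)"
proof -
  let ?T = "range D" and ?t = "tangential Q (range D)"
  have T: "subspace ?T" by (rule linear_subspace_image[OF D(1) subspace_UNIV])
  note b = inner_formD(1)[OF Q]
  note tp = tangential_props[OF Q T]
  have lin: "linear ?t"
  proof (rule linearI)
    show "?t (x + y) = ?t x + ?t y" for x y
    proof (rule tangential_eqI[OF Q T])
      show "?t x + ?t y \<in> ?T" by (intro subspace_add[OF T] tp(1))
      fix u assume u: "u \<in> ?T"
      have "x + y - (?t x + ?t y) = (x - ?t x) + (y - ?t y)" by simp
      then show "Q (x + y - (?t x + ?t y)) u = 0"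
        using tp(2)[OF u] by (simp only: bilinear_ladd[OF b] add_0)
    qed
    show "?t (r *\<^sub>R x) = r *\<^sub>R ?t x" for r x
    proof (rule tangential_eqI[OF Q T])
      show "r *\<^sub>R ?t x \<in> ?T" by (intro subspace_scale[OF T] tp(1))
      fix u assume u: "u \<in> ?T"
      have "r *\<^sub>R x - r *\<^sub>R ?t x = r *\<^sub>R (x - ?t x)" by (simp add: scaleR_diff_right)
      then show "Q (r *\<^sub>R x - r *\<^sub>R ?t x) u = 0"
        using tp(2)[OF u] by (simp only: bilinear_lmul[OF b] mult_zero_right scaleR_zero_right)
    qed
  qed
  \<comment> \<open>Any left inverse of \<open>D\<close> will do: it is only applied after
    orthogonal projection onto the range, which makes the kernel of the composite exactly the normal
    space.\<close>
  obtain K where K: "linear K" "\<And>u. K (D u) = u"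
    using linear_injective_left_inverse[OF D] by (metis comp_apply id_apply)
  show ?thesis
  proof (rule that[of "\<lambda>w. K (?t w)"])
    show "linear (\<lambda>w. K (?t w))" using linear_compose[OF lin K(1)] by (simp add: o_def)
    have "?t (D u) = D u" for u
      by (rule tangential_eqI[OF Q T]) (auto simp: bilinear_lzero[OF b])
    then show "K (?t (D u)) = u" for u by (simp add: K)
    show "K (?t w) = 0 \<longleftrightarrow> (\<forall>u. Q w (D u) = 0)" for w
    proof
      assume "K (?t w) = 0"
      moreover obtain x where "?t w = D x" using tp(1)[of w] by blast
      ultimately have "?t w = 0" using K linear_0[OF D(1)] by simp
      then show "\<forall>u. Q w (D u) = 0" using tp(2)[of _ w] by auto
    next
      assume "\<forall>u. Q w (D u) = 0"
      then have "?t w = 0" by (intro tangential_eqI[OF Q T]) (auto simp: subspace_0[OF T])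
      then show "K (?t w) = 0" by (simp add: linear_0[OF K(1)])
    qed
  qed
qed

lemma dim_preimage_left_inverse:
  fixes D :: "'d::euclidean_space \<Rightarrow> 'e::euclidean_space"
  assumes D: "linear D" and \<tau>: "linear \<tau>" "\<And>u. \<tau> (D u) = u" and P: "subspace P"
  shows "dim {w. \<tau> w \<in> P} = dim P + dim {w. \<tau> w = 0}"
proof -
  let ?N = "{w. \<tau> w = 0}"
  have N: "subspace ?N" using \<tau>(1) by (auto simp: subspace_def linear_0 linear_add linear_scale)
  have DP: "subspace (D ` P)" by (rule linear_subspace_image[OF D P])
  have inj: "inj D" by (metis \<tau>(2) injI)
  have "{x + y |x y. x \<in> D ` P \<and> y \<in> ?N} = {w. \<tau> w \<in> P}"
  proof (intro subset_antisym subsetI)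
    fix w assume "w \<in> {x + y |x y. x \<in> D ` P \<and> y \<in> ?N}"
    then show "w \<in> {w. \<tau> w \<in> P}" by (auto simp: linear_add[OF \<tau>(1)] \<tau>(2))
  next
    fix w assume "w \<in> {w. \<tau> w \<in> P}"
    then have "D (\<tau> w) \<in> D ` P" "w - D (\<tau> w) \<in> ?N" by (auto simp: linear_diff[OF \<tau>(1)] \<tau>(2))
    moreover have "w = D (\<tau> w) + (w - D (\<tau> w))" by simp
    ultimately show "w \<in> {x + y |x y. x \<in> D ` P \<and> y \<in> ?N}" by blast
  qed
  moreover have "D ` P \<inter> ?N = {0}"
    using subspace_0[OF P] by (auto simp: \<tau>(2) linear_0[OF D] linear_0[OF \<tau>(1)] image_iff intro!: bexI[of _ 0])
  moreover have "dim (D ` P) = dim P" by (rule dim_image_eq[OF D]) (use inj in \<open>auto intro: inj_on_subset\<close>)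
  ultimately show ?thesis using dim_sums_Int[OF DP N] by simp
qed

text \<open>The span of the two vectors is enlarged by one new vector at a time; dependent or zero
  vectors are allowed, so the starting dimension may be below 2.\<close>

lemma subspace_of_dim_containing:
  fixes u v :: "'d::euclidean_space"
  assumes s: "2 \<le> s" "s \<le> DIM('d)"
  obtains P where "subspace P" "dim P = s" "u \<in> P" "v \<in> P"
proof -
  have "dim {u, v} \<le> card {u, v}" by (intro dim_le_card') auto
  also have "\<dots> \<le> 2" by (simp add: card_insert_if)
  finally have "dim (span {u, v}) \<le> s" using s by simp
  then have "s \<le> DIM('d) \<longrightarrow> (\<exists>P. subspace P \<and> dim P = s \<and> span {u, v} \<subseteq> P)"
  proof (induction s rule: dec_induct)
    case base
    then show ?case by (intro impI exI[of _ "span {u, v}"]) auto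
  next
    case (step k)
    show ?case
    proof
      assume "Suc k \<le> DIM('d)"
      with step.IH obtain P where P: "subspace P" "dim P = k" "span {u, v} \<subseteq> P" by auto
      have "P \<noteq> UNIV" using P(2) \<open>Suc k \<le> DIM('d)\<close> by auto
      then obtain x where x: "x \<notin> P" by blast
      have "dim (span (insert x P)) = Suc k"
        using P x by (simp add: dim_insert span_eq_iff[THEN iffD2])
      then show "\<exists>P. subspace P \<and> dim P = Suc k \<and> span {u, v} \<subseteq> P"
        using P(3) span_superset[of "insert x P"] by (intro exI[of _ "span (insert x P)"]) auto
    qed
  qed
  then show ?thesis using s that span_superset[of "{u, v}"] by blast
qed

text \<open>In an orthonormal basis, a subspace containing \<open>e\<close> and \<open>e0\<close>
  forces \<open>\<beta> e e = \<beta> e0 e0\<close>, and one containing two distinct basis vectors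
  forces the mixed value to be 0. So the factor belonging to each subspace is compared only through
  the diagonal value at one fixed \<open>e0\<close>, and bilinearity does the rest.\<close>

lemma umbilic_form:
  fixes Q :: "'d::euclidean_space \<Rightarrow> 'd \<Rightarrow> real" and \<beta> :: "'d \<Rightarrow> 'd \<Rightarrow> 'e::euclidean_space"
  assumes Q: "inner_form Q" and \<beta>: "bilinear \<beta>" and s: "2 \<le> s" "s \<le> DIM('d)"
    and planes: "\<And>P. subspace P \<Longrightarrow> dim P = s \<Longrightarrow> \<exists>\<eta>. \<forall>u\<in>P. \<forall>v\<in>P. \<beta> u v = Q u v *\<^sub>R \<eta>"
  shows "\<exists>\<eta>. \<forall>u v. \<beta> u v = Q u v *\<^sub>R \<eta>"
proof -
  obtain E where E: "orthonormal_basis Q UNIV E" using orthonormal_basis_exists[OF Q subspace_UNIV] by metis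
  then have on: "\<And>e e'. e \<in> E \<Longrightarrow> e' \<in> E \<Longrightarrow> Q e e' = (if e = e' then 1 else 0)" and span: "span E = UNIV"
    by (auto simp: orthonormal_basis_def)
  have "E \<noteq> {}" using orthonormal_basis_card(2)[OF Q E] by auto
  then obtain e0 where e0: "e0 \<in> E" by blast
  have plane: "\<exists>\<eta>. \<forall>x\<in>{u, v}. \<forall>y\<in>{u, v}. \<beta> x y = Q x y *\<^sub>R \<eta>" for u v
  proof -
    obtain P where P: "subspace P" "dim P = s" "u \<in> P" "v \<in> P" using subspace_of_dim_containing[OF s] by metis
    then show ?thesis using planes[OF P(1,2)] by blast
  qed
  have basis: "\<beta> e e' = Q e e' *\<^sub>R \<beta> e0 e0" if e: "e \<in> E" "e' \<in> E" for e e'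
  proof (cases "e = e'")
    case True
    obtain \<eta> where "\<forall>x\<in>{e, e0}. \<forall>y\<in>{e, e0}. \<beta> x y = Q x y *\<^sub>R \<eta>" using plane by blast
    then show ?thesis using True on[OF e(1) e(1)] on[OF e0 e0] by simp
  next
    case False
    obtain \<eta> where "\<forall>x\<in>{e, e'}. \<forall>y\<in>{e, e'}. \<beta> x y = Q x y *\<^sub>R \<eta>" using plane by blast
    then show ?thesis using False on[OF e] by simp
  qed
  have b: "bilinear (\<lambda>u v. Q u v *\<^sub>R \<beta> e0 e0)"
    unfolding bilinear_def
    by (auto intro!: linearI simp: bilinear_ladd[OF inner_formD(1)[OF Q]] bilinear_radd[OF inner_formD(1)[OF Q]]
      bilinear_lmul[OF inner_formD(1)[OF Q]] bilinear_rmul[OF inner_formD(1)[OF Q]] scaleR_left_distrib)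
  have "\<beta> u v = Q u v *\<^sub>R \<beta> e0 e0" for u v
    by (rule bilinear_eq[OF \<beta> b, of UNIV E UNIV E]) (use span basis in auto)
  then show ?thesis by blast
qed


lemma pullback_inner_form:
  fixes b :: "('p::topological_space, 'd::euclidean_space) chart" and c :: "('a, 'e::euclidean_space) chart"
  assumes Q: "inner_form (g c (coord c (\<iota> p)))" and D: "linear (differential b c \<iota> p)" "inj (differential b c \<iota> p)"
  shows "inner_form (pullback_form b c g \<iota> p)"
  unfolding inner_form_def
proof (intro conjI allI impI)
  note b = inner_formD(1)[OF Q]
  show "bilinear (pullback_form b c g \<iota> p)"
    unfolding bilinear_def pullback_form_def
    by (auto intro!: linearI simp: linear_add[OF D(1)] linear_scale[OF D(1)]
      bilinear_ladd[OF b] bilinear_radd[OF b] bilinear_lmul[OF b] bilinear_rmul[OF b])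
  show "pullback_form b c g \<iota> p u v = pullback_form b c g \<iota> p v u" for u v
    unfolding pullback_form_def by (rule inner_formD(2)[OF Q])
  fix u :: 'd assume "u \<noteq> 0"
  then have "differential b c \<iota> p u \<noteq> 0" using D linear_injective_0 by blast
  then show "0 < pullback_form b c g \<iota> p u u" unfolding pullback_form_def by (rule inner_formD(3)[OF Q])
qed

lemma hessian_form_bilinear:
  assumes G: "smooth_metric V (g c)" and f: "smooth_on U (coord_rep b c \<iota>)" "open U" "coord b p \<in> U"
    and V: "coord_rep b c \<iota> (coord b p) \<in> V"
  shows "bilinear (hessian_form b c g \<iota> p)"
proof -
  let ?D = "differential b c \<iota> p"
  define D2 where "D2 u v = frechet_derivative (\<lambda>z. frechet_derivative (coord_rep b c \<iota>) (at z) v) (at (coord b p)) u" for u v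
  have l1: "linear (\<lambda>u. D2 u v)" for v
    unfolding D2_def by (rule has_derivative_linear[OF smooth_on_has_derivative[OF smooth_on_frechet_derivative[OF f(1)] f(3)]])
  have sym: "D2 u v = D2 v u" for u v
    unfolding D2_def by (rule second_derivative_symmetric[OF smooth_onD[OF f(1)] f(2,3)])
  have l2: "linear (D2 u)" for u
  proof -
    have "D2 u = (\<lambda>v. D2 v u)" by (rule ext) (rule sym)
    with l1[of u] show ?thesis by (simp only:)
  qed
  have D: "linear ?D" unfolding differential_def by (rule has_derivative_linear[OF smooth_on_has_derivative[OF f(1,3)]])
  note L = levi_civita_props(1)[OF G V]
  show ?thesis
    unfolding bilinear_def hessian_form_def D2_def[symmetric]
    by (auto intro!: linearI simp: linear_add[OF D] linear_scale[OF D] linear_add[OF l1] linear_add[OF l2]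
      linear_scale[OF l1] linear_scale[OF l2] bilinear_ladd[OF L] bilinear_radd[OF L] bilinear_lmul[OF L] bilinear_rmul[OF L]
      scaleR_right_distrib)
qed

section \<open>Reduction of umbilicity to the slices\<close>

theorem theorem8:
  fixes A :: "('a::{t2_space, second_countable_topology}, 'e::euclidean_space) chart set"
    and g :: "('a, 'e) metric_components"
    and B :: "('p::{t2_space, second_countable_topology}, 'd::euclidean_space) chart set"
    and h :: "('p, 'd) metric_components"
    and \<iota> :: "'p \<Rightarrow> 'a"
    and q :: 'p
    and m n s :: nat
  assumes "riemannian_manifold A g" and "DIM('e) = m + n"
    and "riemannian_manifold B h" and "DIM('d) = m"
    and "isometric_immersion B h A g \<iota>"
    and "m \<ge> 3" and "2 \<le> s" and "s \<le> m - 1"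
    and "\<And>M. \<lbrakk>submanifold A (s + n) M; \<iota> q \<in> M; totally_geodesic_at A g M (\<iota> q);
            \<forall>b\<in>B. \<forall>c\<in>A. q \<in> cdom b \<and> \<iota> q \<in> cdom c \<longrightarrow>
              normal_space_at b c g \<iota> q \<subseteq> tangent_space c M (\<iota> q)\<rbrakk>
          \<Longrightarrow> umbilic_at B A g \<iota> (\<iota> -` M) q"
  shows "umbilic_at B A g \<iota> UNIV q"
  unfolding umbilic_at_def
proof (intro conjI ballI impI UNIV_I)
  fix b c u\<^sub>0 v\<^sub>0
  assume bB: "b \<in> B" and cA: "c \<in> A" and q: "q \<in> cdom b \<and> \<iota> q \<in> cdom c"
  note M = assms(1) and A = riemannian_manifoldD(1)[OF assms(1)] and B = riemannian_manifoldD(1)[OF assms(3)]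
  have I: "immersion B A \<iota>" using assms(5) by (simp add: isometric_immersion_def)
  have qb: "q \<in> cdom b" and qc: "\<iota> q \<in> cdom c" using q by auto
  note bh = smooth_structureD(1)[OF B bB] and ch = smooth_structureD(1)[OF A cA]
  note imm = immersionD[OF I bB bh cA ch]
  let ?y = "coord b q" and ?Q = "g c (coord c (\<iota> q))" and ?D = "differential b c \<iota> q"
  let ?II = "second_fundamental_form b c g \<iota>" and ?H = "hessian_form b c g \<iota> q" and ?q = "pullback_form b c g \<iota> q"
  let ?\<Omega> = "coord b ` (cdom b \<inter> \<iota> -` cdom c)"
  have y\<Omega>: "?y \<in> ?\<Omega>" using qb qc by auto
  have Q: "inner_form ?Q" by (rule smooth_metricD(2)[OF riemannian_manifoldD(2)[OF M cA]]) (use qc in auto)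
  have D: "linear ?D" "inj ?D" using imm(4,5) qb qc by auto
  note bQ = inner_formD(1)[OF Q]
  obtain \<tau>0 where \<tau>0: "linear \<tau>0" "\<And>u. \<tau>0 (?D u) = u" "\<And>w. \<tau>0 w = 0 \<longleftrightarrow> (\<forall>u. ?Q w (?D u) = 0)"
    using orthogonal_left_inverse[OF Q D] by metis
  \<comment> \<open>Orthogonal projection to the normal space of \<Sigma>. It annihilates the image
    of the differential, and thus the unknown tangential terms in both second fundamental
    forms.\<close>
  define \<nu> where "\<nu> w = w - ?D (\<tau>0 w)" for w
  have lin\<nu>: "linear \<nu>" unfolding \<nu>_def
    by (auto intro!: linearI simp: linear_add[OF \<tau>0(1)] linear_add[OF D(1)] linear_scale[OF \<tau>0(1)] linear_scale[OF D(1)] scaleR_diff_right)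
  have \<nu>D: "\<nu> (w + ?D x) = \<nu> w" for w x
    by (simp add: \<nu>_def linear_add[OF \<tau>0(1)] linear_add[OF D(1)] \<tau>0(2))
  have \<nu>N: "\<nu> w = w" if "\<And>u. ?Q w (?D u) = 0" for w
    using that \<tau>0(3)[of w] by (simp add: \<nu>_def linear_0[OF D(1)])
  have tanU: "tangent_space b UNIV q = UNIV" by (rule tangent_space_UNIV[OF bh qb])
  \<comment> \<open>The whole of \<Sigma> is its own slice, flattened by the identity with
    \<open>P = UNIV\<close>. Its second fundamental form is already normal, hence fixed by
    \<nu>.\<close>
  have II: "?II UNIV q u v = \<nu> (?H u v)" for u v
  proof -
    let ?C = "coord b ` cdom b"
    note sff = second_fundamental_form_straightened[where b = b and p = q and S = UNIV and U = ?C and V = ?C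
        and \<psi> = "\<lambda>x. x" and \<kappa> = "\<lambda>x. x" and P = UNIV and u = u and v = v and c = c and \<iota> = \<iota> and g = g and \<Omega> = ?\<Omega>]
    have *: "smooth_on ?C (\<lambda>x. x)" "open ?C" "homeomorphism ?C ?C (\<lambda>x. x) (\<lambda>x. x)"
      using chart_inverse(7)[OF bh] by (auto intro!: smooth_on_linear bounded_linear_ident simp: homeomorphism_def)
    obtain x where x: "?II UNIV q u v = ?H u v + ?D x"
      using sff(1)[OF bh _ *(1,1,2,2,3) _ _ subspace_UNIV _ imm(2,1) y\<Omega> Q] qb tanU by auto
    have "?Q (?II UNIV q u v) (?D w) = 0" for w
      using sff(2)[OF bh _ *(1,1,2,2,3) _ _ subspace_UNIV _ imm(2,1) y\<Omega> Q, of w] qb tanU by auto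
    then have "?II UNIV q u v = \<nu> (?II UNIV q u v)" using \<nu>N by metis
    then show ?thesis using x \<nu>D by metis
  qed
  have bil: "bilinear (\<lambda>u v. \<nu> (?H u v))"
  proof -
    have "coord_rep b c \<iota> ?y \<in> coord c ` cdom c" using qc by (simp add: coord_rep_coord[OF bh qb])
    then have b: "bilinear ?H" by (rule hessian_form_bilinear[where b = b and c = c and g = g and \<iota> = \<iota> and p = q, OF riemannian_manifoldD(2)[OF M cA] imm(2,1) y\<Omega>])
    show ?thesis unfolding bilinear_def
      by (auto intro!: linearI simp: bilinear_ladd[OF b] bilinear_radd[OF b] bilinear_lmul[OF b] bilinear_rmul[OF b]
        linear_add[OF lin\<nu>] linear_scale[OF lin\<nu>])
  qed
  \<comment> \<open>A second chart at the same point: slices are built in the normal chart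
    \<open>c'\<close>, while second fundamental forms continue to be computed in the given chart
    \<open>c\<close>, in which the conclusion is demanded.\<close>
  obtain c' where c': "c' \<in> A" "\<iota> q \<in> cdom c'" "coord c' (\<iota> q) = 0"
    and normal: "\<And>y l. y \<in> coord c' ` cdom c' \<Longrightarrow> \<bar>l\<bar> \<le> 1 \<Longrightarrow> l *\<^sub>R y \<in> coord c' ` cdom c' \<Longrightarrow>
      levi_civita (g c') (l *\<^sub>R y) y y = 0"
    using normal_chart[OF M cA qc] by metis
  note ch' = smooth_structureD(1)[OF A c'(1)]
  note imm' = immersionD[OF I bB bh c'(1) ch']
  let ?Q' = "g c' 0" and ?D' = "differential b c' \<iota> q"
  let ?\<Omega>' = "coord b ` (cdom b \<inter> \<iota> -` cdom c')"
  have y\<Omega>': "?y \<in> ?\<Omega>'" using qb c' by auto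
  have "0 \<in> coord c' ` cdom c'" using c'(2,3) by force
  then have Q': "inner_form ?Q'" by (rule smooth_metricD(2)[OF riemannian_manifoldD(2)[OF M c'(1)]])
  have D': "linear ?D'" "inj ?D'" using imm'(4,5) qb c' by auto
  obtain \<tau> where \<tau>: "linear \<tau>" "\<And>u. \<tau> (?D' u) = u" "\<And>w. \<tau> w = 0 \<longleftrightarrow> (\<forall>u. ?Q' w (?D' u) = 0)"
    using orthogonal_left_inverse[OF Q' D'] by metis
  have dimN: "dim {w. \<tau> w = 0} = n"
    using dim_preimage_left_inverse[OF D'(1) \<tau>(1,2) subspace_UNIV] assms(2,4) by simp
  \<comment> \<open>This map does not depend on \<open>P\<close>, and its derivative at
    \<open>q\<close> is the identity because \<tau> inverts the differential. One neighbourhood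
    therefore flattens all intersections below.\<close>
  define \<psi> where "\<psi> x = \<tau> (coord_rep b c' \<iota> x)" for x
  have b\<tau>: "bounded_linear \<tau>" using \<tau>(1) by (simp add: linear_conv_bounded_linear)
  have sm\<psi>: "smooth_on ?\<Omega>' \<psi>" unfolding \<psi>_def[abs_def] by (rule smooth_on_linear_compose[OF b\<tau> imm'(2,1)])
  have "(\<psi> has_derivative (\<lambda>v. \<tau> (?D' v))) (at ?y)"
    unfolding \<psi>_def[abs_def] by (rule bounded_linear.has_derivative[OF b\<tau> imm'(3)[OF qb c'(2)]])
  then have D\<psi>: "frechet_derivative \<psi> (at ?y) = (\<lambda>v. v)" using frechet_derivative_at \<tau>(2) by fastforce
  have inj\<psi>: "inj (frechet_derivative \<psi> (at ?y))" unfolding D\<psi> by (simp add: inj_on_def)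
  obtain U V \<kappa> where U: "open U" "U \<subseteq> ?\<Omega>'" "?y \<in> U" and V: "open V"
    and hom: "homeomorphism U V \<psi> \<kappa>" and \<kappa>: "smooth_on V \<kappa>"
    using smooth_inverse_function[OF imm'(1) sm\<psi> y\<Omega>' inj\<psi>] by metis
  note \<psi>U = smooth_on_subset[OF sm\<psi> U(2)]
  have Ub: "U \<subseteq> coord b ` cdom b" using U(2) by blast
  have planes: "\<exists>\<eta>. \<forall>u\<in>P. \<forall>v\<in>P. \<nu> (?H u v) = ?q u v *\<^sub>R \<eta>" if P: "subspace P" "dim P = s" for P
  proof -
    \<comment> \<open>Contains the kernel of \<tau>, that is the normal space, because 0 lies in
      \<open>P\<close>; its dimension is that of \<open>P\<close> plus \<open>n\<close>.\<close>
    define W where "W = {w. \<tau> w \<in> P}"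
    have W: "subspace W" unfolding W_def using \<tau>(1) P(1) by (auto simp: subspace_def linear_0 linear_add linear_scale)
    have dimW: "dim W = s + n"
      unfolding W_def using dim_preimage_left_inverse[OF D'(1) \<tau>(1,2) P(1)] dimN P(2) by simp
    define N where "N = {p \<in> cdom c'. coord c' p \<in> W}"
    have Niff: "p \<in> N \<longleftrightarrow> p \<in> cdom c' \<and> coord c' p \<in> W" for p by (auto simp: N_def)
    note slice = normal_slice[OF M c' normal W Niff]
    \<comment> \<open>The hypothesis asks for the inclusion in every pair of charts. A normal vector
      is carried to the charts \<open>b\<close> and \<open>c'\<close>, where normality is tested
      against the same tangent vectors; there \<open>W\<close> contains it, and the tangent space is
      carried back.\<close>
    have "normal_space_at b2 c2 g \<iota> q \<subseteq> tangent_space c2 N (\<iota> q)"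
      if b2: "b2 \<in> B" and c2: "c2 \<in> A" and q2: "q \<in> cdom b2 \<and> \<iota> q \<in> cdom c2" for b2 c2
    proof
      fix w assume w: "w \<in> normal_space_at b2 c2 g \<iota> q"
      note ch2 = smooth_structureD(1)[OF A c2]
      let ?T = "frechet_derivative (transition c2 c') (at (coord c2 (\<iota> q)))"
      have "?Q' (?T w) (?D' u) = 0" for u
      proof -
        let ?u = "frechet_derivative (transition b b2) (at ?y) u"
        have "?D' u = ?T (differential b2 c2 \<iota> q ?u)"
          using differential_target_change[OF I bB bh A c2 c'(1) qb _ c'(2), of u]
            differential_source_change[OF I B bB b2 c2 ch2 qb, of u] q2 by simp
        then have "?Q' (?T w) (?D' u) = g c2 (coord c2 (\<iota> q)) w (differential b2 c2 \<iota> q ?u)"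
          using riemannian_manifoldD(3)[OF M c2 c'(1), of "coord c2 (\<iota> q)"] q2 c' transition_coord[OF ch2, of "\<iota> q" c'] by simp
        then show ?thesis using w by (simp add: normal_space_at_def)
      qed
      then have "?T w \<in> W" using \<tau>(3)[of "?T w"] subspace_0[OF P(1)] by (simp add: W_def)
      then have "?T w \<in> tangent_space c' N (\<iota> q)" using slice(3) by simp
      from tangent_space_chart_change[OF A c'(1) c2 c'(2) _ this] q2
      show "w \<in> tangent_space c2 N (\<iota> q)"
        using transition_derivative_inverse[OF A c2 c'(1) _ c'(2), of w] by simp
    qed
    then have umb: "umbilic_at B A g \<iota> (\<iota> -` N) q"
      using slice(1,2,4) dimW by (intro assms(9)) auto
    let ?S = "\<iota> -` N"
    have S: "p \<in> ?S \<longleftrightarrow> \<psi> (coord b p) \<in> P" if p: "p \<in> cdom b" "coord b p \<in> U" for p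
    proof -
      obtain p' where p': "p' \<in> cdom b" "\<iota> p' \<in> cdom c'" "coord b p = coord b p'" using p(2) U(2) by auto
      then have "p = p'" using p chart_inverse(1)[OF bh] by metis
      then show ?thesis using p' by (simp add: Niff W_def \<psi>_def coord_rep_coord[OF bh p'(1), of c' \<iota>])
    qed
    have qS: "q \<in> cdom b \<inter> ?S" using qb slice(2) by simp
    \<comment> \<open>As the derivative of \<psi> is the identity, the tangent space of the
      intersection is the prescribed \<open>P\<close> itself and not merely an isomorphic
      copy.\<close>
    have tan: "tangent_space b ?S q = P"
      using tangent_space_straightened[OF bh qS \<psi>U \<kappa> U(1) V hom U(3) Ub P(1) S] by (simp add: D\<psi>)
    have umb': "?II ?S q u v = ?q u v *\<^sub>R mean_curvature b c g \<iota> ?S q" if "u \<in> P" "v \<in> P" for u v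
      using umb bB cA q that tan unfolding umbilic_at_def by blast
    \<comment> \<open>The mean curvature vector of the intersection is normal to the intersection
      but may have a component tangent to \<Sigma>; after \<nu> the factor is a vector normal to
      \<Sigma>, and the left side no longer refers to the intersection.\<close>
    have "\<nu> (?H u v) = ?q u v *\<^sub>R \<nu> (mean_curvature b c g \<iota> ?S q)" if uv: "u \<in> P" "v \<in> P" for u v
    proof -
      obtain x where x: "?II ?S q u v = ?H u v + ?D x"
        using second_fundamental_form_straightened(1)[where b = b and c = c and g = g and \<iota> = \<iota> and p = q
            and u = u and v = v, OF bh qS \<psi>U \<kappa> U(1) V hom U(3) Ub P(1) S imm(2,1) y\<Omega> Q] uv tan by auto
      have "\<nu> (?H u v) = \<nu> (?II ?S q u v)" unfolding x \<nu>D ..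
      also have "\<dots> = ?q u v *\<^sub>R \<nu> (mean_curvature b c g \<iota> ?S q)"
        unfolding umb'[OF uv] by (rule linear_scale[OF lin\<nu>])
      finally show ?thesis .
    qed
    then show ?thesis by blast
  qed
  have q0: "inner_form ?q" by (rule pullback_inner_form[where b = b and c = c and g = g and \<iota> = \<iota> and p = q, OF Q D])
  have "s \<le> DIM('d)" using assms(4,8) by simp
  then obtain \<eta> where \<eta>: "\<And>u v. ?II UNIV q u v = ?q u v *\<^sub>R \<eta>"
    using umbilic_form[OF q0 bil assms(7) _ planes] unfolding II by blast
  \<comment> \<open>The orthonormal basis in the definition is an arbitrary choice, but every
    diagonal value equals \<eta> and every such basis has \<open>m\<close> elements, so the average
    is \<eta>.\<close>
  have "mean_curvature b c g \<iota> UNIV q = \<eta>"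
  proof -
    define E where "E = (SOME E. orthonormal_basis ?q UNIV E)"
    obtain E' where "orthonormal_basis ?q UNIV E'" using orthonormal_basis_exists[OF q0 subspace_UNIV] by metis
    then have E: "orthonormal_basis ?q UNIV E" unfolding E_def by (rule someI)
    have "(\<Sum>e\<in>E. ?II UNIV q e e) = (\<Sum>e\<in>E. \<eta>)"
      using E by (intro sum.cong) (auto simp: \<eta> orthonormal_basis_def)
    also have "\<dots> = real m *\<^sub>R \<eta>" using orthonormal_basis_card(2)[OF q0 E] assms(4) by (simp add: sum_constant_scaleR)
    finally show ?thesis using assms(4,6) unfolding mean_curvature_def tanU E_def[symmetric] by simp
  qed
  then show "?II UNIV q u\<^sub>0 v\<^sub>0 = ?q u\<^sub>0 v\<^sub>0 *\<^sub>R mean_curvature b c g \<iota> UNIV q" using \<eta> by simp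
qed

end
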